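(* Let $\mathbb{F}_q$ be the finite field with $q$ elements, $K=\mathbb{F}_q(\theta)$, and $K_\infty=\mathbb{F}_q(\!(\tfrac{1}{\theta})\!)$. Let $\lambda_\theta$ be a $(q-1)$-th root of $-\theta$ in a separable closure of $K$, and let \[ \tilde{\pi}=\lambda_\theta\, \theta \prod_{j\ge 1}\bigl(1-\theta^{1-q^j}\bigr)^{-1}\in K_\infty(\lambda_\theta) \] be the Carlitz period. Then $\tilde{\pi}$ is hypertranscendental over $K$, i.e. the set $\{\partial_\theta^{(n)}(\tilde{\pi}) \mid n\ge 0\}$ is algebraically independent over $K$.
   Context: The hyperdifferential operators with respect to $\theta$, $(\partial_\theta^{(n)})_{n\ge 0}$, are defined on $K_\infty$ by $\partial_\theta^{(n)}\bigl(\sum_{i\ge i_0} c_i\theta^{-i}\bigr)=\sum_{i\ge i_0} c_i\binom{-i}{n}\theta^{-i-n}$ (with $c_i\in\mathbb{F}_q$); this family is a higher derivation (i.e. $\partial^{(0)}_\theta=\mathrm{id}$, each $\partial^{(n)}_\theta$ is $\mathbb{F}_q$-linear and $\partial_\theta^{(n)}(fg)=\sum_{i+j=n}\partial_\theta^{(i)}(f)\partial_\theta^{(j)}(g)$), and it is extended to the separable algebraic extension $K_\infty(\lambda_\theta)$ as the unique higher derivation extending it. *)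

theory Defs
  imports
    "HOL.Binomial_Plus"
    "HOL-Analysis.Infinite_Products"
    "HOL-Library.Poly_Mapping"
    "HOL.Hull"
    "HOL-Computational_Algebra.Formal_Laurent_Series"
    "HOL-Algebra.Algebraic_Closure_Type"
begin

text \<open>
  The finite field \<open>F_q\<close> is a type \<open>'a\<close> of class \<open>{field, finite}\<close>, so \<open>q = CARD('a)\<close>.
  The completion \<open>K_\<infinity> = F_q((1/\<theta>))\<close> is the type \<open>'a fls\<close>, whose formal variable
  \<^const>\<open>fls_X\<close> plays the role of \<open>1/\<theta>\<close>: the coefficient \<open>fls_nth f i\<close> is the coefficient of
  \<open>\<theta>\<^sup>-\<^sup>i\<close>, and the library metric on \<open>'a fls\<close> induces the \<open>1/\<theta>\<close>-adic topology.
  All algebraic extensions live in the algebraic closure \<open>'a fls alg_closure\<close> of \<open>K_\<infinity>\<close>,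
  into which \<open>K_\<infinity>\<close> is embedded by \<^const>\<open>to_ac\<close>.
\<close>

definition theta :: "'a::field fls" where
  "theta = fls_X_inv"

definition rational_functions :: "'a::field fls set" where
  "rational_functions =
     {poly (map_poly fls_const a) theta / poly (map_poly fls_const b) theta | a b. b \<noteq> 0}"


definition is_subfield :: "'b::field set \<Rightarrow> bool" where
  "is_subfield F \<longleftrightarrow> 0 \<in> F \<and> 1 \<in> F \<and>
     (\<forall>x\<in>F. \<forall>y\<in>F. x + y \<in> F \<and> x * y \<in> F) \<and> (\<forall>x\<in>F. - x \<in> F \<and> inverse x \<in> F)"

definition field_adjoin :: "'b::field set \<Rightarrow> 'b \<Rightarrow> 'b set" where
  "field_adjoin F x = is_subfield hull (insert x F)"

text \<open>
  For a subfield \<open>F\<close> of an algebraically closed field, the roots of the separable polynomials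
  over \<open>F\<close> form a separable closure of \<open>F\<close>. A polynomial is separable iff it has no
  multiple root in the algebraically closed field, that is, iff it is \<^const>\<open>rsquarefree\<close> there.
\<close>

definition separable_closure :: "'b::alg_closed_field set \<Rightarrow> 'b set" where
  "separable_closure F = {x. \<exists>p. (\<forall>i. coeff p i \<in> F) \<and> rsquarefree p \<and> poly p x = 0}"


text \<open>The binomial coefficient \<open>(a choose n)\<close> for an integer \<open>a\<close> of either sign.\<close>

definition int_binomial :: "int \<Rightarrow> nat \<Rightarrow> int" where
  "int_binomial a n = (\<Prod>i=0..<n. a - int i) div fact n"

lemma of_int_int_binomial:
  "(of_int (int_binomial a n) :: 'b::field_char_0) = of_int a gchoose n"
proof -
  have "fact n dvd (\<Prod>i=0..<n. a - int i)"
    by (simp only: falling_fact_pochhammer' fact_dvd_pochhammer)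
  then have "fact n * int_binomial a n = (\<Prod>i=0..<n. a - int i)"
    by (simp add: int_binomial_def)
  then have "(of_int (fact n * int_binomial a n) :: 'b) = of_int (\<Prod>i=0..<n. a - int i)"
    by (simp only:)
  then have "fact n * of_int (int_binomial a n) = (fact n * (of_int a gchoose n) :: 'b)"
    by (simp add: gbinomial_mult_fact)
  then show ?thesis by simp
qed

definition fls_hyperderiv :: "nat \<Rightarrow> 'a::field fls \<Rightarrow> 'a fls" where
  "fls_hyperderiv n f =
     Abs_fls (\<lambda>k. let i = k - int n in fls_nth f i * of_int (int_binomial (- i) n))"

lemma fls_hyperderiv_nth:
  "fls_nth (fls_hyperderiv n f) (i + int n) = fls_nth f i * of_int (int_binomial (- i) n)"
proof -
  have "fls_nth (fls_hyperderiv n f) k = fls_nth f (k - int n) * of_int (int_binomial (- (k - int n)) n)" for k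
    unfolding fls_hyperderiv_def Let_def
    by (rule nth_Abs_fls_lower_bound[of "fls_subdegree f"]) simp
  then show ?thesis by simp
qed

definition higher_derivation_on ::
  "'b::field set \<Rightarrow> 'b set \<Rightarrow> (nat \<Rightarrow> 'b \<Rightarrow> 'b) \<Rightarrow> bool" where
  "higher_derivation_on C F D \<longleftrightarrow>
     (\<forall>n. \<forall>x\<in>F. D n x \<in> F) \<and>
     (\<forall>x\<in>F. D 0 x = x) \<and>
     (\<forall>n. \<forall>x\<in>F. \<forall>y\<in>F. D n (x + y) = D n x + D n y) \<and>
     (\<forall>n. \<forall>c\<in>C. \<forall>x\<in>F. D n (c * x) = c * D n x) \<and>
     (\<forall>n. \<forall>x\<in>F. \<forall>y\<in>F. D n (x * y) = (\<Sum>i\<le>n. D i x * D (n - i) y))"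


text \<open>A polynomial in commuting variables indexed by \<open>'i\<close> is a finitely supported function
  from monomials \<open>'i \<Rightarrow>\<^sub>0 nat\<close> to coefficients.\<close>

definition mpoly_eval ::
  "('i \<Rightarrow> 'b::comm_ring_1) \<Rightarrow> (('i \<Rightarrow>\<^sub>0 nat) \<Rightarrow>\<^sub>0 'b) \<Rightarrow> 'b" where
  "mpoly_eval x P =
     (\<Sum>m\<in>Poly_Mapping.keys P. Poly_Mapping.lookup P m *
       (\<Prod>i\<in>Poly_Mapping.keys m. x i ^ Poly_Mapping.lookup m i))"

text \<open>Independence is that of the family \<open>(x i)\<close>; it entails that the \<open>x i\<close> are pairwise
  distinct and that the set of the \<open>x i\<close> is algebraically independent.\<close>

definition algebraically_independent :: "'b::field set \<Rightarrow> ('i \<Rightarrow> 'b) \<Rightarrow> bool" where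
  "algebraically_independent F x \<longleftrightarrow>
     (\<forall>P. (\<forall>m. Poly_Mapping.lookup P m \<in> F) \<and> P \<noteq> 0 \<longrightarrow> mpoly_eval x P \<noteq> 0)"

definition hypertranscendental ::
  "'b::field set \<Rightarrow> (nat \<Rightarrow> 'b \<Rightarrow> 'b) \<Rightarrow> 'b \<Rightarrow> bool" where
  "hypertranscendental F D x \<longleftrightarrow> algebraically_independent F (\<lambda>n. D n x)"


text \<open>The product over \<open>j \<ge> 1\<close> is shifted to start at \<open>j = 0\<close>.\<close>

definition carlitz_period ::
  "'a::{field,finite} fls alg_closure \<Rightarrow> 'a fls alg_closure" where
  "carlitz_period lam =
     lam * to_ac (theta * prodinf (\<lambda>j. inverse (1 - theta powi (1 - int (CARD('a) ^ Suc j)))))"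

end

theory Submission
  imports Defs
begin

text \<open>
  Write \<open>f(t, w)\<close> for the product of \<open>1 / (1 - t w^(q^j))\<close> over \<open>j \<ge> 0\<close>, so that
  \<open>f(t, w\<^sup>q) = (1 - t w) f(t, w)\<close>. The factors \<open>theta^(q^j)\<close> with \<open>q\<^sup>j > n\<close> are constants for the first
  \<open>n\<close> hyperderivations, so the hyperderivatives of the Carlitz period are, up to an invertible linear
  change of variables over \<open>K(lam)\<close>, the Taylor coefficients of \<open>f(t, w)\<close> in \<open>t\<close> at
  \<open>t = theta\<close>, \<open>w = theta^(-q^N)\<close>.

  These Taylor coefficients, as functions of \<open>w\<close>, are algebraically independent over \<open>F\<^sub>q(t, w)\<close>:
  specialize \<open>t\<close> to a point of degree \<open>l\<close> over \<open>F\<^sub>q\<close>. There they generate a Kummer and Artin-Schreier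
  tower, totally ramified at \<open>w = 1/t\<close> of degree \<open>(Q - 1) Q^(r - 1)\<close> with \<open>Q = q\<^sup>l\<close>, as for Carlitz
  torsion points, so they satisfy no relation of degree less than \<open>Q - 1\<close>. Mahler's method carries
  the independence over to the values.
\<close>


section \<open>Linear algebra over integral domains\<close>

text \<open>A hyperderivative of the period sees \<open>theta\<close> twice, in the parameter t and
  in the point w. Splitting off the factors of small index turns w into a constant to the order in
  question. This is why the work is done on tails of the product. A relation at one level M is
  carried to every level N by inverting the functional equation. The transported coefficients vary
  with N and have degree O(q^N), and Mahler's method shows that they vanish for large N. To return
  to the original relation, the transport is set up as an identity for every solution of the
  recursion, whatever its initial vector, and not only for the tails. Once the right-hand side is 0,
  the original polynomial vanishes at all points. At a point of degree l the power f(t, w)^(Q - 1)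
  is a polynomial in w, so independence there fails from degree Q - 1 on. Hence the degree of the
  relation must be known before the point is chosen. The root \<open>lam\<close> contributes only
  through the total degree of a monomial modulo q - 1, which splits a relation into pieces free of
  \<open>lam\<close>.\<close>

lemma homogeneous_system_nontrivial:
  fixes E :: "'e set" and M :: "'m set" and A :: "'e \<Rightarrow> 'm \<Rightarrow> 'r::idom"
  assumes "finite E" "finite M" "card E < card M"
  shows "\<exists>v. (\<exists>m\<in>M. v m \<noteq> 0) \<and> (\<forall>e\<in>E. (\<Sum>m\<in>M. A e m * v m) = 0)"
  using assms
proof (induction E arbitrary: M A rule: finite_induct)
  case empty
  then obtain m where "m \<in> M" by fastforce
  then show ?case by (intro exI[of _ "\<lambda>_. 1"]) auto
next
  case (insert e E)
  show ?case
  proof (cases "\<forall>m\<in>M. A e m = 0")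
    case True
    obtain v where "\<exists>m\<in>M. v m \<noteq> 0" "\<forall>e\<in>E. (\<Sum>m\<in>M. A e m * v m) = 0"
      using insert.IH[of M A] insert.prems insert.hyps by auto
    with True show ?thesis by (intro exI[of _ v]) auto
  next
    case False
    then obtain u where u: "u \<in> M" "A e u \<noteq> 0" by blast
    define M' where "M' = M - {u}"
    have M': "finite M'" "u \<notin> M'" "M = insert u M'" "card E < card M'"
      using insert.prems insert.hyps u by (auto simp: M'_def)
    obtain v where v: "\<exists>m\<in>M'. v m \<noteq> 0"
      "\<forall>f\<in>E. (\<Sum>m\<in>M'. (A e u * A f m - A f u * A e m) * v m) = 0"
      using insert.IH[of M' "\<lambda>f m. A e u * A f m - A f u * A e m"] M' by blast
    \<comment> \<open>Solves the equation \<open>e\<close> for the pivot unknown \<open>u\<close>,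
      with everything multiplied by the pivot \<open>A e u\<close> so that no division
      occurs.\<close>
    define w where "w m = (if m = u then - (\<Sum>m\<in>M'. A e m * v m) else A e u * v m)" for m
    have sum_w: "(\<Sum>m\<in>M. A f m * w m)
        = A e u * (\<Sum>m\<in>M'. A f m * v m) - A f u * (\<Sum>m\<in>M'. A e m * v m)" for f
    proof -
      have "(\<Sum>m\<in>M'. A f m * w m) = (\<Sum>m\<in>M'. A e u * (A f m * v m))"
        using M'(2) by (intro sum.cong) (auto simp: w_def)
      then show ?thesis using M'(1,2) unfolding M'(3)
        by (simp add: w_def sum_distrib_left)
    qed
    have "(\<Sum>m\<in>M. A f m * w m) = 0" if "f \<in> E" for f
    proof -
      have "(\<Sum>m\<in>M'. (A e u * A f m - A f u * A e m) * v m) = 0" using v that by blast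
      then show ?thesis unfolding sum_w
        by (simp add: sum_distrib_left left_diff_distrib sum_subtractf mult.assoc)
    qed
    moreover have "(\<Sum>m\<in>M. A e m * w m) = 0" by (simp add: sum_w)
    moreover have "\<exists>m\<in>M. w m \<noteq> 0"
      using v(1) u M' by (auto simp: w_def)
    ultimately show ?thesis by blast
  qed
qed

text \<open>A submodule of deficient rank lies in a hyperplane; one of full rank contains a multiple
  of the standard lattice. The induction splits off a coordinate \<open>u\<close>: an element
  \<open>x\<close> with \<open>x u\<close> nonzero and the kernel \<open>T'\<close> of the
  coordinate together describe \<open>T\<close> up to the factor \<open>x u\<close>.\<close>

lemma submodule_annihilator_or_full_rank:
  fixes T :: "('i \<Rightarrow> 'r::idom) set"
  assumes "finite I"
    and add: "\<And>v w. v \<in> T \<Longrightarrow> w \<in> T \<Longrightarrow> (\<lambda>i. v i + w i) \<in> T"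
    and scale: "\<And>c v. v \<in> T \<Longrightarrow> (\<lambda>i. c * v i) \<in> T"
    and supp: "\<And>v i. v \<in> T \<Longrightarrow> i \<notin> I \<Longrightarrow> v i = 0"
    and zero: "(\<lambda>_. 0) \<in> T"
  shows "(\<exists>R. (\<exists>i\<in>I. R i \<noteq> 0) \<and> (\<forall>v\<in>T. (\<Sum>i\<in>I. R i * v i) = 0)) \<or>
    (\<exists>\<Delta>. \<Delta> \<noteq> 0 \<and> (\<forall>i\<in>I. (\<lambda>j. if j = i then \<Delta> else 0) \<in> T))"
  using assms
proof (induction I arbitrary: T rule: finite_induct)
  case empty
  then show ?case by (intro disjI2 exI[of _ 1]) auto
next
  case (insert u I)
  note add = insert.prems(1) and scale = insert.prems(2) and supp = insert.prems(3) and zero = insert.prems(4)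
  show ?case
  proof (cases "\<forall>v\<in>T. v u = 0")
    case True
    have "(\<Sum>i\<in>insert u I. (if i = u then 1 else 0) * v i) = 0" if "v \<in> T" for v
      using True that by (intro sum.neutral) auto
    then show ?thesis by (intro disjI1 exI[of _ "\<lambda>i. if i = u then 1 else 0"]) auto
  next
    case False
    then obtain x where x: "x \<in> T" "x u \<noteq> 0" by blast
    define T' where "T' = {v \<in> T. v u = 0}"
    have "(\<exists>R. (\<exists>i\<in>I. R i \<noteq> 0) \<and> (\<forall>v\<in>T'. (\<Sum>i\<in>I. R i * v i) = 0)) \<or>
      (\<exists>\<Delta>. \<Delta> \<noteq> 0 \<and> (\<forall>i\<in>I. (\<lambda>j. if j = i then \<Delta> else 0) \<in> T'))"
    proof (rule insert.IH)
      fix v i assume "v \<in> T'" "i \<notin> I"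
      then show "v i = 0" using supp[of v i] by (cases "i = u") (auto simp: T'_def)
    qed (use add scale zero in \<open>auto simp: T'_def\<close>)
    then show ?thesis
    proof (elim disjE exE conjE)
      fix R assume R: "\<exists>i\<in>I. R i \<noteq> 0" "\<forall>v\<in>T'. (\<Sum>i\<in>I. R i * v i) = 0"
      \<comment> \<open>\<open>x u * v - v u * x\<close> lies in \<open>T'\<close> for every
        \<open>v\<close> in \<open>T\<close>, so a functional that kills \<open>T'\<close> only has
        to be extended to \<open>u\<close> in such a way that it kills \<open>x\<close>.\<close>
      define R' where "R' i = (if i = u then - (\<Sum>i\<in>I. R i * x i) else x u * R i)" for i
      have sum_R': "(\<Sum>i\<in>insert u I. R' i * v i)
          = x u * (\<Sum>i\<in>I. R i * v i) - v u * (\<Sum>i\<in>I. R i * x i)" for v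
      proof -
        have "(\<Sum>i\<in>I. R' i * v i) = (\<Sum>i\<in>I. x u * (R i * v i))"
          using insert.hyps by (intro sum.cong) (auto simp: R'_def)
        then show ?thesis using insert.hyps by (simp add: R'_def sum_distrib_left mult_ac)
      qed
      have "(\<Sum>i\<in>insert u I. R' i * v i) = 0" if "v \<in> T" for v
      proof -
        have "(\<lambda>i. x u * v i + (- v u) * x i) \<in> T" by (intro add scale that x)
        then have mem: "(\<lambda>i. x u * v i + (- v u) * x i) \<in> T'" by (simp add: T'_def)
        have "(\<Sum>i\<in>I. R i * (x u * v i + (- v u) * x i)) = 0" using bspec[OF R(2) mem] .
        then show ?thesis unfolding sum_R'
          by (simp add: algebra_simps sum_distrib_left sum_subtractf)
      qed
      moreover have "\<exists>i\<in>insert u I. R' i \<noteq> 0" using R(1) x insert.hyps by (auto simp: R'_def)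
      ultimately show ?thesis by blast
    next
      fix \<Delta> :: 'r assume D: "\<Delta> \<noteq> 0" "\<forall>i\<in>I. (\<lambda>j. if j = i then \<Delta> else 0) \<in> T'"
      have span: "(\<lambda>j. if j \<in> J then \<Delta> * c j else 0) \<in> T" if "J \<subseteq> I" for J c
        using finite_subset[OF that insert.hyps(1)] that
      proof (induction J rule: finite_induct)
        case (insert i J)
        have "(\<lambda>j. c i * (if j = i then \<Delta> else 0) + (if j \<in> J then \<Delta> * c j else 0)) \<in> T"
          using insert D(2) by (intro add scale) (auto simp: T'_def)
        moreover have "(\<lambda>j. c i * (if j = i then \<Delta> else 0) + (if j \<in> J then \<Delta> * c j else 0))
            = (\<lambda>j. if j \<in> insert i J then \<Delta> * c j else 0)"
          using insert.hyps by auto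
        ultimately show ?case by simp
      qed (simp add: zero)
      have "(\<lambda>j. \<Delta> * x j + (-1) * (if j \<in> I then \<Delta> * x j else 0)) \<in> T"
        by (intro add scale x span) auto
      moreover have "(\<lambda>j. \<Delta> * x j + (-1) * (if j \<in> I then \<Delta> * x j else 0))
          = (\<lambda>j. if j = u then \<Delta> * x u else 0)"
        using supp[OF x(1)] insert.hyps by auto
      ultimately have eu: "(\<lambda>j. if j = u then \<Delta> * x u else 0) \<in> T" by simp
      have "(\<lambda>j. if j = i then \<Delta> * x u else 0) \<in> T" if "i \<in> I" for i
      proof -
        have "(\<lambda>j. x u * (if j = i then \<Delta> else 0)) \<in> T" using D that by (intro scale) (auto simp: T'_def)
        moreover have "(\<lambda>j. x u * (if j = i then \<Delta> else 0)) = (\<lambda>j. if j = i then \<Delta> * x u else 0)" by auto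
        ultimately show ?thesis by simp
      qed
      with eu D x show ?thesis by (intro disjI2 exI[of _ "\<Delta> * x u"]) auto
    qed
  qed
qed

text \<open>This substitutes for extending the valuation of \<open>p\<close> to a finite extension.\<close>

lemma bounded_denominator:
  fixes h :: "'r::idom \<Rightarrow> 's::idom" and p :: 'r
  assumes h: "h 0 = 0" "\<And>x y. h (x + y) = h x + h y" "\<And>x y. h (x * y) = h x * h y" "inj h"
    and p: "p \<noteq> 0" and "finite J"
  shows "\<exists>\<Delta>. \<Delta> \<noteq> 0 \<and> (\<forall>k x g. h x = h (p ^ k) * (\<Sum>j\<in>J. h (g j) * z j) \<longrightarrow> p ^ k dvd \<Delta> * x)"
  using assms(6)
proof (induction J rule: finite_induct)
  case empty
  have "h x = 0 \<Longrightarrow> x = 0" for x using h(1,4) by (metis injD)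
  then show ?case by (intro exI[of _ 1]) auto
next
  case (insert u J)
  have h0: "h x = 0 \<longleftrightarrow> x = 0" for x using h(1,4) by (metis injD)
  have hm: "h (- x) = - h x" for x
    using h(1) h(2)[of x "- x"] by (simp add: eq_neg_iff_add_eq_0 add.commute)
  obtain \<Delta> where D: "\<Delta> \<noteq> 0"
    "\<And>k x g. h x = h (p ^ k) * (\<Sum>j\<in>J. h (g j) * z j) \<Longrightarrow> p ^ k dvd \<Delta> * x"
    using insert.IH by blast
  show ?case
  \<comment> \<open>If \<open>z u\<close> depends linearly on 1 and the other \<open>z j\<close>, it
    can be eliminated at the cost of the factor \<open>a\<close> in the denominator. Otherwise its
    coefficient is forced to be 0.\<close>
  proof (cases "\<exists>a b g. a \<noteq> 0 \<and> h a * z u = h b + (\<Sum>j\<in>J. h (g j) * z j)")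
    case True
    then obtain a b g where a: "a \<noteq> 0" "h a * z u = h b + (\<Sum>j\<in>J. h (g j) * z j)" by blast
    have dvd: "p ^ k dvd (\<Delta> * a) * x" if x: "h x = h (p ^ k) * (\<Sum>j\<in>insert u J. h (f j) * z j)" for k x f
    proof -
      have "h (a * x + - (p ^ k * (f u * b))) = h (p ^ k) * (h (f u) * (h a * z u)
          + (\<Sum>j\<in>J. h a * (h (f j) * z j)) - h (f u) * h b)"
      proof -
        have "h (a * x + - (p ^ k * (f u * b))) = h a * h x - h (p ^ k) * (h (f u) * h b)"
          by (simp only: h hm) simp
        then show ?thesis using x insert.hyps
          by (simp add: sum_distrib_left algebra_simps)
      qed
      also have "\<dots> = h (p ^ k) * (\<Sum>j\<in>J. h (f u * g j + a * f j) * z j)"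
        unfolding a(2) by (simp add: h sum_distrib_left algebra_simps sum.distrib)
      finally have "p ^ k dvd \<Delta> * (a * x + - (p ^ k * (f u * b)))" by (rule D(2))
      then have "p ^ k dvd \<Delta> * (a * x + - (p ^ k * (f u * b))) + p ^ k * (\<Delta> * f u * b)" by (intro dvd_add) auto
      also have "\<Delta> * (a * x + - (p ^ k * (f u * b))) + p ^ k * (\<Delta> * f u * b) = \<Delta> * a * x" by (simp add: algebra_simps)
      finally show ?thesis .
    qed
    show ?thesis
    proof (rule exI[of _ "\<Delta> * a"], intro conjI allI impI)
      show "\<Delta> * a \<noteq> 0" using a(1) D(1) by simp
    qed (rule dvd)
  next
    case False
    have dvd: "p ^ k dvd \<Delta> * x" if x: "h x = h (p ^ k) * (\<Sum>j\<in>insert u J. h (f j) * z j)" for k x f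
    proof -
      have eq: "h (p ^ k * f u) * z u = h x + (\<Sum>j\<in>J. h (- (p ^ k * f j)) * z j)"
        using x insert.hyps by (simp add: h hm sum_distrib_left sum_negf algebra_simps)
      have "p ^ k * f u = 0"
      proof (rule ccontr)
        assume "p ^ k * f u \<noteq> 0"
        with eq have "\<exists>a b g. a \<noteq> 0 \<and> h a * z u = h b + (\<Sum>j\<in>J. h (g j) * z j)"
          by (intro exI[of _ "p ^ k * f u"] exI[of _ x] exI[of _ "\<lambda>j. - (p ^ k * f j)"]) simp
        with False show False by contradiction
      qed
      then have "h (f u) = 0" using p by (simp add: h0)
      then have "h x = h (p ^ k) * (\<Sum>j\<in>J. h (f j) * z j)" using x insert.hyps by simp
      then show ?thesis by (rule D(2))
    qed
    show ?thesis by (intro exI[of _ \<Delta>] conjI allI impI) (use D(1) in simp, rule dvd)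
  qed
qed

lemma digit_sum_inj:
  fixes a b :: "nat \<Rightarrow> nat"
  assumes "\<And>i. i < r \<Longrightarrow> a i < Q" "\<And>i. i < r \<Longrightarrow> b i < Q"
    and "(\<Sum>i<r. a i * Q ^ i) = (\<Sum>i<r. b i * Q ^ i)" and "i < r"
  shows "a i = b i"
  using assms
proof (induction r arbitrary: a b i)
  case (Suc r)
  have split: "(\<Sum>i<Suc r. c i * Q ^ i) = c 0 + Q * (\<Sum>i<r. c (Suc i) * Q ^ i)" for c
    unfolding sum.lessThan_Suc_shift by (simp add: sum_distrib_left mult_ac)
  have eq: "a 0 + Q * (\<Sum>i<r. a (Suc i) * Q ^ i) = b 0 + Q * (\<Sum>i<r. b (Suc i) * Q ^ i)"
    using Suc.prems(3) unfolding split .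
  have lt: "a 0 < Q" "b 0 < Q" using Suc.prems by auto
  have 0: "a 0 = b 0"
    using arg_cong[OF eq, of "\<lambda>n. n mod Q"] lt by simp
  have Q: "Q > 0" using lt by simp
  with eq 0 have eq': "(\<Sum>i<r. a (Suc i) * Q ^ i) = (\<Sum>i<r. b (Suc i) * Q ^ i)" by simp
  show ?case
  proof (cases i)
    case 0
    with \<open>a 0 = b 0\<close> show ?thesis by simp
  next
    case (Suc j)
    have "a (Suc j) = b (Suc j)"
      using Suc Suc.prems by (intro Suc.IH[of "\<lambda>i. a (Suc i)" "\<lambda>i. b (Suc i)"] eq') auto
    with Suc show ?thesis by simp
  qed
qed simp

section \<open>Monomials of bounded degree in finitely many variables\<close>

definition monomial_val :: "nat \<Rightarrow> (nat \<Rightarrow> 'r::comm_semiring_1) \<Rightarrow> (nat \<Rightarrow> nat) \<Rightarrow> 'r" where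
  "monomial_val r x b = (\<Prod>i<r. x i ^ b i)"

definition exponents :: "nat \<Rightarrow> nat \<Rightarrow> (nat \<Rightarrow> nat) set" where
  "exponents r d = {b. (\<forall>i\<ge>r. b i = 0) \<and> (\<Sum>i<r. b i) \<le> d}"

lemma finite_exponents: "finite (exponents r d)"
proof -
  have "exponents r d \<subseteq> {b. \<forall>i. (i \<in> {..<r} \<longrightarrow> b i \<in> {..d}) \<and> (i \<notin> {..<r} \<longrightarrow> b i = 0)}"
  proof
    fix b assume b: "b \<in> exponents r d"
    then have "b i \<le> d" if "i < r" for i
      using member_le_sum[of i "{..<r}" b] that by (auto simp: exponents_def)
    with b show "b \<in> {b. \<forall>i. (i \<in> {..<r} \<longrightarrow> b i \<in> {..d}) \<and> (i \<notin> {..<r} \<longrightarrow> b i = 0)}"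
      by (auto simp: exponents_def)
  qed
  then show ?thesis by (rule finite_subset) (intro finite_set_of_finite_funs; simp)
qed

lemma exponents_le: "b \<in> exponents r d \<Longrightarrow> b i \<le> d"
  by (cases "i < r") (auto simp: exponents_def intro: order_trans[OF member_le_sum[of i "{..<r}" b]])

text \<open>Kronecker substitution reduces this to polynomials in one variable.\<close>

lemma coeffs_zero_if_vanishing:
  fixes c :: "(nat \<Rightarrow> nat) \<Rightarrow> 'k::idom"
  assumes inf: "infinite (UNIV :: 'k set)" and A: "finite A" "A \<subseteq> exponents r d"
    and vanish: "\<And>y. (\<Sum>a\<in>A. c a * monomial_val r y a) = 0" and a: "a \<in> A"
  shows "c a = 0"
proof -
  define W where "W b = (\<Sum>i<r. b i * Suc d ^ i)" for b
  have inj: "inj_on W A"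
  proof (rule inj_onI, rule ext)
    fix a b i assume *: "a \<in> A" "b \<in> A" "W a = W b"
    have "a i = b i" if "i < r"
      using * A(2) that exponents_le unfolding W_def by (intro digit_sum_inj[of r a "Suc d" b]) (auto simp: less_Suc_eq_le)
    moreover have "a \<in> exponents r d" "b \<in> exponents r d" using * A(2) by auto
    then have "a i = b i" if "i \<ge> r" using that by (simp add: exponents_def)
    ultimately show "a i = b i" by force
  qed
  define P where "P = (\<Sum>a\<in>A. monom (c a) (W a))"
  have "poly P T = 0" for T
  proof -
    have "monomial_val r (\<lambda>i. T ^ (Suc d ^ i)) a = T ^ W a" for a
      by (simp add: monomial_val_def W_def power_sum mult.commute flip: power_mult)
    then show ?thesis using vanish[of "\<lambda>i. T ^ (Suc d ^ i)"]
      by (simp add: P_def poly_sum poly_monom)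
  qed
  then have "P = 0" using inf poly_roots_finite[of P] by fastforce
  then have "coeff P (W a) = 0" by simp
  moreover have "coeff P (W a) = (\<Sum>b\<in>A. if b = a then c b else 0)"
    unfolding P_def coeff_sum using a inj by (intro sum.cong) (auto simp: inj_on_def)
  ultimately show ?thesis using A(1) a by simp
qed

section \<open>Frobenius powers and the Mahler functions\<close>

text \<open>Additivity of the \<open>q\<close>-th power, put as divisibility of binomial
  coefficients: so it depends on the ring only through its characteristic and passes at once to
  polynomials, power series and the algebraic closure.\<close>

definition frobenius_exponent :: "nat \<Rightarrow> nat \<Rightarrow> bool" where
  "frobenius_exponent c q \<longleftrightarrow> q > 0 \<and> (\<forall>k. 0 < k \<and> k < q \<longrightarrow> c dvd (q choose k))"

lemma power_add_frobenius:
  fixes x y :: "'r::comm_semiring_1"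
  assumes "frobenius_exponent CHAR('r) q"
  shows "(x + y) ^ q = x ^ q + y ^ q"
proof -
  have q: "q > 0" using assms by (simp add: frobenius_exponent_def)
  have "(x + y) ^ q = (\<Sum>k\<le>q. of_nat (q choose k) * x ^ k * y ^ (q - k))"
    by (rule binomial_ring)
  also have "\<dots> = (\<Sum>k\<in>{0,q}. of_nat (q choose k) * x ^ k * y ^ (q - k))"
  proof (intro sum.mono_neutral_right ballI)
    fix k assume "k \<in> {..q} - {0, q}"
    then have "of_nat (q choose k) = (0 :: 'r)"
      using assms by (auto simp: frobenius_exponent_def of_nat_eq_0_iff_char_dvd)
    then show "of_nat (q choose k) * x ^ k * y ^ (q - k) = 0" by simp
  qed auto
  finally show ?thesis using q by (simp add: add_ac)
qed

lemma power_add_frobenius_iterate: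
  fixes x y :: "'r::comm_semiring_1"
  assumes "frobenius_exponent CHAR('r) q"
  shows "(x + y) ^ (q ^ n) = x ^ (q ^ n) + y ^ (q ^ n)"
proof (induction n)
  case (Suc n)
  have "(x + y) ^ (q ^ Suc n) = ((x + y) ^ (q ^ n)) ^ q" by (simp flip: power_mult add: mult.commute)
  also have "\<dots> = x ^ (q ^ Suc n) + y ^ (q ^ Suc n)"
    unfolding Suc power_add_frobenius[OF assms] by (simp flip: power_mult add: mult.commute)
  finally show ?case .
qed simp

lemma power_sum_frobenius:
  fixes x :: "'i \<Rightarrow> 'r::comm_semiring_1"
  assumes "frobenius_exponent CHAR('r) q"
  shows "(\<Sum>i\<in>A. x i) ^ (q ^ n) = (\<Sum>i\<in>A. x i ^ (q ^ n))"
proof -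
  have "q ^ n > 0" using assms by (simp add: frobenius_exponent_def)
  then show ?thesis
    by (induction A rule: infinite_finite_induct)
      (auto simp: power_add_frobenius_iterate[OF assms] power_0_left)
qed

lemma power_minus_frobenius:
  fixes x :: "'r::comm_ring_1"
  assumes "frobenius_exponent CHAR('r) q"
  shows "(- x) ^ (q ^ n) = - (x ^ (q ^ n))"
proof -
  have "q ^ n > 0" using assms by (simp add: frobenius_exponent_def)
  then have "(0 :: 'r) ^ (q ^ n) = 0" by (rule zero_power)
  then have "x ^ (q ^ n) + (- x) ^ (q ^ n) = 0"
    using power_add_frobenius_iterate[OF assms, of x "- x" n] by (simp only: right_minus)
  then show ?thesis by (simp add: eq_neg_iff_add_eq_0 add.commute)
qed

text \<open>Additivity reaches finite sums only, so \<open>F\<close> is cut after degree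
  \<open>k\<close>. The rest is a multiple of \<open>fps_X ^ Suc k\<close>, and its power does not
  touch degree \<open>k\<close>.\<close>

lemma fps_nth_power_frobenius:
  fixes F :: "'r::comm_ring_1 fps"
  assumes "frobenius_exponent CHAR('r) q"
  shows "fps_nth (F ^ (q ^ n)) k = (if q ^ n dvd k then fps_nth F (k div q ^ n) ^ (q ^ n) else 0)"
proof -
  define Q where "Q = q ^ n"
  have Q: "Q > 0" using assms by (simp add: Q_def frobenius_exponent_def)
  have char: "frobenius_exponent CHAR('r fps) q" using assms by simp
  define P where "P = (\<Sum>i\<le>k. fps_const (fps_nth F i) * fps_X ^ i)"
  define G where "G = fps_shift (Suc k) (F - P)"
  have low: "fps_nth (F - P) i = 0" if "i \<le> k" for i
    using that by (simp add: P_def fps_sum_nth if_distrib[of "\<lambda>x. _ * x"] cong: if_cong)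
  have "F - P = fps_X ^ Suc k * G"
  proof (rule fps_ext)
    fix i show "fps_nth (F - P) i = fps_nth (fps_X ^ Suc k * G) i"
    proof (cases "i \<le> k")
      case True
      then show ?thesis unfolding low[OF True] by (simp add: fps_X_power_mult_nth del: power_Suc)
    next
      case False
      then show ?thesis by (simp add: G_def fps_X_power_mult_nth del: power_Suc)
    qed
  qed
  then have "F = P + fps_X ^ Suc k * G" unfolding diff_eq_eq by (subst add.commute)
  then have "F ^ Q = P ^ Q + fps_X ^ (Suc k * Q) * G ^ Q"
    unfolding Q_def by (simp only: power_add_frobenius_iterate[OF char] power_mult_distrib power_mult)
  moreover have "k < Suc k * Q" using Q by (cases Q) auto
  ultimately have "fps_nth (F ^ Q) k = fps_nth (P ^ Q) k"
    by (simp add: fps_X_power_mult_nth del: mult_Suc)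
  also have "P ^ Q = (\<Sum>i\<le>k. fps_const (fps_nth F i ^ Q) * fps_X ^ (i * Q))"
    unfolding P_def Q_def power_sum_frobenius[OF char]
    by (simp only: power_mult_distrib fps_const_power power_mult)
  also have "fps_nth \<dots> k = (\<Sum>i\<le>k. if k = i * Q then fps_nth F i ^ Q else 0)"
    by (simp add: fps_sum_nth if_distrib[of "\<lambda>x. _ * x"] cong: if_cong)
  also have "\<dots> = (if Q dvd k then fps_nth F (k div Q) ^ Q else 0)"
  proof (cases "Q dvd k")
    case True
    then obtain j where j: "k = j * Q" by (auto simp: dvd_def mult.commute)
    have "(\<Sum>i\<le>k. if k = i * Q then fps_nth F i ^ Q else 0)
        = (\<Sum>i\<le>k. if i = j then fps_nth F i ^ Q else 0)"
      using Q j by (intro sum.cong) auto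
    with True j Q show ?thesis by simp
  qed (auto intro!: sum.neutral)
  finally show ?thesis by (simp add: Q_def)
qed

lemma finite_field_power_card:
  fixes x :: "'a::{field,finite}"
  shows "x ^ CARD('a) = x"
proof (cases "x = 0")
  case False
  have pos: "CARD('a) > 0" by simp
  have "x * (\<Prod>y\<in>UNIV-{0}. x * y) = x * x ^ (CARD('a) - 1) * \<Prod>(UNIV-{0})"
    by (simp add: prod.distrib mult_ac)
  also have "x * x ^ (CARD('a) - 1) = x ^ CARD('a)" using pos by (metis Suc_diff_1 power_Suc)
  also have "(\<Prod>y\<in>UNIV-{0}. x * y) = (\<Prod>y\<in>UNIV-{0}. y)"
    by (rule prod.reindex_bij_witness[of _ "\<lambda>y. y / x" "\<lambda>y. x * y"]) (use False in auto)
  finally show ?thesis by simp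
qed simp

text \<open>The polynomial (x + 1)^q - x^q - 1 has degree below q but vanishes at all q elements, so
  its coefficients are 0. That q is a power of the characteristic does not enter.\<close>

lemma finite_field_frobenius_exponent:
  "frobenius_exponent CHAR('a::{field,finite}) CARD('a)"
proof -
  define q where "q = CARD('a)"
  have "card {0, 1 :: 'a} \<le> q" unfolding q_def by (intro card_mono) auto
  then have q: "q \<ge> 2" by simp
  have pow: "x ^ q = x" for x :: 'a by (simp add: q_def finite_field_power_card)
  define P :: "'a poly" where "P = (\<Sum>k\<in>{0<..<q}. monom (of_nat (q choose k)) k)"
  have "poly P x = 0" for x
  proof -
    have "(x + 1) ^ q = (\<Sum>k\<le>q. of_nat (q choose k) * x ^ k)"
      by (simp add: binomial_ring)
    also have "{..q} = insert 0 (insert q {0<..<q})" using q by auto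
    also have "(\<Sum>k\<in>\<dots>. of_nat (q choose k) * x ^ k) = 1 + x ^ q + poly P x"
      using q by (simp add: P_def poly_sum poly_monom)
    finally show ?thesis by (simp add: pow)
  qed
  then have "{x. poly P x = 0} = UNIV" by auto
  moreover have "degree P < q"
    unfolding P_def using q by (intro degree_sum_less) (auto intro: le_less_trans[OF degree_monom_le])
  ultimately have "P = 0"
    using card_poly_roots_bound[of P] by (auto simp: q_def)
  have "CHAR('a) dvd (q choose k)" if "0 < k" "k < q" for k
  proof -
    have "coeff P k = of_nat (q choose k)"
      using that by (simp add: P_def coeff_sum if_distrib cong: if_cong)
    with \<open>P = 0\<close> show ?thesis by (simp add: of_nat_eq_0_iff_char_dvd)
  qed
  with q show ?thesis by (auto simp: frobenius_exponent_def q_def)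
qed

text \<open>\<open>phi q t n k\<close> is the coefficient of \<open>X\<^sup>n w\<^sup>k\<close> in the product of the series
  \<open>1 / (1 - (t + X) w^(q^j))\<close> over \<open>j \<ge> 0\<close>, which satisfies \<open>f(w\<^sup>q) = (1 - (t + X) w) f(w)\<close>.
  The test \<open>2 \<le> q\<close> only serves termination.\<close>

function phi :: "nat \<Rightarrow> 'r::comm_ring_1 \<Rightarrow> nat \<Rightarrow> nat \<Rightarrow> 'r" where
  "phi q t n 0 = (if n = 0 then 1 else 0)"
| "phi q t n (Suc k) = t * phi q t n k + (if n = 0 then 0 else phi q t (n - 1) k)
     + (if 2 \<le> q \<and> q dvd Suc k then phi q t n (Suc k div q) else 0)"
  by pat_completeness auto
termination by (relation "measure (\<lambda>(q, t, n, k). k)") auto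

definition phi_fps :: "nat \<Rightarrow> 'r::comm_ring_1 \<Rightarrow> nat \<Rightarrow> 'r fps" where
  "phi_fps q t n = Abs_fps (phi q t n)"

lemma phi_fps_functional_equation:
  fixes t :: "'r::comm_ring_1"
  assumes "2 \<le> q"
  shows "phi_fps q t n oo fps_X ^ q = (1 - fps_const t * fps_X) * phi_fps q t n
    - (if n = 0 then 0 else fps_X * phi_fps q t (n - 1))" (is "?L = ?R")
proof (rule fps_ext)
  fix k
  show "fps_nth ?L k = fps_nth ?R k"
  proof (cases k)
    case 0
    then show ?thesis using assms
      by (simp add: fps_nth_compose_X_power phi_fps_def left_diff_distrib mult.assoc)
  next
    case (Suc j)
    have "(if q dvd k then phi q t n (k div q) else 0) = phi q t n k - t * phi q t n j
      - (if n = 0 then 0 else phi q t (n - 1) j)"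
      using assms Suc by simp
    moreover have "fps_nth ?L k = (if q dvd k then phi q t n (k div q) else 0)"
      by (simp add: fps_nth_compose_X_power phi_fps_def)
    moreover have "fps_nth ?R k = phi q t n k - t * phi q t n j - (if n = 0 then 0 else phi q t (n - 1) j)"
      using Suc by (simp add: phi_fps_def left_diff_distrib mult.assoc)
    ultimately show ?thesis by simp
  qed
qed

section \<open>Polynomial functions with filtered coefficients\<close>

lemma monomial_val_mult: "monomial_val r x b * monomial_val r x c = monomial_val r x (\<lambda>i. b i + c i)"
  by (simp add: monomial_val_def power_add prod.distrib)

lemma monomial_val_power: "monomial_val r x b ^ n = monomial_val r (\<lambda>i. x i ^ n) b"
  by (simp add: monomial_val_def power_commutes prod_power_distrib mult.commute flip: power_mult)

lemma exponents_add: "b \<in> exponents r m \<Longrightarrow> c \<in> exponents r n \<Longrightarrow> (\<lambda>i. b i + c i) \<in> exponents r (m + n)"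
  by (auto simp: exponents_def sum.distrib)

text \<open>A single index \<open>m\<close> bounds the degree and selects the coefficient set, so
  products keep track of both. It serves twice: with a constant filtration for the modules
  \<open>W\<close>, and with coefficients of bounded degree for relations transported between
  levels.\<close>

definition polyfun :: "nat \<Rightarrow> ('x \<Rightarrow> nat \<Rightarrow> 's::comm_ring_1) \<Rightarrow> (nat \<Rightarrow> 's set) \<Rightarrow> nat \<Rightarrow> ('x \<Rightarrow> 's) set" where
  "polyfun r v C m = {F. \<exists>g. (\<forall>b. g b \<in> C m) \<and> (\<forall>x. F x = (\<Sum>b\<in>exponents r m. g b * monomial_val r (v x) b))}"

locale filtration =
  fixes C :: "nat \<Rightarrow> 's::comm_ring_1 set"
  assumes zero: "0 \<in> C m"
    and add: "x \<in> C m \<Longrightarrow> y \<in> C m \<Longrightarrow> x + y \<in> C m"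
    and mult: "x \<in> C m \<Longrightarrow> y \<in> C n \<Longrightarrow> x * y \<in> C (m + n)"
    and one: "1 \<in> C 0"
begin

lemma polyfun_zero: "(\<lambda>_. 0) \<in> polyfun r v C m"
  unfolding polyfun_def using zero by (intro CollectI exI[of _ "\<lambda>_. 0"]) auto

lemma polyfun_add:
  assumes "F \<in> polyfun r v C m" "G \<in> polyfun r v C m"
  shows "(\<lambda>x. F x + G x) \<in> polyfun r v C m"
proof -
  obtain f g where "\<forall>b. f b \<in> C m" "\<forall>x. F x = (\<Sum>b\<in>exponents r m. f b * monomial_val r (v x) b)"
    "\<forall>b. g b \<in> C m" "\<forall>x. G x = (\<Sum>b\<in>exponents r m. g b * monomial_val r (v x) b)"
    using assms unfolding polyfun_def by blast
  then show ?thesis unfolding polyfun_def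
    by (intro CollectI exI[of _ "\<lambda>b. f b + g b"]) (auto simp: add distrib_right sum.distrib)
qed

lemma polyfun_sum:
  assumes "\<And>i. i \<in> I \<Longrightarrow> F i \<in> polyfun r v C m"
  shows "(\<lambda>x. \<Sum>i\<in>I. F i x) \<in> polyfun r v C m"
  using assms by (induction I rule: infinite_finite_induct) (auto intro: polyfun_zero polyfun_add)

lemma polyfun_mon:
  assumes "b \<in> exponents r m" "c \<in> C m"
  shows "(\<lambda>x. c * monomial_val r (v x) b) \<in> polyfun r v C m"
  unfolding polyfun_def using assms zero
  by (intro CollectI exI[of _ "\<lambda>a. if a = b then c else 0"])
    (auto simp: if_distrib[of "\<lambda>x. x * _"] finite_exponents cong: if_cong)

lemma polyfun_mult:
  assumes "F \<in> polyfun r v C m" "G \<in> polyfun r v C n"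
  shows "(\<lambda>x. F x * G x) \<in> polyfun r v C (m + n)"
proof -
  obtain f g where *: "\<forall>b. f b \<in> C m" "\<forall>x. F x = (\<Sum>b\<in>exponents r m. f b * monomial_val r (v x) b)"
    "\<forall>b. g b \<in> C n" "\<forall>x. G x = (\<Sum>b\<in>exponents r n. g b * monomial_val r (v x) b)"
    using assms unfolding polyfun_def by blast
  have "(\<lambda>x. F x * G x) = (\<lambda>x. \<Sum>b\<in>exponents r m. \<Sum>c\<in>exponents r n. (f b * g c) * monomial_val r (v x) (\<lambda>i. b i + c i))"
    using * by (simp add: sum_product mult_ac flip: monomial_val_mult)
  moreover have "\<dots> \<in> polyfun r v C (m + n)"
    using * by (intro polyfun_sum polyfun_mon exponents_add mult) auto
  ultimately show ?thesis by simp
qed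

lemma polyfun_one: "(\<lambda>_. 1) \<in> polyfun r v C 0"
proof -
  have "(\<lambda>x. 1 * monomial_val r (v x) (\<lambda>_. 0)) \<in> polyfun r v C 0"
    by (intro polyfun_mon one) (auto simp: exponents_def)
  then show ?thesis by (simp add: monomial_val_def)
qed

lemma polyfun_prod_power:
  assumes "finite I" "\<And>i. i \<in> I \<Longrightarrow> F i \<in> polyfun r v C 1"
  shows "(\<lambda>x. \<Prod>i\<in>I. F i x ^ a i) \<in> polyfun r v C (\<Sum>i\<in>I. a i)"
  using assms
proof (induction I rule: finite_induct)
  case (insert i I)
  have pow: "(\<lambda>x. F i x ^ k) \<in> polyfun r v C k" for k
  proof (induction k)
    case (Suc k)
    have "(\<lambda>x. F i x * F i x ^ k) \<in> polyfun r v C (1 + k)"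
      using Suc insert.prems by (intro polyfun_mult) auto
    then show ?case by simp
  qed (simp add: polyfun_one)
  have "(\<lambda>x. F i x ^ a i * (\<Prod>i\<in>I. F i x ^ a i)) \<in> polyfun r v C (a i + (\<Sum>i\<in>I. a i))"
    using insert by (intro polyfun_mult pow) auto
  with insert.hyps show ?case by simp
qed (simp add: polyfun_one)

lemma polyfun_linear:
  assumes "\<And>j. j < r \<Longrightarrow> c j \<in> C 1"
  shows "(\<lambda>x. \<Sum>j<r. c j * v x j) \<in> polyfun r v C 1"
proof (intro polyfun_sum)
  fix j assume "j \<in> {..<r}"
  then have j: "j < r" by simp
  have "monomial_val r y (\<lambda>i. if i = j then 1 else 0) = y j" for y :: "nat \<Rightarrow> 's"
  proof -
    have "monomial_val r y (\<lambda>i. if i = j then 1 else 0) = (\<Prod>i<r. if i = j then y i else 1)"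
      unfolding monomial_val_def by (intro prod.cong) auto
    with j show ?thesis by simp
  qed
  moreover have "(\<lambda>x. c j * monomial_val r (v x) (\<lambda>i. if i = j then 1 else 0)) \<in> polyfun r v C 1"
    using j assms by (intro polyfun_mon) (auto simp: exponents_def)
  ultimately show "(\<lambda>x. c j * v x j) \<in> polyfun r v C 1" by simp
qed

end

section \<open>Independence at points of finite fields\<close>

text \<open>Here \<open>t\<close> is a point of exact degree \<open>l\<close> over the field with \<open>q\<close> elements.\<close>

locale periodic_point =
  fixes q l :: nat and t :: "'k::field"
  assumes q: "2 \<le> q" and frob: "frobenius_exponent CHAR('k) q"
    and l: "0 < l" and t_nz: "t \<noteq> 0" and period: "t ^ (q ^ l) = t"
    and least: "\<And>j. 0 < j \<Longrightarrow> j < l \<Longrightarrow> t ^ (q ^ j) \<noteq> t"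
begin

definition Q :: nat where "Q = q ^ l"

abbreviation h :: "'k poly \<Rightarrow> 'k fps" where "h \<equiv> fps_of_poly"

definition f :: "nat \<Rightarrow> 'k fps" where "f = phi_fps q t"

text \<open>\<open>beta m i\<close> is the coefficient of \<open>X\<^sup>i\<close> in the product of \<open>1 - (t + X) w^(q^j)\<close> over \<open>j < m\<close>.\<close>

fun beta :: "nat \<Rightarrow> nat \<Rightarrow> 'k poly" where
  "beta 0 i = (if i = 0 then 1 else 0)"
| "beta (Suc m) i = (1 - monom t (q ^ m)) * beta m i
     - (if i = 0 then 0 else monom 1 (q ^ m) * beta m (i - 1))"

lemma Q_ge: "2 \<le> Q"
  using q l self_le_power[of q l] unfolding Q_def by linarith

lemma Q_power: "Q ^ N = q ^ (l * N)"
  by (simp add: Q_def power_mult)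

lemma t_Q_power: "t ^ (Q ^ N) = t"
proof (induction N)
  case (Suc N)
  have "t ^ (Q ^ Suc N) = (t ^ (Q ^ N)) ^ Q" by (simp flip: power_mult add: mult.commute)
  then show ?case using Suc period by (simp add: Q_def)
qed simp

text \<open>The coefficients are sums and products of \<open>t\<close>, 0 and 1, and
  \<open>t\<close> is fixed by the \<open>Q\<close>-th power. Hence a \<open>Q\<close>-power of the
  series is a substitution w -> w^(Q^N), to which the functional equation applies.\<close>

lemma phi_Q_power: "phi q t n k ^ (Q ^ N) = phi q t n k"
proof (induction k arbitrary: n rule: less_induct)
  case (less k)
  note char = power_add_frobenius_iterate[OF frob]
  have pos: "Q ^ N > 0" using Q_ge by simp
  show ?case
  proof (cases k)
    case 0
    then show ?thesis using pos by simp
  next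
    case (Suc j)
    have IH: "phi q t m i ^ (q ^ (l * N)) = phi q t m i" if "i < k" for m i
      using less[OF that] by (simp add: Q_power)
    have div: "Suc j div q < k" using q Suc by (auto intro!: div_less_dividend)
    have z: "(0::'k) ^ (q ^ (l * N)) = 0" using q by (simp add: power_0_left)
    show ?thesis
      using Suc IH[of j] IH[OF div] t_Q_power[of N] z unfolding Q_power
      by (simp add: char power_mult_distrib)
  qed
qed

lemma f_Q_power: "f n ^ (Q ^ N) = f n oo fps_X ^ (Q ^ N)"
proof (rule fps_ext)
  fix k show "fps_nth (f n ^ (Q ^ N)) k = fps_nth (f n oo fps_X ^ (Q ^ N)) k"
    using fps_nth_power_frobenius[OF frob, of "f n" "l * N" k] phi_Q_power[of n _ N] Q_ge
    by (simp add: Q_power fps_nth_compose_X_power f_def phi_fps_def)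
qed

lemma f_compose: "f n oo fps_X ^ (q ^ m) = (\<Sum>i\<le>n. h (beta m i) * f (n - i))"
proof (induction m arbitrary: n)
  case 0
  have "(\<Sum>i\<le>n. h (beta 0 i) * f (n - i)) = (\<Sum>i\<le>n. if i = 0 then f n else 0)"
    by (intro sum.cong) auto
  then show ?case by simp
next
  case (Suc m)
  have nz: "fps_nth (fps_X ^ (q ^ m) :: 'k fps) 0 = 0" "fps_nth (fps_X ^ q :: 'k fps) 0 = 0" using q by auto
  have X: "fps_X oo (fps_X ^ (q ^ m)) = (fps_X ^ (q ^ m) :: 'k fps)"
    by (rule fps_X_fps_compose_startby0[OF nz(1)])
  have "f n oo fps_X ^ (q ^ Suc m) = f n oo (fps_X ^ q oo fps_X ^ (q ^ m))"
    by (simp add: fps_compose_power[OF nz(1), symmetric] X flip: power_mult) (simp add: mult.commute)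
  also have "\<dots> = (f n oo fps_X ^ q) oo fps_X ^ (q ^ m)"
    by (rule fps_compose_assoc[OF nz])
  also have "\<dots> = (1 - fps_const t * fps_X ^ (q ^ m)) * (f n oo fps_X ^ (q ^ m))
     - (if n = 0 then 0 else fps_X ^ (q ^ m) * (f (n - 1) oo fps_X ^ (q ^ m)))"
    unfolding f_def phi_fps_functional_equation[OF q]
    by (simp add: fps_compose_sub_distrib fps_compose_mult_distrib[OF nz(1)] X)
  also have "\<dots> = (\<Sum>i\<le>n. (1 - fps_const t * fps_X ^ (q ^ m)) * h (beta m i) * f (n - i))
     - (if n = 0 then 0 else \<Sum>i\<le>n-1. fps_X ^ (q ^ m) * h (beta m i) * f (n - 1 - i))"
    unfolding Suc.IH by (simp add: sum_distrib_left mult.assoc)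
  also have "(if n = 0 then 0 else \<Sum>i\<le>n-1. fps_X ^ (q ^ m) * h (beta m i) * f (n - 1 - i))
     = (\<Sum>i\<le>n. if i = 0 then 0 else fps_X ^ (q ^ m) * h (beta m (i - 1)) * f (n - i))"
  proof (cases n)
    case (Suc k)
    show ?thesis unfolding Suc sum.atMost_Suc_shift by simp
  qed simp
  also have "(\<Sum>i\<le>n. (1 - fps_const t * fps_X ^ (q ^ m)) * h (beta m i) * f (n - i)) - \<dots>
     = (\<Sum>i\<le>n. h (beta (Suc m) i) * f (n - i))"
    unfolding sum_subtractf[symmetric]
    by (intro sum.cong) (auto simp: fps_of_poly_diff fps_of_poly_mult fps_of_poly_monom left_diff_distrib)
  finally show ?case .
qed

text \<open>For \<open>n = 0\<close> and \<open>N = 1\<close> this is the Kummer equation of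
  \<open>f 0\<close>. For \<open>n > 0\<close>, dividing by it gives an Artin-Schreier equation for
  \<open>f n / f 0\<close>.\<close>

lemma f_power: "f n ^ (Q ^ N) = (\<Sum>i\<le>n. h (beta (l * N) i) * f (n - i))"
  unfolding f_Q_power by (simp only: Q_power f_compose)

section \<open>Orders of vanishing at the point \<open>z0\<close>\<close>

definition z0 :: 'k where "z0 = inverse t"

definition p :: "'k poly" where "p = [:- z0, 1:]"

definition exact_order :: "'k poly \<Rightarrow> nat \<Rightarrow> bool" where
  "exact_order a n \<longleftrightarrow> (\<exists>c. a = p ^ n * c \<and> poly c z0 \<noteq> 0)"

lemma poly_p [simp]: "poly p z0 = 0" by (simp add: p_def)

lemma p_nz: "p \<noteq> 0" by (simp add: p_def)

lemma exact_order_mult: "exact_order a m \<Longrightarrow> exact_order b n \<Longrightarrow> exact_order (a * b) (m + n)"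
  unfolding exact_order_def
proof (elim exE conjE)
  fix c d assume "a = p ^ m * c" "poly c z0 \<noteq> 0" "b = p ^ n * d" "poly d z0 \<noteq> 0"
  then show "\<exists>e. a * b = p ^ (m + n) * e \<and> poly e z0 \<noteq> 0"
    by (intro exI[of _ "c * d"]) (simp add: power_add mult_ac)
qed

lemma exact_order_add:
  assumes "exact_order a n" "exact_order b m" "n < m"
  shows "exact_order (a + b) n" "exact_order (b + a) n"
proof -
  obtain c d where *: "a = p ^ n * c" "poly c z0 \<noteq> 0" "b = p ^ m * d"
    using assms by (auto simp: exact_order_def)
  obtain k where "m = n + Suc k" using assms(3) less_iff_Suc_add by auto
  with * show "exact_order (a + b) n" unfolding exact_order_def
    by (intro exI[of _ "c + p ^ Suc k * d"]) (simp add: power_add algebra_simps)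
  then show "exact_order (b + a) n" by (simp add: add.commute)
qed

lemma exact_order_add':
  assumes "exact_order a 0" "p dvd b"
  shows "exact_order (b + a) 0"
  using assms by (auto simp: exact_order_def)

lemma exact_order_uminus: "exact_order a n \<Longrightarrow> exact_order (- a) n"
  unfolding exact_order_def by (metis mult_minus_right poly_minus neg_equal_0_iff_equal)

lemma exact_order_exists:
  assumes "a \<noteq> 0" shows "\<exists>n. exact_order a n"
proof -
  obtain c where "a = [:- z0, 1:] ^ order z0 a * c" "\<not> [:- z0, 1:] dvd c"
    using order_decomp[OF assms] by blast
  then show ?thesis unfolding exact_order_def p_def by (metis poly_eq_0_iff_dvd)
qed

lemma exact_order_not_dvd:
  assumes "exact_order a n" "p ^ m dvd a" shows "m \<le> n"
proof (rule ccontr)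
  assume "\<not> m \<le> n"
  then have "p ^ (n + 1) dvd p ^ m" by (intro le_imp_power_dvd) simp
  then have "p ^ (n + 1) dvd a" using assms(2) by (rule dvd_trans)
  moreover obtain c where c: "a = p ^ n * c" "poly c z0 \<noteq> 0" using assms by (auto simp: exact_order_def)
  ultimately have "p dvd c" using p_nz by (simp add: dvd_mult_cancel_left)
  then show False using c by auto
qed

text \<open>For j = l k the factor 1 - t w^(q^j) has order Q^k at \<open>z0\<close>;
  \<open>S m\<close> is the order of the product of the first m such factors.\<close>

definition S :: "nat \<Rightarrow> nat" where "S m = (\<Sum>k<m. Q ^ k)"

lemma S_Suc: "S (Suc m) = Q ^ m + S m" by (simp add: S_def)

lemma S_0 [simp]: "S 0 = 0" by (simp add: S_def)

lemma S_eq: "(Q - 1) * S m + 1 = Q ^ m"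
proof (induction m)
  case (Suc m)
  have "(Q - 1) * S (Suc m) + 1 = (Q - 1) * Q ^ m + ((Q - 1) * S m + 1)"
    by (simp add: S_Suc algebra_simps)
  also have "\<dots> = Q ^ Suc m" unfolding Suc using Q_ge by (cases Q) auto
  finally show ?case .
qed (simp add: S_def)

lemma S_mono: "m \<le> n \<Longrightarrow> S m \<le> S n"
  unfolding S_def by (intro sum_mono2) auto

lemma S_less: "m < n \<Longrightarrow> S m < S n"
proof -
  assume "m < n"
  then have "S (Suc m) \<le> S n" by (intro S_mono) simp
  moreover have "Q ^ m > 0" using Q_ge by (intro zero_less_power) simp
  ultimately show "S m < S n" unfolding S_Suc by linarith
qed

text \<open>This is m / l rounded up: the number of j < m divisible by l, that is, of factors 1 - t
  w^(q^j) with j < m that vanish at \<open>z0\<close>.\<close>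

definition cnt :: "nat \<Rightarrow> nat" where "cnt m = (m + (l - 1)) div l"

lemma cnt_0 [simp]: "cnt 0 = 0" using l by (simp add: cnt_def)

lemma cnt_mult: "cnt (l * N) = N"
  using l unfolding cnt_def by (simp only: div_mult_self4) simp

lemma cnt_Suc: "cnt (Suc m) = (if l dvd m then Suc (cnt m) else cnt m)"
proof -
  obtain a b where m: "m = l * a + b" "b < l" using l by (metis mod_less_divisor mult_div_mod_eq)
  have "Suc m + (l - 1) = l * (a + 1) + b" using m l by (simp add: algebra_simps)
  then have 1: "cnt (Suc m) = a + 1"
    using m l unfolding cnt_def by (simp only: div_mult_self4) simp
  have 2: "cnt m = (if b = 0 then a else a + 1)"
  proof (cases b)
    case (Suc c)
    then have "m + (l - 1) = l * (a + 1) + c" using m l by (simp add: algebra_simps)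
    then show ?thesis using m l Suc unfolding cnt_def by (simp only: div_mult_self4) simp
  qed (use m cnt_mult in simp)
  have "m mod l = b" using m by simp
  then have "l dvd m \<longleftrightarrow> b = 0" by (simp add: dvd_eq_mod_eq_0)
  with 1 2 show ?thesis by auto
qed

text \<open>If l divides m, then t = t^(q^m), and the polynomial is the q^m-th power of 1 - t w, a
  constant multiple of \<open>p\<close>. Otherwise its value 1 - t^(1 - q^m) at \<open>z0\<close> is
  nonzero by the minimality of l.\<close>

lemma exact_order_one_minus:
  "exact_order (1 - monom t (q ^ m)) (if l dvd m then q ^ m else 0)"
proof (cases "l dvd m")
  case True
  then obtain N where m: "m = l * N" by blast
  have "frobenius_exponent CHAR('k poly) q" using frob by simp
  note char = power_add_frobenius_iterate[OF this] power_minus_frobenius[OF this]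
  have "smult (- t) p = 1 + - monom t 1"
    using t_nz by (simp add: p_def z0_def monom_altdef one_pCons)
  then have "(smult (- t) p) ^ (q ^ m) = (1 + - monom t 1) ^ (q ^ m)" by (rule arg_cong)
  also have "\<dots> = 1 - monom t (q ^ m)"
    using t_Q_power[of N] unfolding char by (simp add: monom_power m Q_power)
  finally have "smult ((- t) ^ (q ^ m)) (p ^ (q ^ m)) = 1 - monom t (q ^ m)"
    by (simp only: smult_power)
  then have "1 - monom t (q ^ m) = p ^ (q ^ m) * [:(- t) ^ (q ^ m):]" by simp
  then show ?thesis using True t_nz unfolding exact_order_def
    by (intro exI[of _ "[:(- t) ^ (q ^ m):]"]) auto
next
  case False
  obtain a b where m: "m = l * a + b" "b < l" using l by (metis mod_less_divisor mult_div_mod_eq)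
  with False have b: "0 < b" by (cases b) auto
  have "t ^ (q ^ m) = (t ^ (Q ^ a)) ^ (q ^ b)"
    by (simp add: m Q_power power_add flip: power_mult)
  then have "t ^ (q ^ m) \<noteq> t" using least[OF b m(2)] by (simp add: t_Q_power)
  then have "poly (1 - monom t (q ^ m)) z0 \<noteq> 0"
    using t_nz by (simp add: poly_monom z0_def field_simps)
  then show ?thesis using False unfolding exact_order_def by auto
qed

text \<open>Taking the coefficient of X^i replaces i factors by powers of w, which are units at
  \<open>z0\<close>. With N = \<open>cnt m\<close>, the order drops most when these are the factors
  of orders Q^(N-1), ..., Q^(N-i), and then \<open>S (N - i)\<close> remains. The choice is unique,
  so nothing cancels.\<close>

lemma exact_order_beta: "i \<le> cnt m \<Longrightarrow> exact_order (beta m i) (S (cnt m - i))"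
proof (induction m arbitrary: i)
  case 0
  then show ?case by (simp add: exact_order_def)
next
  case (Suc m)
  have mono: "exact_order (monom 1 (q ^ m)) 0"
    using t_nz by (simp add: exact_order_def poly_monom z0_def)
  show ?case
  proof (cases "l dvd m")
    case True
    then obtain N where N: "m = l * N" by blast
    then have cm: "cnt m = N" "cnt (Suc m) = Suc N" using cnt_mult[of N] by (simp_all add: cnt_Suc)
    have qm: "q ^ m = Q ^ N" by (simp add: N Q_power)
    have order_first: "exact_order ((1 - monom t (q ^ m)) * beta m i) (Q ^ N + S (N - i))" if "i \<le> N"
      using exact_order_mult[OF exact_order_one_minus[of m] Suc.IH[of i]] True that by (simp add: cm qm)
    show ?thesis
    proof (cases i)
      case 0
      then show ?thesis using order_first by (simp add: cm S_Suc)
    next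
      case (Suc j)
      have second: "exact_order (- (monom 1 (q ^ m) * beta m j)) (S (N - j))"
        using exact_order_uminus[OF exact_order_mult[OF mono Suc.IH[of j]]] Suc Suc.prems by (simp add: cm)
      have "exact_order ((1 - monom t (q ^ m)) * beta m i + - (monom 1 (q ^ m) * beta m j)) (S (N - j))"
      proof (cases "i \<le> N")
        case True
        have "S (N - j) = Q ^ (N - i) + S (N - i)"
          using True Suc S_Suc[of "N - i"] by (simp add: Suc_diff_Suc)
        moreover have "Q ^ (N - i) < Q ^ N" using Q_ge Suc True by (intro power_strict_increasing) auto
        ultimately show ?thesis by (intro exact_order_add(2)[OF second order_first[OF True]]) simp
      next
        case False
        then have "N = j" using Suc Suc.prems by (simp add: cm)
        \<comment> \<open>Here \<open>i = Suc N\<close> exceeds \<open>cnt m\<close>, so the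
          induction hypothesis says nothing about \<open>beta m i\<close>. That the factor in front
          of it is divisible by \<open>p\<close> is enough, as the other summand has order
          0.\<close>
        have "p dvd 1 - monom t (q ^ m)"
          using exact_order_one_minus[of m] True q unfolding exact_order_def
          by (auto intro!: dvd_mult2 dvd_power)
        then have "p dvd (1 - monom t (q ^ m)) * beta m i" by (rule dvd_mult2)
        moreover have "exact_order (- (monom 1 (q ^ m) * beta m j)) 0"
          using second \<open>N = j\<close> by simp
        ultimately show ?thesis using exact_order_add' \<open>N = j\<close> by (metis S_0 diff_self_eq_0)
      qed
      then show ?thesis using Suc by (simp add: cm)
    qed
  next
    case False
    then have cm: "cnt (Suc m) = cnt m" by (simp add: cnt_Suc)
    have first: "exact_order ((1 - monom t (q ^ m)) * beta m i) (S (cnt m - i))"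
      using exact_order_mult[OF exact_order_one_minus[of m] Suc.IH[of i]] False Suc.prems by (simp add: cm)
    show ?thesis
    proof (cases i)
      case 0
      then show ?thesis using first by (simp add: cm)
    next
      case (Suc j)
      have second: "exact_order (- (monom 1 (q ^ m) * beta m j)) (S (cnt m - j))"
        using exact_order_uminus[OF exact_order_mult[OF mono Suc.IH[of j]]] Suc Suc.prems by (simp add: cm)
      have "S (cnt m - i) < S (cnt m - j)" using Suc Suc.prems by (intro S_less) (simp add: cm)
      from exact_order_add(1)[OF first second this] show ?thesis using Suc by (simp add: cm)
    qed
  qed
qed

section \<open>Leading terms in the ring generated by the \<open>f i\<close>\<close>

sublocale coeffs: filtration "\<lambda>_. range h"
proof
  show "0 \<in> range h" by (intro image_eqI[of _ _ 0]) auto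
  show "1 \<in> range h" by (intro image_eqI[of _ _ 1]) auto
next
  fix x y assume "x \<in> range h" "y \<in> range h"
  then obtain a b where "x = h a" "y = h b" by blast
  then show "x + y \<in> range h" "x * y \<in> range h"
    by (auto simp flip: fps_of_poly_add fps_of_poly_mult)
qed

text \<open>The dummy argument of type \<open>unit\<close> makes single elements into functions, so
  that the closure properties of \<open>polyfun\<close> apply.\<close>

definition W :: "nat \<Rightarrow> nat \<Rightarrow> 'k fps set" where
  "W r m = {y. (\<lambda>_. y) \<in> polyfun r (\<lambda>_ :: unit. f) (\<lambda>_. range h) m}"

lemma W_add: "x \<in> W r m \<Longrightarrow> y \<in> W r m \<Longrightarrow> x + y \<in> W r m"
  unfolding W_def mem_Collect_eq by (rule coeffs.polyfun_add)

lemma W_sum: "(\<And>i. i \<in> I \<Longrightarrow> x i \<in> W r m) \<Longrightarrow> (\<Sum>i\<in>I. x i) \<in> W r m"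
  unfolding W_def mem_Collect_eq by (rule coeffs.polyfun_sum)

lemma W_mult: "x \<in> W r m \<Longrightarrow> y \<in> W r n \<Longrightarrow> x * y \<in> W r (m + n)"
  unfolding W_def mem_Collect_eq by (rule coeffs.polyfun_mult)

lemma W_const: "h a \<in> W r m"
proof -
  have "(\<lambda>_ :: unit. h a * monomial_val r f (\<lambda>_. 0)) \<in> polyfun r (\<lambda>_. f) (\<lambda>_. range h) m"
    by (rule coeffs.polyfun_mon) (auto simp: exponents_def)
  then show ?thesis by (simp add: W_def monomial_val_def)
qed

lemma W_mult_const: "x \<in> W r m \<Longrightarrow> h a * x \<in> W r m"
  using W_mult[OF W_const[of a r 0], of x m] by simp

lemma W_mono: assumes "x \<in> W r m" "m \<le> n" shows "x \<in> W r n"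
  using W_mult[OF assms(1) W_const[of 1 r "n - m"]] assms(2) by simp

lemma W_f: assumes "j < r" shows "f j \<in> W r 1"
proof -
  have "(\<lambda>_ :: unit. \<Sum>i<r. (if i = j then h 1 else h 0) * f i) \<in> polyfun r (\<lambda>_. f) (\<lambda>_. range h) 1"
    by (rule coeffs.polyfun_linear) auto
  moreover have "(\<Sum>i<r. (if i = j then h 1 else h 0) * f i) = (\<Sum>i<r. if i = j then f i else 0)"
    by (intro sum.cong) auto
  ultimately show ?thesis using assms by (simp add: W_def)
qed

lemma W_uminus: "x \<in> W r m \<Longrightarrow> - x \<in> W r m"
  using W_mult_const[of x r m "- 1"] by (simp add: fps_of_poly_uminus)

lemma W_f_power: "0 < r \<Longrightarrow> f 0 ^ m \<in> W r m"
proof (induction m)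
  case (Suc m)
  then show ?case using W_mult[OF W_f[of 0 r], of "f 0 ^ m" m] by simp
qed (use W_const[of 1] in simp)

lemma W_expand: "x \<in> W r m \<Longrightarrow> \<exists>g. x = (\<Sum>b\<in>exponents r m. h (g b) * monomial_val r f b)"
proof -
  assume "x \<in> W r m"
  then obtain g where g: "\<forall>b. g b \<in> range h" "x = (\<Sum>b\<in>exponents r m. g b * monomial_val r f b)"
    by (auto simp: W_def polyfun_def)
  then have "\<forall>b. \<exists>a. g b = h a" by blast
  then obtain a where "\<forall>b. g b = h (a b)" by metis
  with g show ?thesis by auto
qed

text \<open>A stand-in for a valuation at \<open>z0\<close>, with relative precision
  \<open>G\<close>. As f 0^(Q - 1) is a polynomial of order 1, such an \<open>x\<close> has order E
  + m / (Q - 1) in an extension of the valuation, provided that \<open>G\<close> is large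
  enough.\<close>

definition lead :: "nat \<Rightarrow> nat \<Rightarrow> nat \<Rightarrow> nat \<Rightarrow> 'k fps \<Rightarrow> bool" where
  "lead r G m E x \<longleftrightarrow> (\<exists>c y. poly c z0 \<noteq> 0 \<and> y \<in> W r m \<and> x = h (p ^ E) * (h c * f 0 ^ m + h (p ^ G) * y))"

lemma lead_mult:
  assumes "0 < r" "lead r G m E x" "lead r G n E' x'"
  shows "lead r G (m + n) (E + E') (x * x')"
proof -
  obtain c y where 1: "poly c z0 \<noteq> 0" "y \<in> W r m" "x = h (p ^ E) * (h c * f 0 ^ m + h (p ^ G) * y)"
    using assms unfolding lead_def by blast
  obtain c' y' where 2: "poly c' z0 \<noteq> 0" "y' \<in> W r n" "x' = h (p ^ E') * (h c' * f 0 ^ n + h (p ^ G) * y')"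
    using assms unfolding lead_def by blast
  define Y where "Y = (y * (h c' * f 0 ^ n) + (h c * f 0 ^ m) * y') + h (p ^ G) * (y * y')"
  have "Y \<in> W r (m + n)" unfolding Y_def
    using 1 2 W_f_power[OF assms(1)] by (intro W_add W_mult W_mult_const) auto
  moreover have "x * x' = h (p ^ (E + E')) * (h (c * c') * f 0 ^ (m + n) + h (p ^ G) * Y)"
    unfolding 1 2 Y_def by (simp add: fps_of_poly_mult power_add algebra_simps)
  ultimately show ?thesis unfolding lead_def using 1 2 by (intro exI[of _ "c * c'"] exI[of _ Y]) auto
qed

lemma lead_one: "lead r G 0 0 1"
  unfolding lead_def using W_const[of 0 r 0] by (intro exI[of _ 1] exI[of _ 0]) auto

lemma lead_power: "0 < r \<Longrightarrow> lead r G m E x \<Longrightarrow> lead r G (k * m) (k * E) (x ^ k)"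
  by (induction k) (auto simp: lead_one intro: lead_mult)

lemma lead_prod:
  assumes "0 < r" "finite I" "\<And>i. i \<in> I \<Longrightarrow> lead r G (m i) (E i) (x i)"
  shows "lead r G (\<Sum>i\<in>I. m i) (\<Sum>i\<in>I. E i) (\<Prod>i\<in>I. x i)"
  using assms(2,3) by (induction I rule: finite_induct) (auto simp: lead_one intro: lead_mult[OF assms(1)])

text \<open>In the expansion of the power by \<open>f_power\<close>, the term with k = i has the
  least order \<open>S (N - i)\<close> and carries \<open>f 0\<close>. For k < i the order is larger
  by at least Q^(N - i), which limits the precision \<open>G\<close>.\<close>

lemma lead_f:
  assumes "i < r" "i \<le> N" "G \<le> Q ^ (N - i)"
  shows "lead r G 1 (S (N - i)) (f i ^ (Q ^ N))"
proof -
  have "\<forall>k\<in>{..i}. \<exists>c. beta (l * N) k = p ^ S (N - k) * c \<and> poly c z0 \<noteq> 0"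
    using exact_order_beta[of _ "l * N"] assms by (auto simp: cnt_mult exact_order_def)
  then obtain c where c: "\<And>k. k \<le> i \<Longrightarrow> beta (l * N) k = p ^ S (N - k) * c k"
    "\<And>k. k \<le> i \<Longrightarrow> poly (c k) z0 \<noteq> 0" by (metis atMost_iff)
  define e where "e k = S (N - k) - S (N - i) - G" for k
  have e: "S (N - k) = S (N - i) + G + e k" if "k < i" for k
  proof -
    have "S (N - k) \<ge> S (Suc (N - i))" using that assms by (intro S_mono) simp
    then show ?thesis using assms(3) by (simp add: e_def S_Suc)
  qed
  define Y where "Y = (\<Sum>k<i. h (p ^ e k * c k) * f (i - k))"
  have "Y \<in> W r 1" unfolding Y_def using assms(1) by (intro W_sum W_mult_const W_f) auto
  moreover have "f i ^ (Q ^ N) = h (p ^ S (N - i)) * (h (c i) * f 0 ^ 1 + h (p ^ G) * Y)"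
  proof -
    have "f i ^ (Q ^ N) = h (beta (l * N) i) * f 0 + (\<Sum>k<i. h (beta (l * N) k) * f (i - k))"
      unfolding f_power by (simp add: lessThan_Suc_atMost[symmetric])
    also have "(\<Sum>k<i. h (beta (l * N) k) * f (i - k))
        = h (p ^ S (N - i)) * (h (p ^ G) * Y)"
      unfolding Y_def sum_distrib_left
    proof (intro sum.cong refl)
      fix k assume "k \<in> {..<i}"
      then have k: "k < i" by simp
      show "h (beta (l * N) k) * f (i - k) = h (p ^ S (N - i)) * (h (p ^ G) * (h (p ^ e k * c k) * f (i - k)))"
        unfolding c(1)[OF less_imp_le[OF k]] e[OF k] by (simp add: power_add fps_of_poly_mult mult_ac)
    qed
    finally show ?thesis unfolding c(1)[OF order_refl] by (simp add: fps_of_poly_mult algebra_simps)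
  qed
  ultimately show ?thesis unfolding lead_def using c(2)[of i] by blast
qed

lemma lead_mon:
  assumes "0 < r" "r \<le> N" "G \<le> Q ^ (N - (r - 1))"
  shows "lead r G (\<Sum>i<r. a i) (\<Sum>i<r. a i * S (N - i)) (monomial_val r f a ^ (Q ^ N))"
proof -
  have "G \<le> Q ^ (N - i)" if "i < r" for i
    using assms(3) Q_ge that by (elim order_trans) (intro power_increasing; simp)
  then have "lead r G (a i * 1) (a i * S (N - i)) ((f i ^ (Q ^ N)) ^ a i)" if "i < r" for i
    using that assms by (intro lead_power lead_f) auto
  then have "lead r G (\<Sum>i<r. a i * 1) (\<Sum>i<r. a i * S (N - i)) (\<Prod>i<r. (f i ^ (Q ^ N)) ^ a i)"
    using assms(1) by (intro lead_prod) auto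
  then show ?thesis unfolding monomial_val_power by (simp add: monomial_val_def)
qed

lemma f_0_nz: "f 0 \<noteq> 0"
proof
  assume "f 0 = 0"
  then have "fps_nth (f 0) 0 = 0" by simp
  then show False by (simp add: f_def phi_fps_def)
qed

lemma f_0_power: "f 0 ^ (Q - 1) = h (beta l 0)"
proof -
  have "f 0 ^ Q = h (beta l 0) * f 0" using f_power[of 0 1] by simp
  moreover have "f 0 ^ Q = f 0 ^ (Q - 1) * f 0" using Q_ge by (metis Suc_diff_1 power_Suc2 zero_less_numeral order_less_le_trans)
  ultimately show ?thesis using f_0_nz by simp
qed

text \<open>The number \<open>wt a\<close> below is, up to a common factor, the order at \<open>z0\<close> of the term with
  exponent \<open>a\<close>, extended to the field generated by the \<open>f i\<close>, where \<open>f i\<close> has order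
  \<open>1 / (Q\<^sup>i (Q - 1))\<close>. No two terms have the same order. This extension is not constructed; instead
  the relation is raised to a high power of \<open>Q\<close>, which makes the leading terms visible.\<close>

theorem monomials_independent:
  assumes r: "0 < r" and d: "d + 2 \<le> Q"
    and rel: "(\<Sum>a\<in>exponents r d. h (R a) * monomial_val r f a) = 0" and a: "a \<in> exponents r d"
  shows "R a = 0"
proof (rule ccontr)
  assume Ra: "R a \<noteq> 0"
  define A where "A = {a \<in> exponents r d. R a \<noteq> 0}"
  have A: "finite A" "a \<in> A" "A \<subseteq> exponents r d" using finite_exponents a Ra by (auto simp: A_def)
  have "\<forall>a\<in>A. \<exists>n. exact_order (R a) n" by (auto simp: A_def intro: exact_order_exists)
  then obtain ord where ord: "\<And>a. a \<in> A \<Longrightarrow> exact_order (R a) (ord a)" by metis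
  \<comment> \<open>The common denominator of the orders 1 / (Q^i (Q - 1)) for i < r; multiplying
    them by it gives the weights in \<open>V\<close>.\<close>
  define M where "M = (Q - 1) * Q ^ (r - 1)"
  define V where "V a = (\<Sum>i<r. a i * Q ^ (r - 1 - i))" for a
  define wt where "wt a = M * ord a + V a" for a
  define wd where "wd a = (\<Sum>i<r. a i)" for a :: "nat \<Rightarrow> nat"
  have wd: "wd a \<le> d" if "a \<in> A" for a using that by (auto simp: A_def exponents_def wd_def)
  have ai: "a i \<le> Q - 2" if "a \<in> A" for a i
    using exponents_le[of a r d i] that A(3) d by (simp add: subset_iff)
  have ai': "a i < Q" if "a \<in> A" for a i using ai[OF that, of i] Q_ge by linarith
  have V_rev: "V a = (\<Sum>i<r. a (r - 1 - i) * Q ^ i)" for a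
    unfolding V_def by (subst sum.nat_diff_reindex[symmetric]) simp
  \<comment> \<open>Together with \<open>d + 2 <= Q\<close> this makes \<open>V a\<close> the
    remainder of \<open>wt a\<close> modulo \<open>M\<close>. The bound is sharp: the exponent of f
    0^(Q - 1), which is a polynomial, would give exactly \<open>M\<close>.\<close>
  have V_less: "V a < M" if "a \<in> A" for a
  proof -
    obtain r' where r': "r = Suc r'" using r by (cases r) auto
    obtain Q' where Q': "Q = Suc (Suc Q')" using Q_ge by (metis add_2_eq_Suc le_Suc_ex)
    have "V a \<le> (\<Sum>i<r. (Q - 2) * Q ^ i)"
      unfolding V_rev using ai[OF that] by (intro sum_mono mult_right_mono) auto
    also have "\<dots> = Q' * S r" by (simp add: S_def sum_distrib_left Q')
    also have "\<dots> = Q' * Q ^ r' + Q' * S r'" by (simp add: r' S_Suc algebra_simps)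
    also have "Q' * S r' < Q ^ r'" using S_eq[of r'] by (simp add: Q')
    finally show ?thesis by (simp add: M_def Q' r')
  qed
  have inj: "a = b" if "a \<in> A" "b \<in> A" "wt a = wt b" for a b
  proof
    fix i
    have "wt a mod M = wt b mod M" using that by simp
    then have "V a = V b" using V_less that by (simp add: wt_def)
    then have "a (r - 1 - (r - 1 - i)) = b (r - 1 - (r - 1 - i))" if "i < r"
      using that ai'[OF \<open>a \<in> A\<close>] ai'[OF \<open>b \<in> A\<close>] unfolding V_rev
      by (intro digit_sum_inj[of r "\<lambda>i. a (r - 1 - i)" Q "\<lambda>i. b (r - 1 - i)"]) auto
    moreover have "a i = b i" if "\<not> i < r" using that \<open>a \<in> A\<close> \<open>b \<in> A\<close> by (auto simp: A_def exponents_def)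
    ultimately show "a i = b i" by (cases "i < r") auto
  qed
  have "Min (wt ` A) \<in> wt ` A" using A by (intro Min_in) auto
  then obtain a0 where a0: "a0 \<in> A" "wt a0 = Min (wt ` A)" by auto
  have min: "wt a0 + 1 \<le> wt a" if "a \<in> A" "a \<noteq> a0" for a
  proof -
    have "wt a0 \<le> wt a" using a0 A that by simp
    moreover have "wt a0 \<noteq> wt a" using inj a0 that by blast
    ultimately show ?thesis by simp
  qed
  define m where "m = wd a0"
  \<comment> \<open>The degree reached once the relation has been multiplied by f 0^((Q - 2) m),
    which turns f 0^m into the polynomial \<open>beta l 0 ^ m\<close>.\<close>
  define D where "D = d + (Q - 2) * m"
  have "\<exists>\<Delta>. \<Delta> \<noteq> 0 \<and> (\<forall>k x g. h x = h (p ^ k) * (\<Sum>j\<in>exponents r D. h (g j) * monomial_val r f j) \<longrightarrow> p ^ k dvd \<Delta> * x)"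
    by (rule bounded_denominator) (auto simp: fps_of_poly_add fps_of_poly_mult p_nz finite_exponents inj_def)
  then obtain \<Delta> where \<Delta>: "\<Delta> \<noteq> 0"
    "\<And>k x g. h x = h (p ^ k) * (\<Sum>j\<in>exponents r D. h (g j) * monomial_val r f j) \<Longrightarrow> p ^ k dvd \<Delta> * x" by blast
  obtain nD where nD: "exact_order \<Delta> nD" using exact_order_exists[OF \<Delta>(1)] by blast
  \<comment> \<open>At the end \<open>p ^ G\<close> divides
    \<open>\<Delta> * (c * beta l 0 ^ m)\<close>, which has order nD + m: one too few.
    \<open>N\<close> is so large that a gap of 1 between weights becomes a gap of at least
    \<open>G\<close> between the exponents \<open>E\<close>.\<close>
  define G where "G = nD + m + 1"
  define N where "N = (r - 1) + (d + (Q - 1) * G)"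
  define H where "H = Q ^ (N - (r - 1))"
  have HG: "d + (Q - 1) * G \<le> H"
    unfolding H_def N_def using less_exp[of "d + (Q - 1) * G"] power_mono[of 2 Q "d + (Q - 1) * G"] Q_ge by simp
  have "1 * G \<le> (Q - 1) * G" using Q_ge by (intro mult_right_mono) auto
  then have GH: "G \<le> Q ^ (N - (r - 1))" using HG unfolding H_def by linarith
  have "(Q - 1) * G \<ge> 1 * 1" using Q_ge by (intro mult_le_mono) (auto simp: G_def)
  then have rN: "r \<le> N" using r unfolding N_def by linarith
  define E where "E a = Q ^ N * ord a + (\<Sum>i<r. a i * S (N - i))" for a
  \<comment> \<open>The order of the Q^N-th power of the term is E a + wd a / (Q - 1), and
    \<open>H * M\<close> equals (Q - 1) Q^N.\<close>
  have E_eq: "(Q - 1) * E a + wd a = H * wt a" for a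
  proof -
    have HQ: "H * Q ^ (r - 1 - i) = Q ^ (N - i)" if "i < r" for i
      using that rN by (simp add: H_def flip: power_add)
    have "(Q - 1) * E a + wd a = (Q - 1) * Q ^ N * ord a + (\<Sum>i<r. a i * ((Q - 1) * S (N - i) + 1))"
      by (simp add: E_def wd_def algebra_simps sum_distrib_left sum.distrib)
    also have "(\<Sum>i<r. a i * ((Q - 1) * S (N - i) + 1)) = H * V a"
      unfolding S_eq V_def sum_distrib_left by (intro sum.cong) (auto simp: HQ[symmetric] mult_ac)
    also have "(Q - 1) * Q ^ N * ord a = H * (M * ord a)"
      using HQ[of 0] r by (simp add: M_def mult_ac)
    also have "H * (M * ord a) + H * V a = H * wt a" by (simp add: wt_def distrib_left)
    finally show ?thesis .
  qed
  have E_ge: "E a0 + G \<le> E a" if "a \<in> A" "a \<noteq> a0" for a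
  proof -
    have "H * (wt a0 + 1) \<le> H * wt a" using min[OF that] by (rule mult_left_mono) simp
    then have "(Q - 1) * E a0 + wd a0 + H \<le> (Q - 1) * E a + wd a"
      unfolding E_eq by (simp only: distrib_left mult_1_right)
    with HG wd[OF that(1)] have "(Q - 1) * (E a0 + G) \<le> (Q - 1) * E a"
      unfolding distrib_left by linarith
    then show ?thesis using Q_ge by simp
  qed
  define x where "x a = (h (R a) * monomial_val r f a) ^ (Q ^ N)" for a
  have lead: "lead r G (wd a) (E a) (x a)" if aA: "a \<in> A" for a
  proof -
    obtain c where c: "R a = p ^ ord a * c" "poly c z0 \<noteq> 0" using ord[OF aA] by (auto simp: exact_order_def)
    have "h (R a) ^ (Q ^ N) = h (p ^ (Q ^ N * ord a)) * (h (c ^ (Q ^ N)) * f 0 ^ 0 + h (p ^ G) * 0)"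
      by (simp add: c fps_of_poly_mult fps_of_poly_power power_mult_distrib mult.commute flip: power_mult)
    then have "lead r G 0 (Q ^ N * ord a) (h (R a) ^ (Q ^ N))"
      unfolding lead_def using c W_const[of 0 r 0] by (intro exI[of _ "c ^ (Q ^ N)"] exI[of _ 0]) auto
    from lead_mult[OF r this lead_mon[OF r rN GH, of a]] show ?thesis
      by (simp add: x_def E_def wd_def power_mult_distrib)
  qed
  \<comment> \<open>Every term but the minimal one is absorbed into the error of relative order
    \<open>G\<close>, so cancelling \<open>p ^ E a0\<close> will leave f 0^m, times a unit at
    \<open>z0\<close>, as a multiple of \<open>p ^ G\<close>.\<close>
  have "\<forall>a\<in>A - {a0}. \<exists>y. y \<in> W r d \<and> x a = h (p ^ E a0) * (h (p ^ G) * y)"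
  proof
    fix a assume a: "a \<in> A - {a0}"
    then obtain c y where y: "y \<in> W r (wd a)" "x a = h (p ^ E a) * (h c * f 0 ^ wd a + h (p ^ G) * y)"
      using lead[of a] unfolding lead_def by blast
    define e where "e = E a - E a0 - G"
    have "E a = E a0 + G + e" using E_ge[of a] a by (simp add: e_def)
    then have "x a = h (p ^ E a0) * (h (p ^ G) * (h (p ^ e) * (h c * f 0 ^ wd a + h (p ^ G) * y)))"
      unfolding y(2) by (simp add: power_add fps_of_poly_mult mult_ac)
    moreover have "h (p ^ e) * (h c * f 0 ^ wd a + h (p ^ G) * y) \<in> W r d"
      using y wd[of a] a r by (intro W_mult_const W_add W_mono[OF _ wd[of a]] W_f_power) auto
    ultimately show "\<exists>y. y \<in> W r d \<and> x a = h (p ^ E a0) * (h (p ^ G) * y)" by blast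
  qed
  then obtain y where y: "\<And>a. a \<in> A - {a0} \<Longrightarrow> y a \<in> W r d"
    "\<And>a. a \<in> A - {a0} \<Longrightarrow> x a = h (p ^ E a0) * (h (p ^ G) * y a)" by metis
  obtain c y0 where c: "poly c z0 \<noteq> 0" "y0 \<in> W r m" "x a0 = h (p ^ E a0) * (h c * f 0 ^ m + h (p ^ G) * y0)"
    using lead[OF a0(1)] unfolding lead_def m_def by blast
  define Y where "Y = y0 + (\<Sum>a\<in>A-{a0}. y a)"
  have Y: "Y \<in> W r d" unfolding Y_def
    using y c wd[OF a0(1)] by (intro W_add W_sum) (auto simp: m_def intro: W_mono)
  have char: "frobenius_exponent CHAR('k fps) q" using frob by simp
  have "0 = (\<Sum>a\<in>A. h (R a) * monomial_val r f a) ^ (Q ^ N)"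
  proof -
    have "(\<Sum>a\<in>A. h (R a) * monomial_val r f a) = (\<Sum>a\<in>exponents r d. h (R a) * monomial_val r f a)"
      by (intro sum.mono_neutral_left) (auto simp: A_def finite_exponents)
    then show ?thesis using rel Q_ge by simp
  qed
  also have "\<dots> = (\<Sum>a\<in>A. x a)" unfolding x_def Q_power by (rule power_sum_frobenius[OF char])
  also have "\<dots> = x a0 + (\<Sum>a\<in>A-{a0}. x a)" using A(1) a0(1) by (rule sum.remove)
  also have "(\<Sum>a\<in>A-{a0}. x a) = h (p ^ E a0) * (h (p ^ G) * (\<Sum>a\<in>A-{a0}. y a))"
    unfolding sum_distrib_left by (intro sum.cong y refl)
  also have "x a0 + \<dots> = h (p ^ E a0) * (h c * f 0 ^ m + h (p ^ G) * Y)"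
    unfolding c Y_def by (simp add: distrib_left)
  finally have "h c * f 0 ^ m + h (p ^ G) * Y = 0" using p_nz by simp
  then have eq: "h c * f 0 ^ m = h (p ^ G) * (- Y)" by (simp add: eq_neg_iff_add_eq_0)
  have "m + (Q - 2) * m = (Q - 1) * m" using Q_ge by (cases Q; cases "Q - 1") auto
  then have "h (c * beta l 0 ^ m) = h c * f 0 ^ m * f 0 ^ ((Q - 2) * m)"
    by (simp add: fps_of_poly_mult fps_of_poly_power flip: f_0_power power_mult power_add)
  also have "\<dots> = h (p ^ G) * (- Y * f 0 ^ ((Q - 2) * m))" unfolding eq by simp
  finally have eq2: "h (c * beta l 0 ^ m) = h (p ^ G) * (- Y * f 0 ^ ((Q - 2) * m))" .
  have "- Y * f 0 ^ ((Q - 2) * m) \<in> W r D"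
    unfolding D_def using Y r by (intro W_mult W_uminus W_f_power)
  then obtain g where g: "- Y * f 0 ^ ((Q - 2) * m) = (\<Sum>b\<in>exponents r D. h (g b) * monomial_val r f b)"
    using W_expand by blast
  have dvd: "p ^ G dvd \<Delta> * (c * beta l 0 ^ m)" by (rule \<Delta>(2)[OF eq2[unfolded g]])
  have "cnt l = 1" using cnt_mult[of 1] by simp
  then have b: "exact_order (beta l 0) 1" using exact_order_beta[of 0 l] by (simp add: S_def)
  have "exact_order (beta l 0 ^ k) k" for k
  proof (induction k)
    case (Suc k)
    then show ?case using exact_order_mult[OF b Suc] by simp
  qed (simp add: exact_order_def)
  moreover have "exact_order c 0" using c by (simp add: exact_order_def)
  ultimately have "exact_order (\<Delta> * (c * beta l 0 ^ m)) (nD + (0 + m))"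
    by (intro exact_order_mult nD)
  from exact_order_not_dvd[OF this dvd] show False by (simp add: G_def)
qed

end

section \<open>Functional independence\<close>

locale ring_map =
  fixes h :: "'r::comm_ring_1 \<Rightarrow> 's::comm_ring_1"
  assumes zero [simp]: "h 0 = 0" and one [simp]: "h 1 = 1"
    and add: "h (x + y) = h x + h y" and mult: "h (x * y) = h x * h y"
begin

lemma sum: "h (\<Sum>i\<in>I. f i) = (\<Sum>i\<in>I. h (f i))"
  by (induction I rule: infinite_finite_induct) (auto simp: add)

lemma prod: "h (\<Prod>i\<in>I. f i) = (\<Prod>i\<in>I. h (f i))"
  by (induction I rule: infinite_finite_induct) (auto simp: mult)

lemma power: "h (x ^ n) = h x ^ n"
  by (induction n) (auto simp: mult)

lemma uminus: "h (- x) = - h x"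
  using add[of x "- x"] by (simp add: eq_neg_iff_add_eq_0 add.commute)

lemma diff: "h (x - y) = h x - h y"
  using add[of x "- y"] by (simp add: uminus)

lemma phi: "h (phi q t n k) = phi q (h t) n k"
proof (induction k arbitrary: n rule: less_induct)
  case (less k)
  show ?case
  proof (cases k)
    case (Suc j)
    have "Suc j div q < k" if "2 \<le> q" using that Suc by (auto intro!: div_less_dividend)
    then show ?thesis using Suc less by (simp add: add mult)
  qed simp
qed

lemma ring_map_map_poly: "ring_map (map_poly h)"
proof
  fix p q :: "'r poly"
  show "map_poly h (p + q) = map_poly h p + map_poly h q"
    by (rule poly_eqI) (simp add: coeff_map_poly add)
  show "map_poly h (p * q) = map_poly h p * map_poly h q"
    by (rule poly_eqI) (simp add: coeff_map_poly coeff_mult sum mult)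
qed (auto simp: map_poly_1')

lemma ring_map_eval: "ring_map (\<lambda>p. poly (map_poly h p) x)"
proof -
  interpret m: ring_map "map_poly h" by (rule ring_map_map_poly)
  show ?thesis by unfold_locales (auto simp: m.add m.mult)
qed

lemma ring_map_fps: "ring_map (\<lambda>F. Abs_fps (\<lambda>n. h (fps_nth F n)))"
proof
  show "Abs_fps (\<lambda>n. h (fps_nth 1 n)) = 1" by (rule fps_ext) simp
  fix F G :: "'r fps"
  show "Abs_fps (\<lambda>n. h (fps_nth (F * G) n)) = Abs_fps (\<lambda>n. h (fps_nth F n)) * Abs_fps (\<lambda>n. h (fps_nth G n))"
    by (rule fps_ext) (simp add: fps_mult_nth sum mult)
qed (auto simp: add fps_eq_iff)

end

lemma ring_map_to_ac: "ring_map to_ac"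
  by unfold_locales auto

section \<open>Points of the algebraic closure of a finite field\<close>

lemma infinite_alg_closed_field: "infinite (UNIV :: 'k::alg_closed_field set)"
proof
  assume fin: "finite (UNIV :: 'k set)"
  define P where "P = (\<Prod>a\<in>(UNIV :: 'k set). [:- a, 1:])"
  have deg: "degree P = card (UNIV :: 'k set)"
    unfolding P_def by (subst degree_prod_sum_eq) auto
  then have "degree (P + 1) > 0" using fin
    by (subst degree_add_eq_left) (auto simp: card_gt_0_iff)
  then obtain x where "poly (P + 1) x = 0" using alg_closed_imp_poly_has_root by blast
  moreover have "poly P x = 0" using fin by (auto simp: P_def poly_prod)
  ultimately show False by simp
qed

lemma finite_fixed_points:
  assumes "1 < n" shows "finite {x :: 'k::field. x ^ n = x}"
proof -
  define P :: "'k poly" where "P = monom 1 n - monom 1 1"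
  have "coeff P n = 1" using assms by (simp add: P_def)
  then have "P \<noteq> 0" by auto
  moreover have "{x. x ^ n = x} = {x. poly P x = 0}" by (auto simp: P_def poly_monom)
  ultimately show ?thesis using poly_roots_finite by simp
qed

text \<open>All powers x^(q^i) lie in the finite set of values at x of polynomials of bounded
  degree, so two of them coincide. Injectivity of the Frobenius map makes the sequence periodic from
  its start.\<close>

lemma periodic_alg_closure:
  fixes x :: "'a::{field,finite} alg_closure"
  shows "\<exists>l>0. x ^ (CARD('a) ^ l) = x"
proof -
  interpret to_ac: ring_map to_ac by (rule ring_map_to_ac)
  interpret ev: ring_map "\<lambda>p. poly (map_poly to_ac p) x" by (rule to_ac.ring_map_eval)
  obtain P :: "'a poly" where P: "P \<noteq> 0" "poly (map_poly to_ac P) x = 0"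
    by (rule alg_closure_algebraic)
  define n where "n = degree P"
  define B where "B = (\<lambda>g. poly (map_poly to_ac g) x) ` {g. degree g \<le> n}"
  have "finite {g :: 'a poly. degree g \<le> n}"
  proof -
    have "{g :: 'a poly. degree g \<le> n} \<subseteq> Poly ` {xs. set xs \<subseteq> UNIV \<and> length xs \<le> Suc n}"
    proof
      fix g :: "'a poly" assume "g \<in> {g. degree g \<le> n}"
      then have "length (coeffs g) \<le> Suc n" by (simp add: length_coeffs_degree le_SucI) (auto simp: coeffs_def)
      moreover have "g = Poly (coeffs g)" by simp
      ultimately show "g \<in> Poly ` {xs. set xs \<subseteq> UNIV \<and> length xs \<le> Suc n}" by blast
    qed
    then show ?thesis by (rule finite_subset) (intro finite_imageI finite_lists_length_le; simp)
  qed
  then have "finite B" by (simp add: B_def)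
  moreover have "(\<lambda>i. x ^ (CARD('a) ^ i)) ` UNIV \<subseteq> B"
  proof clarify
    fix i
    define g where "g = monom (1 :: 'a) (CARD('a) ^ i)"
    have "x ^ (CARD('a) ^ i) = poly (map_poly to_ac g) x"
      by (simp add: g_def map_poly_monom poly_monom)
    also have "g = P * (g div P) + g mod P" by simp
    also have "poly (map_poly to_ac (P * (g div P) + g mod P)) x = poly (map_poly to_ac (g mod P)) x"
      unfolding ev.add ev.mult by (simp add: P)
    finally show "x ^ (CARD('a) ^ i) \<in> B"
      unfolding B_def n_def using degree_mod_less[OF P(1), of g] by auto
  qed
  ultimately have "finite (range (\<lambda>i. x ^ (CARD('a) ^ i)))" by (rule finite_subset[rotated])
  then have "\<not> inj (\<lambda>i. x ^ (CARD('a) ^ i))" using finite_imageD by blast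
  then obtain i j where ij: "i < j" "x ^ (CARD('a) ^ i) = x ^ (CARD('a) ^ j)"
    unfolding inj_def by (metis linorder_neqE_nat)
  define l where "l = j - i"
  have "x ^ (CARD('a) ^ j) = (x ^ (CARD('a) ^ l)) ^ (CARD('a) ^ i)"
    using ij(1) by (simp add: l_def flip: power_mult power_add)
  then have eq: "(x ^ (CARD('a) ^ l)) ^ (CARD('a) ^ i) = x ^ (CARD('a) ^ i)" using ij(2) by simp
  have frob: "frobenius_exponent CHAR('a alg_closure) CARD('a)"
    using finite_field_frobenius_exponent[where 'a = 'a] by simp
  have "(x ^ (CARD('a) ^ l) - x) ^ (CARD('a) ^ i) = 0"
    unfolding diff_conv_add_uminus power_add_frobenius_iterate[OF frob] power_minus_frobenius[OF frob] eq
    by (rule right_minus)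
  then have "x ^ (CARD('a) ^ l) - x = 0" by (rule power_eq_0_iff[THEN iffD1, THEN conjunct1])
  then have "x ^ (CARD('a) ^ l) = x" by (simp only: right_minus_eq)
  with ij(1) show ?thesis by (intro exI[of _ l]) (simp add: l_def)
qed

lemma card_field_ge_2: "2 \<le> CARD('a::{field,finite})"
proof -
  have "card {0, 1 :: 'a} \<le> CARD('a)" by (intro card_mono) auto
  then show ?thesis by simp
qed

text \<open>The variable \<open>t\<close> is specialized to a point of large degree at which the relation survives.\<close>

theorem functional_independence:
  fixes R :: "(nat \<Rightarrow> nat) \<Rightarrow> 'a::{field,finite} poly poly"
  defines "F \<equiv> phi_fps CARD('a) ([:0, 1:] :: 'a poly)"
  assumes r: "0 < r" and rel: "(\<Sum>a\<in>exponents r d. fps_of_poly (R a) * monomial_val r F a) = 0" and b: "b \<in> exponents r d"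
  shows "R b = 0"
proof (rule ccontr)
  assume "R b \<noteq> 0"
  define q where "q = CARD('a)"
  have q: "2 \<le> q" by (simp add: q_def card_field_ge_2)
  define c where "c = lead_coeff (R b)"
  have "map_poly to_ac c \<noteq> 0" using \<open>R b \<noteq> 0\<close> by (auto simp: c_def map_poly_eq_0_iff)
  define L where "L = d + 2"
  \<comment> \<open>Off the roots of \<open>c\<close> the relation keeps a nonzero coefficient. Off
    the points of degree at most \<open>L\<close> the degree l exceeds d + 2, and so does Q >=
    2^l.\<close>
  define Bad where "Bad = {x. poly (map_poly to_ac c) x = 0} \<union> {0} \<union> (\<Union>j\<in>{1..L}. {x :: 'a alg_closure. x ^ (q ^ j) = x})"
  have "finite Bad"
    unfolding Bad_def using \<open>map_poly to_ac c \<noteq> 0\<close> q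
    by (auto intro!: poly_roots_finite finite_fixed_points one_less_power)
  then obtain t where t: "t \<notin> Bad" using infinite_alg_closed_field ex_new_if_finite by metis
  define l where "l = (LEAST l. 0 < l \<and> t ^ (q ^ l) = t)"
  have "\<exists>l. 0 < l \<and> t ^ (q ^ l) = t" using periodic_alg_closure[of t] by (simp add: q_def)
  from LeastI_ex[OF this] have l_pos: "0 < l" and l_period: "t ^ (q ^ l) = t" unfolding l_def by blast+
  have least: "t ^ (q ^ j) \<noteq> t" if "0 < j" "j < l" for j
    using not_less_Least[OF that(2)[unfolded l_def]] that(1) by simp
  interpret periodic_point q l t
    using q l_pos l_period least t finite_field_frobenius_exponent[where 'a = 'a]
    by unfold_locales (auto simp: Bad_def q_def)
  have "L < l"
  proof (rule ccontr)
    assume "\<not> L < l"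
    then have "l \<in> {1..L}" using l_pos by simp
    with l_period t show False unfolding Bad_def by blast
  qed
  then have "d + 2 \<le> Q"
    using less_exp[of l] power_mono[OF q, of l] unfolding Q_def L_def by linarith
  interpret ac: ring_map to_ac by (rule ring_map_to_ac)
  define s :: "'a poly \<Rightarrow> 'a alg_closure" where "s = (\<lambda>p. poly (map_poly to_ac p) t)"
  interpret s: ring_map s unfolding s_def by (rule ac.ring_map_eval)
  define sf where "sf F = Abs_fps (\<lambda>n. s (fps_nth F n))" for F
  interpret sf: ring_map sf unfolding sf_def by (rule s.ring_map_fps)
  have sX: "s [:0, 1:] = t" by (simp add: s_def map_poly_pCons)
  have sF: "sf (F n) = f n" for n
    unfolding F_def q_def[symmetric] f_def sf_def phi_fps_def by (rule fps_ext) (simp add: s.phi sX)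
  have sR: "sf (fps_of_poly P) = fps_of_poly (map_poly s P)" for P
    unfolding sf_def by (rule fps_ext) (simp add: coeff_map_poly)
  have "(\<Sum>a\<in>exponents r d. fps_of_poly (map_poly s (R a)) * monomial_val r f a) = 0"
    using arg_cong[OF rel, of sf] by (simp add: sf.sum sf.mult sf.prod sf.power sR sF monomial_val_def)
  from monomials_independent[OF r \<open>d + 2 \<le> Q\<close> this b] have "map_poly s (R b) = 0" .
  then have "s c = 0" unfolding c_def by (metis coeff_map_poly coeff_0 s.zero)
  with t show False by (auto simp: Bad_def s_def)
qed

section \<open>Mahler's method\<close>

definition emb :: "'a::field poly \<Rightarrow> 'a fls" where
  "emb a = poly (map_poly fls_const a) theta"

lemma ring_map_fls_const: "ring_map (fls_const :: 'a::field \<Rightarrow> 'a fls)"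
  by unfold_locales (auto simp: fls_plus_const)

global_interpretation emb: ring_map "emb :: 'a::field poly \<Rightarrow> 'a fls"
  unfolding emb_def by (rule ring_map.ring_map_eval[OF ring_map_fls_const])

lemma emb_pCons: "emb (pCons c a) = fls_const c + theta * emb a"
  by (simp add: emb_def map_poly_pCons)

lemma emb_X: "emb [:0, 1:] = theta"
  by (simp add: emb_pCons)

lemma emb_nth: "fls_nth (emb a) i = (if i \<le> 0 then coeff a (nat (- i)) else 0)"
proof (induction a arbitrary: i)
  case 0
  then show ?case by simp
next
  case (pCons c a)
  have "fls_nth (emb (pCons c a)) i = (if i = 0 then c else 0) + fls_nth (emb a) (i + 1)"
    by (simp add: emb_pCons theta_def fls_X_inv_times_conv_shift)
  also have "\<dots> = (if i \<le> 0 then coeff (pCons c a) (nat (- i)) else 0)"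
  proof (cases "i < 0")
    case True
    then have "nat (- i) = Suc (nat (- (i + 1)))" by simp
    with True show ?thesis unfolding pCons.IH by simp
  qed (auto simp: pCons.IH)
  finally show ?case .
qed

lemma emb_eq_0_iff [simp]: "emb a = 0 \<longleftrightarrow> a = 0"
proof
  assume "emb a = 0"
  then have "fls_nth (emb a) (- int k) = 0" for k by simp
  then show "a = 0" by (intro poly_eqI) (simp add: emb_nth)
qed simp

text \<open>An inequality holding for the zero series at every \<open>n\<close>;
  \<open>fls_subdegree\<close> is 0 there and would force a case distinction in each
  estimate.\<close>

definition ord_ge :: "'a::field fls \<Rightarrow> int \<Rightarrow> bool" where
  "ord_ge z n \<longleftrightarrow> (\<forall>i<n. fls_nth z i = 0)"

lemma ord_ge_mono: "ord_ge z n \<Longrightarrow> m \<le> n \<Longrightarrow> ord_ge z m"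
  by (auto simp: ord_ge_def)

lemma ord_ge_add: "ord_ge x n \<Longrightarrow> ord_ge y n \<Longrightarrow> ord_ge (x + y) n"
  and ord_ge_diff: "ord_ge x n \<Longrightarrow> ord_ge y n \<Longrightarrow> ord_ge (x - y) n"
  and ord_ge_uminus: "ord_ge x n \<Longrightarrow> ord_ge (- x) n"
  and ord_ge_0: "ord_ge 0 n"
  by (auto simp: ord_ge_def)

lemma ord_ge_sum: "(\<And>i. i \<in> I \<Longrightarrow> ord_ge (x i) n) \<Longrightarrow> ord_ge (\<Sum>i\<in>I. x i) n"
  by (induction I rule: infinite_finite_induct) (auto intro: ord_ge_add ord_ge_0)

lemma ord_ge_iff_subdegree: "ord_ge z n \<longleftrightarrow> z = 0 \<or> n \<le> fls_subdegree z"
  by (auto simp: ord_ge_def intro!: fls_subdegree_geI)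

lemma ord_ge_mult:
  assumes "ord_ge x n" "ord_ge y m"
  shows "ord_ge (x * y) (n + m)"
  using assms unfolding ord_ge_iff_subdegree by (cases "x = 0"; cases "y = 0") auto

lemma ord_ge_emb: "degree a \<le> d \<Longrightarrow> ord_ge (emb a) (- int d)"
  by (auto simp: ord_ge_def emb_nth coeff_eq_0)

text \<open>The Liouville step of the method: a polynomial in \<open>theta\<close> has no positive
  powers of 1/theta, so positive order at infinity leaves nothing.\<close>

lemma emb_eq_0_if_ordge_1: "ord_ge (emb a) 1 \<Longrightarrow> emb a = 0"
  by (rule fls_eqI) (auto simp: ord_ge_def emb_nth)

lemma theta_nz [simp]: "theta \<noteq> 0" by (simp add: theta_def)

lemma theta_times_X [simp]: "theta * fls_X = 1" "fls_X * theta = 1"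
  unfolding theta_def by (metis fls_inverse_X fls_X_nonzero right_inverse left_inverse)+

section \<open>Evaluation at the points of Mahler's method\<close>

definition wval :: "nat \<Rightarrow> 'a::{field,finite} fls" where
  "wval N = fls_X ^ (CARD('a) ^ N)"

lemma w_nz [simp]: "wval N \<noteq> 0" by (simp add: wval_def)

lemma ord_ge_w_power: "ord_ge (wval N ^ k :: 'a::{field,finite} fls) (int k * int (CARD('a) ^ N))"
  by (simp add: wval_def ord_ge_iff_subdegree mult.commute flip: power_mult)

text \<open>In \<open>'a poly poly\<close> the inner variable is t and the outer one is w.\<close>

definition ev :: "nat \<Rightarrow> 'a::{field,finite} poly poly \<Rightarrow> 'a fls" where
  "ev N p = poly (map_poly emb p) (wval N)"

global_interpretation ev: ring_map "ev N :: 'a::{field,finite} poly poly \<Rightarrow> 'a fls" for N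
  unfolding ev_def by (rule emb.ring_map_eval)

lemma ev_monom: "ev N (monom c k) = emb c * wval N ^ k"
  by (simp add: ev_def map_poly_monom poly_monom)

lemma ev_altdef: "ev N p = (\<Sum>k\<le>degree p. emb (coeff p k) * wval N ^ k)"
  by (subst poly_as_sum_of_monoms[symmetric, of p]) (simp only: ev.sum ev_monom)

lemma ev_lower_bound: "\<exists>c::nat. \<forall>N. ord_ge (ev N p) (- int c)"
proof -
  define c where "c = (\<Sum>k\<le>degree p. degree (coeff p k))"
  have "ord_ge (ev N p) (- int c)" for N
    unfolding ev_altdef
  proof (intro ord_ge_sum)
    fix k assume k: "k \<in> {..degree p}"
    have "degree (coeff p k) \<le> c" unfolding c_def using k by (intro member_le_sum) auto
    from ord_ge_mult[OF ord_ge_emb[OF this] ord_ge_w_power[of N k]]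
    show "ord_ge (emb (coeff p k) * wval N ^ k) (- int c)" by (rule ord_ge_mono) simp
  qed
  then show ?thesis by blast
qed

text \<open>The factor w^m contributes m q^N; \<open>c\<close> absorbs the t-degrees of the
  coefficients, which do not depend on \<open>N\<close>.\<close>

lemma ev_low_coeffs_zero:
  fixes p :: "'a::{field,finite} poly poly"
  assumes "\<And>k. k < m \<Longrightarrow> coeff p k = 0"
  shows "\<exists>c::nat. \<forall>N. ord_ge (ev N p) (int m * int (CARD('a) ^ N) - int c)"
proof -
  have "monom 1 m dvd p" using assms by (simp add: monom_1_dvd_iff')
  then obtain R where R: "p = monom 1 m * R" by blast
  obtain c :: nat where c: "\<forall>N. ord_ge (ev N R) (- int c)" using ev_lower_bound by blast
  have "ord_ge (ev N p) (int m * int (CARD('a) ^ N) - int c)" for N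
    using ord_ge_mult[OF ord_ge_w_power[of N m] spec[OF c, of N]] by (simp add: R ev.mult ev_monom)
  then show ?thesis by blast
qed

definition fps_trunc :: "nat \<Rightarrow> 'r::zero fps \<Rightarrow> 'r poly" where
  "fps_trunc m F = Abs_poly (\<lambda>k. if k < m then fps_nth F k else 0)"

lemma coeff_fps_trunc: "coeff (fps_trunc m F) k = (if k < m then fps_nth F k else 0)"
  unfolding fps_trunc_def by (subst Abs_poly_inverse) (auto simp: MOST_nat intro: exI[of _ m])

text \<open>\<open>z N\<close> is the value at \<open>wval N\<close> of the series \<open>F\<close>, in an asymptotic sense for large \<open>N\<close> that only
  evaluates truncations of \<open>F\<close>, so that convergence is never needed.\<close>

definition expansion :: "(nat \<Rightarrow> 'a::{field,finite} fls) \<Rightarrow> 'a poly fps \<Rightarrow> bool" where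
  "expansion z F \<longleftrightarrow> (\<forall>m. \<exists>(c::nat) N0. \<forall>N\<ge>N0. ord_ge (z N - ev N (fps_trunc m F)) (int m * int (CARD('a) ^ N) - int c))"

lemma expansion_ev: "expansion (\<lambda>N. ev N p) (fps_of_poly p)"
  unfolding expansion_def
proof
  fix m
  have "coeff (p - fps_trunc m (fps_of_poly p)) k = 0" if "k < m" for k using that by (simp add: coeff_fps_trunc)
  from ev_low_coeffs_zero[OF this]
  show "\<exists>c N0. \<forall>N\<ge>N0. ord_ge (ev N p - ev N (fps_trunc m (fps_of_poly p))) (int m * int (CARD('a) ^ N) - int c)"
    unfolding ev.diff by blast
qed

lemma expansion_1: "expansion (\<lambda>N. 1) 1"
  using expansion_ev[of 1] by simp

lemma expansion_mult:
  fixes z z' :: "nat \<Rightarrow> 'a::{field,finite} fls"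
  assumes "expansion z F" "expansion z' G"
  shows "expansion (\<lambda>N. z N * z' N) (F * G)"
  unfolding expansion_def
proof
  fix m
  define q where "q = CARD('a)"
  obtain c N0 where c: "\<And>N. N \<ge> N0 \<Longrightarrow> ord_ge (z N - ev N (fps_trunc m F)) (int m * int (q ^ N) - int c)"
    using assms(1) unfolding expansion_def q_def by blast
  obtain c' N0' where c': "\<And>N. N \<ge> N0' \<Longrightarrow> ord_ge (z' N - ev N (fps_trunc m G)) (int m * int (q ^ N) - int c')"
    using assms(2) unfolding expansion_def q_def by blast
  obtain b where b: "\<And>N. ord_ge (ev N (fps_trunc m F)) (- int b)" using ev_lower_bound by blast
  obtain b' where b': "\<And>N. ord_ge (ev N (fps_trunc m G)) (- int b')" using ev_lower_bound by blast
  have "coeff (fps_trunc m F * fps_trunc m G - fps_trunc m (F * G)) k = 0" if "k < m" for k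
    using that by (auto simp: coeff_fps_trunc coeff_mult fps_mult_nth atLeast0AtMost intro!: sum.cong)
  from ev_low_coeffs_zero[OF this]
  obtain e where e: "\<And>N. ord_ge (ev N (fps_trunc m F * fps_trunc m G - fps_trunc m (F * G))) (int m * int (q ^ N) - int e)"
    unfolding q_def by blast
  have "ord_ge (z N * z' N - ev N (fps_trunc m (F * G))) (int m * int (q ^ N) - int (c + c' + b + b' + e))"
    if N: "N \<ge> max N0 N0'" for N
  proof -
    define s s' x x' where defs: "s = ev N (fps_trunc m F)" "s' = ev N (fps_trunc m G)" "x = z N - s" "x' = z' N - s'"
    have x: "ord_ge x (int m * int (q ^ N) - int c)" "ord_ge x' (int m * int (q ^ N) - int c')"
      using c[of N] c'[of N] N by (auto simp: defs)
    then have x0: "ord_ge x' (- int c')" by (elim ord_ge_mono) simp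
    have "z N * z' N - ev N (fps_trunc m (F * G))
        = ev N (fps_trunc m F * fps_trunc m G - fps_trunc m (F * G)) + s * x' + x * s' + x * x'"
      by (simp add: ev.diff ev.mult defs algebra_simps)
    moreover have "ord_ge \<dots> (int m * int (q ^ N) - int (c + c' + b + b' + e))"
    proof (intro ord_ge_add)
      show "ord_ge (ev N (fps_trunc m F * fps_trunc m G - fps_trunc m (F * G))) (int m * int (q ^ N) - int (c + c' + b + b' + e))"
        by (rule ord_ge_mono[OF e]) simp
      show "ord_ge (s * x') (int m * int (q ^ N) - int (c + c' + b + b' + e))"
        using b[of N] x by (intro ord_ge_mono[OF ord_ge_mult]) (auto simp: defs(1))
      show "ord_ge (x * s') (int m * int (q ^ N) - int (c + c' + b + b' + e))"
        using b'[of N] x by (intro ord_ge_mono[OF ord_ge_mult]) (auto simp: defs(2))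
      show "ord_ge (x * x') (int m * int (q ^ N) - int (c + c' + b + b' + e))"
        by (rule ord_ge_mono[OF ord_ge_mult[OF x(1) x0]]) simp
    qed
    ultimately show ?thesis by simp
  qed
  then show "\<exists>c N0. \<forall>N\<ge>N0. ord_ge (z N * z' N - ev N (fps_trunc m (F * G))) (int m * int (CARD('a) ^ N) - int c)"
    unfolding q_def by blast
qed

lemma expansion_power: "expansion z F \<Longrightarrow> expansion (\<lambda>N. z N ^ k) (F ^ k)"
  by (induction k) (auto intro: expansion_1 expansion_mult)

lemma expansion_prod:
  "(\<And>i. i \<in> I \<Longrightarrow> expansion (z i) (F i)) \<Longrightarrow> expansion (\<lambda>N. \<Prod>i\<in>I. z i N) (\<Prod>i\<in>I. F i)"
  by (induction I rule: infinite_finite_induct) (auto intro: expansion_1 expansion_mult)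

lemma expansion_mon:
  "(\<And>i. i < r \<Longrightarrow> expansion (\<lambda>N. z N i) (F i)) \<Longrightarrow> expansion (\<lambda>N. monomial_val r (z N) b) (monomial_val r F b)"
  unfolding monomial_val_def by (intro expansion_prod expansion_power) auto

lemma less_card_power:
  assumes "n \<le> N" shows "n < CARD('a::{field,finite}) ^ N"
  using assms less_exp[of N] power_mono[OF card_field_ge_2, of N, where 'a1 = 'a] by linarith

text \<open>The lowest term in w dominates: a nonzero polynomial in \<open>theta\<close> has order
  at most 0, so this term has order at most o' q^N, while the rest has order at least (o' + 1) q^N -
  c.\<close>

lemma ev_nonzero_eventually:
  assumes "p \<noteq> 0"
  shows "\<exists>N0. \<forall>N\<ge>N0. ev N p \<noteq> (0 :: 'a::{field,finite} fls)"
proof -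
  define o' where "o' = (LEAST k. coeff p k \<noteq> 0)"
  have "\<exists>k. coeff p k \<noteq> 0" using assms by (metis poly_eqI coeff_0)
  then have o': "coeff p o' \<noteq> 0" "\<And>k. k < o' \<Longrightarrow> coeff p k = 0"
    unfolding o'_def by (rule LeastI_ex) (metis not_less_Least)
  have "coeff (p - monom (coeff p o') o') k = 0" if "k < Suc o'" for k
    using o'(2)[of k] that by (auto simp: less_Suc_eq)
  from ev_low_coeffs_zero[OF this] obtain c :: nat where
    c: "\<And>N. ord_ge (ev N (p - monom (coeff p o') o')) (int (Suc o') * int (CARD('a) ^ N) - int c)" by blast
  have "ev N p \<noteq> 0" if "N \<ge> c" for N
  proof
    assume "ev N p = 0"
    then have "ord_ge (emb (coeff p o') * wval N ^ o') (int (Suc o') * int (CARD('a) ^ N) - int c)"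
      using ord_ge_uminus[OF c[of N]] by (simp add: ev.diff ev_monom)
    then have "int (Suc o') * int (CARD('a) ^ N) - int c
        \<le> fls_subdegree (emb (coeff p o')) + int o' * int (CARD('a) ^ N)"
      using o' by (simp add: ord_ge_iff_subdegree) (simp add: wval_def mult.commute flip: power_mult)
    moreover have "int c < int CARD('a) ^ N"
      using less_card_power[OF that, where 'a = 'a] by (metis of_nat_less_iff of_nat_power)
    moreover have "fls_subdegree (emb (coeff p o')) \<le> 0"
    proof (rule ccontr)
      assume "\<not> fls_subdegree (emb (coeff p o')) \<le> 0"
      then have "emb (coeff p o') = 0"
        by (intro emb_eq_0_if_ordge_1) (simp add: ord_ge_iff_subdegree)
      with o' show False by simp
    qed
    ultimately show False by (simp add: algebra_simps)
  qed
  then show ?thesis by blast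
qed

text \<open>A relation whose coefficients have degree \<open>O(q\<^sup>N)\<close> is tested on Hermite-Pade
  approximants: the value of the relation at an approximant is, up to a power of \<open>theta\<close>, a polynomial
  in \<open>theta\<close> of positive order at infinity, hence zero. Since there are enough approximants, no zero
  estimate is needed.\<close>

theorem mahler_relation_vanishes:
  fixes z :: "'i \<Rightarrow> nat \<Rightarrow> 'a::{field,finite} fls" and \<psi> :: "'i \<Rightarrow> 'a poly fps"
    and \<rho> :: "nat \<Rightarrow> 'i \<Rightarrow> 'a poly"
  assumes I: "finite I" and exp: "\<And>i. i \<in> I \<Longrightarrow> expansion (z i) (\<psi> i)"
    and indep: "\<And>R. (\<Sum>i\<in>I. fps_of_poly (R i) * \<psi> i) = 0 \<Longrightarrow> \<forall>i\<in>I. R i = 0"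
    and deg: "\<And>N i. N1 \<le> N \<Longrightarrow> i \<in> I \<Longrightarrow> degree (\<rho> N i) \<le> C * CARD('a) ^ N"
    and rel: "\<And>N. N1 \<le> N \<Longrightarrow> (\<Sum>i\<in>I. emb (\<rho> N i) * z i N) = 0"
  shows "\<exists>N0. \<forall>N\<ge>N0. \<forall>i\<in>I. \<rho> N i = 0"
proof -
  define q where "q = CARD('a)"
  \<comment> \<open>The vectors that satisfy the relation at all large levels. If this module has
    full rank, every coefficient \<open>\<rho> N i\<close> dies eventually; an annihilator is what
    has to be excluded.\<close>
  define T where "T = {v :: 'i \<Rightarrow> 'a poly poly. (\<forall>i. i \<notin> I \<longrightarrow> v i = 0) \<and>
    (\<exists>N0. \<forall>N\<ge>N0. (\<Sum>i\<in>I. emb (\<rho> N i) * ev N (v i)) = 0)}"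
  have add: "(\<lambda>i. v i + u i) \<in> T" if v: "v \<in> T" and u: "u \<in> T" for v u
  proof -
    obtain M where M: "\<forall>N\<ge>M. (\<Sum>i\<in>I. emb (\<rho> N i) * ev N (v i)) = 0"
      using v by (auto simp: T_def)
    obtain M' where M': "\<forall>N\<ge>M'. (\<Sum>i\<in>I. emb (\<rho> N i) * ev N (u i)) = 0"
      using u by (auto simp: T_def)
    have "(\<Sum>i\<in>I. emb (\<rho> N i) * ev N (v i + u i)) = 0" if "N \<ge> max M M'" for N
      using M M' that by (simp add: ev.add distrib_left sum.distrib)
    moreover have "\<forall>i. i \<notin> I \<longrightarrow> v i + u i = 0" using u v by (simp add: T_def)
    ultimately show ?thesis by (auto simp: T_def intro!: exI[of _ "max M M'"])
  qed
  have scale: "(\<lambda>i. c * v i) \<in> T" if v: "v \<in> T" for c v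
  proof -
    obtain M where M: "\<forall>N\<ge>M. (\<Sum>i\<in>I. emb (\<rho> N i) * ev N (v i)) = 0"
      using v by (auto simp: T_def)
    have "(\<Sum>i\<in>I. emb (\<rho> N i) * ev N (c * v i)) = 0" if "N \<ge> M" for N
    proof -
      have "(\<Sum>i\<in>I. emb (\<rho> N i) * ev N (c * v i)) = ev N c * (\<Sum>i\<in>I. emb (\<rho> N i) * ev N (v i))"
        by (simp add: ev.mult sum_distrib_left mult.left_commute)
      with M that show ?thesis by simp
    qed
    moreover have "\<forall>i. i \<notin> I \<longrightarrow> c * v i = 0" using v by (simp add: T_def)
    ultimately show ?thesis by (auto simp: T_def intro!: exI[of _ M])
  qed
  have dich: "(\<exists>R. (\<exists>i\<in>I. R i \<noteq> 0) \<and> (\<forall>v\<in>T. (\<Sum>i\<in>I. R i * v i) = 0)) \<or>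
    (\<exists>\<Delta>. \<Delta> \<noteq> 0 \<and> (\<forall>i\<in>I. (\<lambda>j. if j = i then \<Delta> else 0) \<in> T))"
    by (rule submodule_annihilator_or_full_rank[OF I add scale]) (auto simp: T_def)
  have no_annihilator: "\<not> (\<exists>R. (\<exists>i\<in>I. R i \<noteq> 0) \<and> (\<forall>v\<in>T. (\<Sum>i\<in>I. R i * v i) = 0))"
  proof
    assume "\<exists>R. (\<exists>i\<in>I. R i \<noteq> 0) \<and> (\<forall>v\<in>T. (\<Sum>i\<in>I. R i * v i) = 0)"
    then obtain R where R: "\<exists>i\<in>I. R i \<noteq> 0" "\<And>v. v \<in> T \<Longrightarrow> (\<Sum>i\<in>I. R i * v i) = 0" by blast
    define \<Theta> where "\<Theta> = (\<Sum>i\<in>I. fps_of_poly (R i) * \<psi> i)"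
    have \<Theta>: "\<Theta> \<noteq> 0" using indep[of R] R(1) unfolding \<Theta>_def by blast
    \<comment> \<open>\<open>P\<close> gets m unknown coefficients. For each of the series, C + 1
      consecutive coefficients of \<open>P * \<psi> i\<close> after position n have to vanish, so
      there is one unknown more than equations.\<close>
    define m where "m = (C + 1) * card I + 1"
    \<comment> \<open>The lowest term of \<open>P\<close> lies below m, so
      \<open>P * \<Theta>\<close> has a nonzero coefficient below position n. The contradiction will
      be that it vanishes up to n.\<close>
    define n where "n = m + subdegree \<Theta>"
    define E where "E = I \<times> {n+1..<n+(C+2)}"
    have "\<exists>v. (\<exists>j\<in>{..<m}. v j \<noteq> 0) \<and> (\<forall>e\<in>E. (\<Sum>j<m. fps_nth (\<psi> (fst e)) (snd e - j) * v j) = 0)"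
      by (rule homogeneous_system_nontrivial)
        (auto simp: E_def m_def card_cartesian_product mult.commute I)
    then obtain v where v: "\<exists>j\<in>{..<m}. v j \<noteq> 0"
      "\<forall>e\<in>E. (\<Sum>j<m. fps_nth (\<psi> (fst e)) (snd e - j) * v j) = 0" by auto
    define P where "P = (\<Sum>j<m. monom (v j) j)"
    have coeff_P: "coeff P j = (if j < m then v j else 0)" for j
      by (simp add: P_def coeff_sum if_distrib cong: if_cong)
    then have "P \<noteq> 0" using v(1) by (metis coeff_0 lessThan_iff)
    have gap: "fps_nth (fps_of_poly P * \<psi> i) k = 0" if "i \<in> I" "n < k" "k < n + (C + 2)" for i k
    proof -
      have "fps_nth (fps_of_poly P * \<psi> i) k = (\<Sum>j=0..k. if j < m then v j * fps_nth (\<psi> i) (k - j) else 0)"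
        unfolding fps_mult_nth by (intro sum.cong) (auto simp: coeff_P)
      also have "\<dots> = (\<Sum>j<m. fps_nth (\<psi> i) (k - j) * v j)"
        using that by (intro sum.mono_neutral_cong_right) (auto simp: n_def)
      also have "\<dots> = 0" using bspec[OF v(2), of "(i, k)"] that by (simp add: E_def)
      finally show ?thesis .
    qed
    define p where "p i = (if i \<in> I then fps_trunc (n + 1) (fps_of_poly P * \<psi> i) else 0)" for i
    have tr_p: "fps_trunc (n + (C + 2)) (fps_of_poly P * \<psi> i) = p i" if "i \<in> I" for i
      using gap[OF that] that by (intro poly_eqI) (auto simp: p_def coeff_fps_trunc)
    have "\<forall>i\<in>I. \<exists>(c::nat) N0. \<forall>N\<ge>N0. ord_ge (ev N P * z i N - ev N (p i)) (int (n + (C + 2)) * int (q ^ N) - int c)"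
      using expansion_mult[OF expansion_ev exp, of _ P] tr_p unfolding expansion_def q_def by metis
    then obtain c N0 where c: "\<And>i N. i \<in> I \<Longrightarrow> N \<ge> N0 i \<Longrightarrow>
      ord_ge (ev N P * z i N - ev N (p i)) (int (n + (C + 2)) * int (q ^ N) - int (c i :: nat))" by metis
    define c' where "c' = (\<Sum>i\<in>I. c i)"
    define N' where "N' = N1 + (\<Sum>i\<in>I. N0 i) + c'"
    have "(\<Sum>i\<in>I. emb (\<rho> N i) * ev N (p i)) = 0" if N: "N \<ge> N'" for N
    proof -
      define x where "x = (\<Sum>i\<in>I. emb (\<rho> N i) * ev N (p i))"
      have "x = ev N P * (\<Sum>i\<in>I. emb (\<rho> N i) * z i N) - (\<Sum>i\<in>I. emb (\<rho> N i) * (ev N P * z i N - ev N (p i)))"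
        by (simp add: x_def sum_distrib_left algebra_simps sum_subtractf)
      also have "(\<Sum>i\<in>I. emb (\<rho> N i) * z i N) = 0" using rel N by (simp add: N'_def)
      finally have x: "x = - (\<Sum>i\<in>I. emb (\<rho> N i) * (ev N P * z i N - ev N (p i)))" by simp
      \<comment> \<open>Of the approximation order (n + C + 2) q^N, the coefficients of the relation
        use up C q^N. The rest exceeds by 2 q^N - c' >= 1 the n q^N lost in clearing the
        denominators of \<open>ev N (p i)\<close>.\<close>
      have ord_x: "ord_ge x (int (n + 2) * int (q ^ N) - int c')"
        unfolding x
      proof (intro ord_ge_uminus ord_ge_sum)
        fix i assume i: "i \<in> I"
        have "N0 i \<le> (\<Sum>i\<in>I. N0 i)" "c i \<le> c'" unfolding c'_def using i I by (auto intro: member_le_sum)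
        then have "ord_ge (ev N P * z i N - ev N (p i)) (int (n + (C + 2)) * int (q ^ N) - int c')"
          using N i by (intro ord_ge_mono[OF c]) (auto simp: N'_def)
        moreover have "ord_ge (emb (\<rho> N i)) (- int (C * q ^ N))"
          using deg[of N i] N i by (intro ord_ge_emb) (simp add: N'_def q_def)
        ultimately show "ord_ge (emb (\<rho> N i) * (ev N P * z i N - ev N (p i))) (int (n + 2) * int (q ^ N) - int c')"
          by (intro ord_ge_mono[OF ord_ge_mult]) (auto simp: algebra_simps)
      qed
      have "int c' < int q ^ N"
        using less_card_power[of c' N, where 'a = 'a] N unfolding N'_def q_def by (metis le_add2 le_trans of_nat_less_iff of_nat_power)
      then have bound: "1 + int c' \<le> 2 * int q ^ N" by linarith
      have "ord_ge (x * theta ^ (n * q ^ N)) 1"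
      proof -
        have "ord_ge (theta ^ (n * q ^ N) :: 'a fls) (- int (n * q ^ N))"
          by (simp add: ord_ge_iff_subdegree theta_def)
        from ord_ge_mult[OF ord_x this] show ?thesis
          by (elim ord_ge_mono) (use bound in \<open>simp add: algebra_simps\<close>)
      qed
      moreover have "\<exists>a. x * theta ^ (n * q ^ N) = emb a"
      proof -
        have low: "\<exists>a. ev N (p i) * theta ^ (n * q ^ N) = emb a" if "i \<in> I" for i
        proof -
          have "degree (p i) \<le> n" using that by (intro degree_le) (auto simp: p_def coeff_fps_trunc)
          then have "ev N (p i) = (\<Sum>k\<le>n. emb (coeff (p i) k) * wval N ^ k)"
            unfolding ev_altdef by (intro sum.mono_neutral_left) (auto simp: coeff_eq_0)
          then have "ev N (p i) * theta ^ (n * q ^ N) = (\<Sum>k\<le>n. emb (coeff (p i) k) * (wval N ^ k * theta ^ (n * q ^ N)))"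
            by (simp add: sum_distrib_right mult.assoc)
          also have "\<dots> = (\<Sum>k\<le>n. emb (coeff (p i) k) * theta ^ ((n - k) * q ^ N))"
          proof (intro sum.cong refl)
            fix k assume "k \<in> {..n}"
            then have "n * q ^ N = k * q ^ N + (n - k) * q ^ N" by (simp flip: distrib_right)
            then have "wval N ^ k * theta ^ (n * q ^ N) = (fls_X * theta) ^ (k * q ^ N) * (theta ^ ((n - k) * q ^ N) :: 'a fls)"
              by (simp only: power_add power_mult_distrib wval_def q_def mult.commute[of k] power_mult mult.assoc)
            then show "emb (coeff (p i) k) * (wval N ^ k * theta ^ (n * q ^ N)) = emb (coeff (p i) k) * theta ^ ((n - k) * q ^ N)"
              by simp
          qed
          also have "\<dots> = emb (\<Sum>k\<le>n. coeff (p i) k * [:0, 1:] ^ ((n - k) * q ^ N))"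
            by (simp only: emb.sum emb.mult emb.power emb_X)
          finally show ?thesis by blast
        qed
        then obtain a where a: "\<And>i. i \<in> I \<Longrightarrow> ev N (p i) * theta ^ (n * q ^ N) = emb (a i)" by metis
        have "x * theta ^ (n * q ^ N) = (\<Sum>i\<in>I. emb (\<rho> N i) * (ev N (p i) * theta ^ (n * q ^ N)))"
          by (simp add: x_def sum_distrib_right mult.assoc)
        also have "\<dots> = emb (\<Sum>i\<in>I. \<rho> N i * a i)" by (simp add: a emb.sum emb.mult)
        finally show ?thesis by blast
      qed
      ultimately have "x * theta ^ (n * q ^ N) = 0" using emb_eq_0_if_ordge_1 by metis
      then show ?thesis by (simp add: x_def)
    qed
    then have "p \<in> T" by (auto simp: T_def p_def)
    then have "(\<Sum>i\<in>I. R i * p i) = 0" by (rule R(2))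
    then have zero: "(\<Sum>i\<in>I. fps_of_poly (R i) * fps_of_poly (p i)) = 0"
      by (metis (no_types, lifting) fps_of_poly_0 fps_of_poly_mult fps_of_poly_sum sum.cong)
    \<comment> \<open>\<open>R\<close> kills \<open>p\<close>, so only the remainders of
      \<open>P * \<psi> i\<close> beyond degree n survive.\<close>
    have PT: "fps_of_poly P * \<Theta> = (\<Sum>i\<in>I. fps_of_poly (R i) * (fps_of_poly P * \<psi> i - fps_of_poly (p i)))"
      using zero by (simp add: \<Theta>_def sum_distrib_left right_diff_distrib sum_subtractf mult.left_commute)
    have "fps_nth (fps_of_poly P * \<Theta>) k = 0" if "k \<le> n" for k
      unfolding PT fps_sum_nth fps_mult_nth using that
      by (intro sum.neutral ballI) (auto simp: p_def coeff_fps_trunc)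
    moreover have "fps_nth (fps_of_poly P * \<Theta>) (subdegree (fps_of_poly P * \<Theta>)) \<noteq> 0"
      using \<open>P \<noteq> 0\<close> \<Theta> by (intro nth_subdegree_nonzero) simp
    ultimately have "n < subdegree (fps_of_poly P * \<Theta>)" by (meson not_le)
    also have "\<dots> = subdegree (fps_of_poly P) + subdegree \<Theta>"
      using \<open>P \<noteq> 0\<close> \<Theta> by (intro subdegree_mult) auto
    also have "subdegree (fps_of_poly P) < m"
    proof -
      obtain j where "j < m" "v j \<noteq> 0" using v(1) by blast
      then have "subdegree (fps_of_poly P) \<le> j" by (intro subdegree_leI) (simp add: coeff_P)
      with \<open>j < m\<close> show ?thesis by simp
    qed
    finally show False by (simp add: n_def)
  qed
  from dich have "\<exists>\<Delta>. \<Delta> \<noteq> 0 \<and> (\<forall>i\<in>I. (\<lambda>j. if j = i then \<Delta> else 0) \<in> T)"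
    by (rule disjE) (erule notE[OF no_annihilator], assumption)
  then obtain \<Delta> where \<Delta>: "\<Delta> \<noteq> 0" "\<forall>i\<in>I. (\<lambda>j. if j = i then \<Delta> else 0) \<in> T"
    by (elim exE conjE)
  \<comment> \<open>On a multiple of a unit vector the relation consists of the single term
    \<open>emb (\<rho> N i) * ev N \<Delta>\<close>, whose second factor is nonzero at large
    levels.\<close>
  obtain M where M: "\<And>N. N \<ge> M \<Longrightarrow> ev N \<Delta> \<noteq> 0" using ev_nonzero_eventually[OF \<Delta>(1)] by blast
  have "\<exists>N0. \<forall>N\<ge>N0. \<rho> N i = 0" if i: "i \<in> I" for i
  proof -
    from bspec[OF \<Delta>(2) i]
    have "\<exists>N0. \<forall>N\<ge>N0. (\<Sum>j\<in>I. emb (\<rho> N j) * ev N (if j = i then \<Delta> else 0)) = 0"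
      by (simp only: T_def mem_Collect_eq)
    then obtain N0 where N0: "\<forall>N\<ge>N0. (\<Sum>j\<in>I. emb (\<rho> N j) * ev N (if j = i then \<Delta> else 0)) = 0"
      by (elim exE)
    have "\<rho> N i = 0" if "N \<ge> max N0 M" for N
    proof -
      have "(\<Sum>j\<in>I. emb (\<rho> N j) * ev N (if j = i then \<Delta> else 0)) = (\<Sum>j\<in>I. if j = i then emb (\<rho> N j) * ev N \<Delta> else 0)"
        by (intro sum.cong) auto
      then show ?thesis using N0 M[of N] that i I by simp
    qed
    then show ?thesis by blast
  qed
  then obtain N0 where N0: "\<And>i N. i \<in> I \<Longrightarrow> N \<ge> N0 i \<Longrightarrow> \<rho> N i = 0" by metis
  have "\<rho> N i = 0" if "i \<in> I" "N \<ge> (\<Sum>i\<in>I. N0 i)" for N i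
    using that I member_le_sum[of i I N0] by (intro N0) auto
  then show ?thesis by blast
qed

section \<open>The product and its hyperderivatives\<close>

text \<open>The expansion x(theta + X). The product rule says that it is a ring homomorphism, and
  powers of x become powers of series.\<close>

definition taylor :: "'a::field fls \<Rightarrow> 'a fls fps" where
  "taylor x = Abs_fps (\<lambda>n. fls_hyperderiv n x)"

lemma fls_hyperderiv_nth_shift: "fls_nth (fls_hyperderiv n f) k = fls_nth f (k - int n) * of_int (int_binomial (- (k - int n)) n)"
  using fls_hyperderiv_nth[of n f "k - int n"] by simp

lemma int_binomial_0: "int_binomial a 0 = 1"
  by (simp add: int_binomial_def)

lemma int_binomial_0_left: "0 < n \<Longrightarrow> int_binomial 0 n = 0"
proof -
  assume "0 < n"
  then have "(\<Prod>i=0..<n. 0 - int i) = 0" by (intro prod_zero) auto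
  then show ?thesis by (simp only: int_binomial_def div_0)
qed

lemma int_binomial_1_left: "int_binomial 1 n = (if n \<le> 1 then 1 else 0)"
proof (cases "n \<le> 1")
  case True
  then have "n = 0 \<or> n = 1" by auto
  then show ?thesis by (auto simp: int_binomial_def)
next
  case False
  then have "(\<Prod>i=0..<n. 1 - int i) = 0" by (intro prod_zero bexI[of _ 1]) auto
  with False show ?thesis by (simp only: int_binomial_def div_0 if_False)
qed

lemma fls_hyperderiv_0: "fls_hyperderiv 0 x = x"
  by (rule fls_eqI) (simp add: fls_hyperderiv_nth_shift int_binomial_0)

lemma fls_hyperderiv_one: "fls_hyperderiv n 1 = (if n = 0 then 1 else 0)"
  by (rule fls_eqI) (auto simp: fls_hyperderiv_nth_shift int_binomial_0 int_binomial_0_left)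

lemma fls_hyperderiv_theta: "fls_hyperderiv n theta = (if n = 0 then theta else if n = 1 then 1 else 0)"
proof (rule fls_eqI)
  fix k
  show "fls_nth (fls_hyperderiv n theta) k = fls_nth (if n = 0 then theta else if n = 1 then 1 else 0) k"
    by (cases "k = int n - 1") (auto simp: fls_hyperderiv_nth_shift theta_def int_binomial_1_left)
qed

lemma taylor_add: "taylor (x + y) = taylor x + taylor y"
  by (rule fps_ext) (auto simp: taylor_def fls_hyperderiv_nth_shift distrib_right intro!: fls_eqI)

lemma taylor_theta: "taylor theta = fps_const theta + fps_X"
  by (rule fps_ext) (auto simp: taylor_def fls_hyperderiv_theta)

lemma ord_ge_hyperderiv: "ord_ge x B \<Longrightarrow> ord_ge (fls_hyperderiv n x) B"
  by (auto simp: ord_ge_def fls_hyperderiv_nth_shift)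

text \<open>The product rule for \<^const>\<open>fls_hyperderiv\<close> is inherited from the given higher derivation.\<close>

locale leibniz =
  fixes dummy :: "'a::{field,finite} itself"
  assumes taylor_mult: "taylor (x * y :: 'a fls) = taylor x * taylor y"
begin

sublocale taylor: ring_map "taylor :: 'a fls \<Rightarrow> 'a fls fps"
proof
  show "taylor (0 :: 'a fls) = 0" by (rule fps_ext) (auto simp: taylor_def fls_hyperderiv_nth_shift intro!: fls_eqI)
  show "taylor (1 :: 'a fls) = 1" by (rule fps_ext) (simp add: taylor_def fls_hyperderiv_one)
qed (auto simp: taylor_add taylor_mult)

lemma hyperderiv_diff: "fls_hyperderiv n (x - y :: 'a fls) = fls_hyperderiv n x - fls_hyperderiv n y"
  using arg_cong[OF taylor.diff[of x y], of "\<lambda>F. fps_nth F n"] by (simp add: taylor_def)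

lemma hyperderiv_sum: "fls_hyperderiv n (\<Sum>i\<in>I. x i :: 'a fls) = (\<Sum>i\<in>I. fls_hyperderiv n (x i))"
  using arg_cong[OF taylor.sum[of x I], of "\<lambda>F. fps_nth F n"] by (simp add: taylor_def fps_sum_nth)

lemma hyperderiv_theta_mult:
  "fls_hyperderiv n (theta * x :: 'a fls) = theta * fls_hyperderiv n x + (if n = 0 then 0 else fls_hyperderiv (n - 1) x)"
proof -
  have "fps_nth (taylor (theta * x)) n = theta * fps_nth (taylor x) n + (if n = 0 then 0 else fps_nth (taylor x) (n - 1))"
    by (simp only: taylor_mult taylor_theta distrib_right) simp
  then show ?thesis by (simp only: taylor_def fps_nth_Abs_fps)
qed

text \<open>\<open>wval N ^ k\<close> is a q^N-th power, so its Taylor expansion is a series in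
  X^(q^N) and is constant up to order n.\<close>

lemma hyperderiv_mult_w_power:
  assumes "n < CARD('a) ^ N"
  shows "fls_hyperderiv n (x * wval N ^ k :: 'a fls) = fls_hyperderiv n x * wval N ^ k"
proof -
  have frob: "frobenius_exponent CHAR('a fls) CARD('a)"
    using finite_field_frobenius_exponent[where 'a = 'a] by simp
  have "wval N ^ k = (fls_X ^ k :: 'a fls) ^ (CARD('a) ^ N)"
    by (simp add: wval_def mult.commute flip: power_mult)
  then have T: "taylor (wval N ^ k :: 'a fls) = taylor (fls_X ^ k) ^ (CARD('a) ^ N)"
    by (simp only: taylor.power)
  have nth: "fps_nth (taylor (wval N ^ k :: 'a fls)) i = (if i = 0 then wval N ^ k else 0)" if "i \<le> n" for i
  proof (cases "i = 0")
    case True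
    then show ?thesis by (simp add: taylor_def fls_hyperderiv_0)
  next
    case False
    then have "\<not> CARD('a) ^ N dvd i" using that assms by (meson dvd_imp_le le_less_trans not_le gr0I)
    with False show ?thesis unfolding T by (simp add: fps_nth_power_frobenius[OF frob])
  qed
  have "fls_hyperderiv n (x * wval N ^ k) = fps_nth (taylor (x * wval N ^ k)) n" by (simp add: taylor_def)
  also have "\<dots> = (\<Sum>i=0..n. fps_nth (taylor x) i * fps_nth (taylor (wval N ^ k)) (n - i))"
    by (simp only: taylor_mult fps_mult_nth)
  also have "\<dots> = (\<Sum>i=0..n. if i = n then fps_nth (taylor x) n * wval N ^ k else 0)"
    by (intro sum.cong) (auto simp: nth)
  finally show ?thesis by (simp add: taylor_def)
qed

text \<open>Putting theta + X for \<open>theta\<close> in the recursion at n = 0 gives the recursion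
  for all n.\<close>

lemma hyperderiv_phi: "fls_hyperderiv n (phi q (theta :: 'a fls) 0 k) = phi q theta n k"
proof (induction k arbitrary: n rule: less_induct)
  case (less k)
  have add: "fls_hyperderiv n (x + y :: 'a fls) = fls_hyperderiv n x + fls_hyperderiv n y" for n x y
    using arg_cong[OF taylor_add[of x y], of "\<lambda>F. fps_nth F n"] by (simp add: taylor_def)
  have zero: "fls_hyperderiv n (0 :: 'a fls) = 0" for n
    using arg_cong[OF taylor.zero, of "\<lambda>F. fps_nth F n"] by (simp add: taylor_def)
  show ?case
  proof (cases k)
    case 0
    then show ?thesis by (simp add: fls_hyperderiv_one)
  next
    case (Suc j)
    have "Suc j div q < k" if "2 \<le> q" using that Suc by (auto intro!: div_less_dividend)
    then show ?thesis using Suc less by (simp add: add zero hyperderiv_theta_mult)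
  qed
qed

end

text \<open>The factors \<open>1 - theta powi (1 - q\<^sup>j)\<close> of the product are the \<open>carlitz_factor j\<close>.\<close>

definition carlitz_factor :: "nat \<Rightarrow> 'a::{field,finite} fls" where
  "carlitz_factor j = 1 - theta * wval j"

lemma subdegree_theta_w: "fls_subdegree (theta * wval j :: 'a::{field,finite} fls) = int (CARD('a) ^ j) - 1"
proof -
  have "fls_subdegree (theta * wval j :: 'a fls) = fls_subdegree (theta :: 'a fls) + fls_subdegree (wval j :: 'a fls)"
    by (intro fls_subdegree_mult) auto
  then show ?thesis by (simp add: theta_def wval_def)
qed

lemma ord_ge_theta_w: "ord_ge (theta * wval j :: 'a::{field,finite} fls) (int j)"
proof -
  have "j < CARD('a) ^ j" by (rule less_card_power) simp
  then have "int j + 1 \<le> int (CARD('a) ^ j)" by linarith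
  then show ?thesis unfolding ord_ge_iff_subdegree subdegree_theta_w by linarith
qed

lemma carlitz_factor_unit:
  assumes "1 \<le> j"
  shows "carlitz_factor j \<noteq> (0 :: 'a::{field,finite} fls)" "fls_subdegree (carlitz_factor j :: 'a fls) = 0"
proof -
  have "ord_ge (theta * wval j :: 'a fls) 1" using assms by (intro ord_ge_mono[OF ord_ge_theta_w]) simp
  then have nth: "fls_nth (carlitz_factor j :: 'a fls) i = (if i = 0 then 1 else 0)" if "i < 1" for i
    using that by (simp add: carlitz_factor_def ord_ge_def)
  show "fls_subdegree (carlitz_factor j :: 'a fls) = 0"
    by (rule fls_subdegree_eqI) (simp_all add: nth)
  show "carlitz_factor j \<noteq> (0 :: 'a fls)" using nth[of 0] by auto
qed

lemma ord_ge_divide_unit: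
  assumes "ord_ge (u * x) B" "fls_subdegree u = 0" "u \<noteq> 0"
  shows "ord_ge x B"
  using assms unfolding ord_ge_iff_subdegree by (cases "x = 0") auto

definition carlitz_partial :: "nat \<Rightarrow> 'a::{field,finite} fls" where
  "carlitz_partial n = (\<Prod>j\<in>{1..<n}. carlitz_factor j)"

lemma carlitz_partial_Suc: "1 \<le> n \<Longrightarrow> carlitz_partial (Suc n) = carlitz_factor n * carlitz_partial n"
  by (simp add: carlitz_partial_def atLeastLessThanSuc)

lemma carlitz_partial_unit: "carlitz_partial n \<noteq> (0 :: 'a::{field,finite} fls)" "fls_subdegree (carlitz_partial n :: 'a fls) = 0"
proof -
  have "carlitz_partial n \<noteq> (0 :: 'a fls) \<and> fls_subdegree (carlitz_partial n :: 'a fls) = 0"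
  proof (induction n)
    case 0
    then show ?case by (simp add: carlitz_partial_def)
  next
    case (Suc n)
    show ?case
    proof (cases "1 \<le> n")
      case True
      with Suc carlitz_factor_unit[OF True, where 'a = 'a] show ?thesis by (simp add: carlitz_partial_Suc)
    qed (simp add: carlitz_partial_def)
  qed
  then show "carlitz_partial n \<noteq> (0 :: 'a::{field,finite} fls)" "fls_subdegree (carlitz_partial n :: 'a fls) = 0" by auto
qed

section \<open>Convergence of the product and expansion of its tails\<close>

lemma fls_limit_exists:
  fixes P :: "nat \<Rightarrow> 'a::field fls"
  assumes "\<And>n. ord_ge (P (Suc n) - P n) (int n)"
  shows "\<exists>Z. \<forall>n. ord_ge (Z - P n) (int n)"
proof -
  have stable: "fls_nth (P (n + k)) i = fls_nth (P n) i" if "i < int n" for n k i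
  proof (induction k)
    case (Suc k)
    have "fls_nth (P (Suc (n + k)) - P (n + k)) i = 0"
      using assms[of "n + k"] that by (auto simp: ord_ge_def)
    with Suc show ?case by simp
  qed simp
  \<comment> \<open>Coefficient i no longer changes from index i + 1 on; for negative i it is that
    of \<open>P 0\<close>, which also bounds the order of \<open>Z\<close> from below.\<close>
  define Z where "Z = Abs_fls (\<lambda>i. fls_nth (P (nat (i + 1))) i)"
  have Z: "fls_nth Z i = fls_nth (P (nat (i + 1))) i" for i
    unfolding Z_def
  proof (rule nth_Abs_fls_lower_bound[of "min (- 1) (fls_subdegree (P 0))"], intro allI impI)
    fix j assume "j < min (- 1) (fls_subdegree (P 0))"
    then show "fls_nth (P (nat (j + 1))) j = 0" by simp
  qed
  have "ord_ge (Z - P n) (int n)" for n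
    unfolding ord_ge_def
  proof (intro allI impI)
    fix i assume i: "i < int n"
    define m where "m = nat (i + 1)"
    have "fls_nth (P (m + (n - m))) i = fls_nth (P m) i" by (rule stable) (simp add: m_def)
    moreover have "m \<le> n" using i by (simp add: m_def)
    ultimately show "fls_nth (Z - P n) i = 0" by (simp add: Z m_def)
  qed
  then show ?thesis by blast
qed

lemma LIMSEQ_ordge:
  fixes P :: "nat \<Rightarrow> 'a::field fls"
  assumes "\<And>n. ord_ge (Z - P n) (int n)"
  shows "P \<longlonglongrightarrow> Z"
proof (rule metric_LIMSEQ_I)
  fix e :: real assume "e > 0"
  then obtain M where "(1 / 2) ^ M < e" using real_arch_pow_inv[of e "1 / 2"] by auto
  then have M: "inverse (2 ^ M) < e" by (simp add: power_one_over inverse_eq_divide)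
  have "dist (P n) Z < e" if "n \<ge> M" for n
  proof (cases "P n = Z")
    case False
    then have sub: "int n \<le> fls_subdegree (P n - Z)"
      using assms[of n] by (simp add: ord_ge_iff_subdegree fls_subdegree_minus_sym)
    then have "dist (P n) Z = inverse (2 ^ nat (fls_subdegree (P n - Z)))"
      using False by (simp add: dist_fls_def)
    also have "\<dots> \<le> inverse (2 ^ M)"
      using sub that by (intro le_imp_inverse_le power_increasing) auto
    finally show ?thesis using M by simp
  qed (use \<open>e > 0\<close> in simp)
  then show "\<exists>no. \<forall>n\<ge>no. dist (P n) Z < e" by blast
qed

text \<open>Fixed by order estimates, the form in which it is used;
  \<open>prodinf_carlitz_prod\<close> identifies it with the topological product.\<close>

definition carlitz_prod :: "'a::{field,finite} fls" where
  "carlitz_prod = (SOME Z. \<forall>n. ord_ge (Z - inverse (carlitz_partial (Suc n))) (int n))"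

lemma carlitz_prod_approx: "ord_ge (carlitz_prod - inverse (carlitz_partial (Suc n)) :: 'a::{field,finite} fls) (int n)"
proof -
  have "ord_ge (inverse (carlitz_partial (Suc (Suc n))) - inverse (carlitz_partial (Suc n)) :: 'a fls) (int n)" for n
  proof (rule ord_ge_divide_unit[OF _ carlitz_partial_unit(2) carlitz_partial_unit(1)])
    have c: "carlitz_factor (Suc n) \<noteq> (0 :: 'a fls)" by (rule carlitz_factor_unit) simp
    have "carlitz_partial (Suc (Suc n)) * (inverse (carlitz_partial (Suc (Suc n))) - inverse (carlitz_partial (Suc n)) :: 'a fls) = 1 - carlitz_factor (Suc n)"
      using carlitz_partial_unit(1)[of "Suc n", where 'a = 'a] c by (simp add: carlitz_partial_Suc field_simps)
    also have "\<dots> = theta * wval (Suc n)" by (simp add: carlitz_factor_def)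
    finally show "ord_ge (carlitz_partial (Suc (Suc n)) * (inverse (carlitz_partial (Suc (Suc n))) - inverse (carlitz_partial (Suc n)) :: 'a fls)) (int n)"
      using ord_ge_mono[OF ord_ge_theta_w[of "Suc n", where 'a = 'a], of "int n"] by simp
  qed
  from fls_limit_exists[of "\<lambda>n. inverse (carlitz_partial (Suc n))", OF this]
  have "\<forall>n. ord_ge (carlitz_prod - inverse (carlitz_partial (Suc n)) :: 'a fls) (int n)"
    unfolding carlitz_prod_def by (rule someI_ex)
  then show ?thesis by blast
qed

lemma carlitz_prod_subdegree: "fls_subdegree (carlitz_prod :: 'a::{field,finite} fls) = 0" "carlitz_prod \<noteq> (0 :: 'a fls)"
proof -
  define y where "y = inverse (carlitz_partial (Suc 1) :: 'a fls)"
  have y: "y \<noteq> 0" "fls_subdegree y = 0" using carlitz_partial_unit[of "Suc 1", where 'a = 'a] by (auto simp: y_def)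
  have nth: "fls_nth carlitz_prod i = fls_nth y i" if "i < 1" for i
    using carlitz_prod_approx[of 1, where 'a = 'a] that by (simp add: ord_ge_def y_def)
  have "fls_nth y 0 \<noteq> 0" using y by (metis nth_fls_subdegree_nonzero)
  then have "fls_nth carlitz_prod 0 \<noteq> (0 :: 'a)" using nth[of 0] by simp
  moreover have "fls_nth carlitz_prod i = (0 :: 'a)" if "i < 0" for i using nth[of i] y that by simp
  ultimately show "fls_subdegree (carlitz_prod :: 'a fls) = 0" by (intro fls_subdegree_eqI)
  show "carlitz_prod \<noteq> (0 :: 'a fls)" using \<open>fls_nth carlitz_prod 0 \<noteq> 0\<close> by auto
qed

lemma prodinf_carlitz_prod:
  "prodinf (\<lambda>j. inverse (1 - theta powi (1 - int (CARD('a) ^ Suc j)))) = (carlitz_prod :: 'a::{field,finite} fls)"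
proof -
  define g where "g j = inverse (1 - theta powi (1 - int (CARD('a) ^ Suc j)) :: 'a fls)" for j
  have g: "g j = inverse (carlitz_factor (Suc j))" for j
  proof -
    have "theta powi (1 - int (CARD('a) ^ Suc j)) = (theta :: 'a fls) powi 1 * inverse theta powi int (CARD('a) ^ Suc j)"
      by (simp only: power_int_diff theta_nz power_int_inverse divide_inverse simp_thms)
    also have "\<dots> = theta * wval (Suc j)"
      by (simp only: power_int_1_right power_int_of_nat theta_def fls_inverse_X_inv wval_def)
    finally show ?thesis by (simp add: g_def carlitz_factor_def)
  qed
  have "(\<Prod>j\<le>n. g j) = inverse (carlitz_partial (Suc (Suc n)))" for n
  proof (induction n)
    case 0
    then show ?case by (simp add: g carlitz_partial_def)
  next
    case (Suc n)
    then show ?case by (simp add: g carlitz_partial_Suc[of "Suc (Suc n)"])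
  qed
  moreover have "ord_ge (carlitz_prod - inverse (carlitz_partial (Suc (Suc n))) :: 'a fls) (int n)" for n
    by (rule ord_ge_mono[OF carlitz_prod_approx]) simp
  ultimately have "(\<lambda>n. \<Prod>j\<le>n. g j) \<longlonglongrightarrow> carlitz_prod" by (intro LIMSEQ_ordge) simp
  then have "g has_prod carlitz_prod" by (simp add: has_prod_def raw_has_prod_def carlitz_prod_subdegree(2))
  then show ?thesis unfolding g_def by (rule has_prod_unique[symmetric])
qed

text \<open>\<open>carlitz_tail N\<close> is the part of the product over \<open>j \<ge> N\<close>.\<close>

definition carlitz_tail :: "nat \<Rightarrow> 'a::{field,finite} fls" where
  "carlitz_tail N = carlitz_prod * carlitz_partial N"

lemma carlitz_tail_Suc: "1 \<le> N \<Longrightarrow> carlitz_tail (Suc N) = carlitz_factor N * carlitz_tail N"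
  by (simp add: carlitz_tail_def carlitz_partial_Suc)

lemma ord_ge_carlitz_tail: "ord_ge (carlitz_tail N :: 'a::{field,finite} fls) 0"
proof -
  have "ord_ge (carlitz_prod * carlitz_partial N :: 'a fls) (0 + 0)"
    by (intro ord_ge_mult) (auto simp: ord_ge_iff_subdegree carlitz_prod_subdegree carlitz_partial_unit)
  then show ?thesis by (simp add: carlitz_tail_def)
qed

lemma carlitz_tail_limit: "ord_ge (carlitz_tail (Suc N) - 1 :: 'a::{field,finite} fls) (int N)"
proof -
  have "ord_ge ((carlitz_prod - inverse (carlitz_partial (Suc N))) * carlitz_partial (Suc N) :: 'a fls) (int N + 0)"
    by (intro ord_ge_mult carlitz_prod_approx) (auto simp: ord_ge_iff_subdegree carlitz_partial_unit)
  then show ?thesis using carlitz_partial_unit(1)[of "Suc N", where 'a = 'a] by (simp add: carlitz_tail_def left_diff_distrib)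
qed

text \<open>\<open>wval (Suc N)\<close> is the q-th power of \<open>wval N\<close>, so moving up a
  level is the substitution w -> w^q.\<close>

lemma ev_Suc:
  fixes p :: "'a::{field,finite} poly poly"
  shows "ev (Suc N) p = ev N (\<Sum>k\<le>degree p. monom (coeff p k) (CARD('a) * k))"
  unfolding ev_altdef[of "Suc N"] ev.sum ev_monom
  by (intro sum.cong refl) (simp add: wval_def mult_ac flip: power_mult)

text \<open>The tails satisfy the functional equation exactly, the truncation up to order m q^N - c.
  An estimate at \<open>Suc N\<close> therefore descends to \<open>N\<close>, where one divides by a
  unit. For m > 0 the descent starts at a far level, where tail and truncation are both close to
  1.\<close>

lemma expansion_carlitz_tail:
  fixes m :: nat
  defines "F \<equiv> phi_fps CARD('a) ([:0, 1:] :: 'a::{field,finite} poly) 0"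
  shows "\<exists>c::nat. \<forall>N\<ge>1. ord_ge (carlitz_tail N - ev N (fps_trunc m F) :: 'a fls) (int m * int (CARD('a) ^ N) - int c)"
proof -
  define q where "q = CARD('a)"
  have q: "2 \<le> q" by (simp add: q_def card_field_ge_2)
  define S where "S = fps_trunc m F"
  define G where "G = (\<Sum>k\<le>degree S. monom (coeff S k) (q * k))"
  have coeff_G: "coeff G i = (if q dvd i then coeff S (i div q) else 0)" for i
  proof (cases "q dvd i")
    case True
    then obtain j where j: "i = q * j" by blast
    have "coeff G i = (\<Sum>k\<le>degree S. if k = j then coeff S k else 0)"
      unfolding G_def coeff_sum using q by (intro sum.cong) (auto simp: j)
    then show ?thesis using True q by (auto simp: j coeff_eq_0)
  qed (auto simp: G_def coeff_sum intro!: sum.neutral)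
  define tw :: "'a poly poly" where "tw = monom [:0, 1:] 1"
  have low: "coeff ((1 - tw) * S - G) k = 0" if "k < m" for k
  proof -
    have eq: "F oo fps_X ^ q = (1 - fps_const [:0, 1:] * fps_X) * F"
      unfolding F_def q_def[symmetric] using phi_fps_functional_equation[OF q, of "[:0, 1:]" 0] by simp
    have "coeff (tw * S) k = (if k = 0 then 0 else [:0, 1:] * coeff S (k - 1))"
      unfolding tw_def by (cases k) (auto simp: coeff_monom_mult)
    moreover have "fps_nth (F oo fps_X ^ q) k = fps_nth F k - (if k = 0 then 0 else [:0, 1:] * fps_nth F (k - 1))"
      unfolding eq by (simp add: left_diff_distrib mult.assoc)
    moreover have "k div q < m" using that by (rule le_less_trans[OF div_le_dividend])
    ultimately show ?thesis using that
      by (simp add: left_diff_distrib coeff_G S_def coeff_fps_trunc fps_nth_compose_X_power split: if_splits)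
  qed
  obtain c :: nat where c: "\<And>N. ord_ge (ev N ((1 - tw) * S - G)) (int m * int (q ^ N) - int c)"
    using ev_low_coeffs_zero[OF low] unfolding q_def by blast
  have descend: "ord_ge (carlitz_tail N - ev N S :: 'a fls) B"
    if "ord_ge (carlitz_tail (Suc N) - ev (Suc N) S :: 'a fls) B" "B \<le> int m * int (q ^ N) - int c" "1 \<le> N" for N B
  proof -
    have "ev (Suc N) S = (ev N G :: 'a fls)" unfolding G_def q_def by (rule ev_Suc)
    moreover have "ev N tw = theta * (wval N :: 'a fls)" by (simp add: tw_def ev_monom emb_X)
    ultimately have "carlitz_factor N * (carlitz_tail N - ev N S) = (carlitz_tail (Suc N) - ev (Suc N) S) - (ev N ((1 - tw) * S - G) :: 'a fls)"
      using that(3) by (simp add: carlitz_tail_Suc ev.diff ev.mult right_diff_distrib left_diff_distrib) (simp add: carlitz_factor_def left_diff_distrib)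
    moreover have "ord_ge \<dots> B" by (rule ord_ge_diff[OF that(1) ord_ge_mono[OF c that(2)]])
    ultimately have "ord_ge (carlitz_factor N * (carlitz_tail N - ev N S) :: 'a fls) B" by simp
    then show ?thesis by (rule ord_ge_divide_unit) (use carlitz_factor_unit[OF that(3)] in auto)
  qed
  have far: "\<exists>M>N. ord_ge (carlitz_tail M - ev M S :: 'a fls) (int m * int (q ^ N) - int c)" for N
  proof (cases m)
    case 0
    \<comment> \<open>The empty truncation is not close to 1, but for m = 0 only order -c is
      required.\<close>
    then have "S = 0" by (intro poly_eqI) (simp add: S_def coeff_fps_trunc)
    then show ?thesis using 0 ord_ge_mono[OF ord_ge_carlitz_tail[of "Suc N", where 'a = 'a], of "- int c"]
      by (intro exI[of _ "Suc N"]) simp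
  next
    case (Suc m')
    have "coeff (S - 1) k = 0" if "k < 1" for k
      using that Suc by (simp add: S_def coeff_fps_trunc F_def phi_fps_def)
    then obtain b :: nat where b: "\<And>N. ord_ge (ev N (S - 1)) (int 1 * int (CARD('a) ^ N) - int b)"
      using ev_low_coeffs_zero[of 1 "S - 1"] by blast
    \<comment> \<open>Large enough that tail and truncation at level \<open>Suc L\<close> differ
      from 1 by terms of the order required at \<open>N\<close>.\<close>
    define L where "L = m * q ^ N + b + N"
    have "int L \<le> int (q ^ Suc L)"
      using less_card_power[of L "Suc L", where 'a = 'a] by (simp add: q_def del: power_Suc)
    then have "ord_ge (ev (Suc L) (S - 1) :: 'a fls) (int m * int (q ^ N) - int c)"
      by (intro ord_ge_mono[OF b]) (simp add: L_def q_def del: power_Suc)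
    moreover have "ord_ge (carlitz_tail (Suc L) - 1 :: 'a fls) (int m * int (q ^ N) - int c)"
      by (rule ord_ge_mono[OF carlitz_tail_limit]) (simp add: L_def)
    ultimately have "ord_ge ((carlitz_tail (Suc L) - 1) - ev (Suc L) (S - 1) :: 'a fls) (int m * int (q ^ N) - int c)"
      by (rule ord_ge_diff[rotated])
    then show ?thesis by (intro exI[of _ "Suc L"]) (simp add: ev.diff L_def)
  qed
  have "ord_ge (carlitz_tail N - ev N S :: 'a fls) (int m * int (q ^ N) - int c)" if N: "1 \<le> N" for N
  proof -
    obtain M where M: "M > N" "ord_ge (carlitz_tail M - ev M S :: 'a fls) (int m * int (q ^ N) - int c)" using far by blast
    have "ord_ge (carlitz_tail k - ev k S :: 'a fls) (int m * int (q ^ N) - int c)" if "k \<le> M" "N \<le> k" for k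
      using that
    proof (induction rule: inc_induct)
      case base
      show ?case by (rule M(2))
    next
      case (step k)
      have "q ^ N \<le> q ^ k" using step.prems q by (intro power_increasing) auto
      then have "int (q ^ N) \<le> int (q ^ k)" by (simp only: of_nat_le_iff)
      then have le: "int m * int (q ^ N) \<le> int m * int (q ^ k)" by (rule mult_left_mono) simp
      show ?case
      proof (rule descend)
        show "ord_ge (carlitz_tail (Suc k) - ev (Suc k) S :: 'a fls) (int m * int (q ^ N) - int c)"
          using step by simp
      qed (use le step.prems N in simp_all)
    qed
    then show ?thesis using M(1) by simp
  qed
  then show ?thesis unfolding S_def q_def by blast
qed

definition tail_deriv :: "nat \<Rightarrow> nat \<Rightarrow> 'a::{field,finite} fls" where
  "tail_deriv N n = fls_hyperderiv n (carlitz_tail N)"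

context leibniz
begin

text \<open>Once q^N exceeds n, the powers of \<open>wval N\<close> are constants for the
  hyperderivation of order n. It acts on the coefficients only, taking those of the series with
  index 0 to those with index n, and it does not lower orders.\<close>

lemma expansion_tail_deriv: "expansion (\<lambda>N. tail_deriv N n :: 'a fls) (phi_fps CARD('a) [:0, 1:] n)"
  unfolding expansion_def
proof
  fix m
  define q where "q = CARD('a)"
  define F where "F = (phi_fps q ([:0, 1:] :: 'a poly) 0)"
  define G where "G = (phi_fps q ([:0, 1:] :: 'a poly) n)"
  obtain c :: nat where c: "\<And>N. 1 \<le> N \<Longrightarrow> ord_ge (carlitz_tail N - ev N (fps_trunc m F) :: 'a fls) (int m * int (q ^ N) - int c)"
    using expansion_carlitz_tail[of m, where 'a = 'a] unfolding F_def q_def by blast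
  have ev_tr: "ev N (fps_trunc m H) = (\<Sum>k<m. emb (fps_nth H k) * (wval N ^ k :: 'a fls))" for H N
  proof -
    have "fps_trunc m H = (\<Sum>k<m. monom (fps_nth H k) k)"
      by (rule poly_eqI) (simp add: coeff_fps_trunc coeff_sum if_distrib cong: if_cong)
    then show ?thesis by (simp add: ev.sum ev_monom)
  qed
  have "ord_ge (tail_deriv N n - ev N (fps_trunc m G) :: 'a fls) (int m * int (q ^ N) - int c)" if N: "N \<ge> Suc n" for N
  proof -
    have n: "n < CARD('a) ^ N" using N by (intro less_card_power) simp
    have "fls_hyperderiv n (ev N (fps_trunc m F)) = (ev N (fps_trunc m G) :: 'a fls)"
      unfolding ev_tr hyperderiv_sum hyperderiv_mult_w_power[OF n]
      by (simp add: F_def G_def phi_fps_def emb.phi emb_X hyperderiv_phi)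
    then have "tail_deriv N n - ev N (fps_trunc m G) = (fls_hyperderiv n (carlitz_tail N - ev N (fps_trunc m F)) :: 'a fls)"
      by (simp add: tail_deriv_def hyperderiv_diff)
    then show ?thesis using c[of N] N by (simp add: ord_ge_hyperderiv)
  qed
  then show "\<exists>c N0. \<forall>N\<ge>N0. ord_ge (tail_deriv N n - ev N (fps_trunc m (phi_fps CARD('a) [:0, 1:] n)) :: 'a fls) (int m * int (CARD('a) ^ N) - int c)"
    unfolding G_def q_def by blast
qed

lemma tail_deriv_Suc:
  assumes "1 \<le> N" "n < CARD('a) ^ N"
  shows "tail_deriv (Suc N) n = (carlitz_factor N * tail_deriv N n - (if n = 0 then 0 else wval N * tail_deriv N (n - 1)) :: 'a fls)"
proof -
  have "carlitz_tail (Suc N) = carlitz_tail N - theta * carlitz_tail N * (wval N ^ 1 :: 'a fls)"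
    using assms(1) by (simp add: carlitz_tail_Suc carlitz_factor_def algebra_simps)
  then have "tail_deriv (Suc N) n = fls_hyperderiv n (carlitz_tail N) - fls_hyperderiv n (theta * carlitz_tail N) * (wval N ^ 1 :: 'a fls)"
    unfolding tail_deriv_def by (simp only: hyperderiv_diff hyperderiv_mult_w_power[OF assms(2)])
  then show ?thesis by (cases n; simp add: hyperderiv_theta_mult tail_deriv_def carlitz_factor_def algebra_simps)
qed

end

section \<open>Transport of a relation between levels\<close>

text \<open>The recursion is multiplication by \<open>1 - (theta + X) wval N\<close> modulo \<open>X\<^sup>r\<close>.\<close>

definition tail_sequence :: "nat \<Rightarrow> nat \<Rightarrow> (nat \<Rightarrow> nat \<Rightarrow> 'a::{field,finite} fls) \<Rightarrow> bool" where
  "tail_sequence r M x \<longleftrightarrow> (\<forall>N\<ge>M. \<forall>n<r. x (Suc N) n = carlitz_factor N * x N n - (if n = 0 then 0 else wval N * x N (n - 1)))"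

text \<open>Carlitz's bracket [N]. \<open>carlitz_factor N\<close> is its image times
  \<open>wval N\<close>, so its powers are the denominators that arise in going back a
  level.\<close>

definition bracket :: "nat \<Rightarrow> 'a::{field,finite} poly" where
  "bracket N = monom 1 (CARD('a) ^ N) - [:0, 1:]"

lemma emb_monom: "emb (monom 1 k) = theta ^ k"
  by (simp add: monom_altdef emb.power emb_X)

lemma theta_power_w: "theta ^ (CARD('a) ^ N) * wval N = (1 :: 'a::{field,finite} fls)"
  by (simp add: wval_def flip: power_mult_distrib)

lemma emb_bracket: "emb (bracket N) = theta ^ (CARD('a) ^ N) * (carlitz_factor N :: 'a::{field,finite} fls)"
  using theta_power_w[of N, where 'a = 'a]
  by (simp add: bracket_def emb.diff emb_monom emb_X carlitz_factor_def right_diff_distrib mult.left_commute)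

lemma bracket_nz: "1 \<le> N \<Longrightarrow> bracket N \<noteq> (0 :: 'a::{field,finite} poly)"
proof -
  assume N: "1 \<le> N"
  have "carlitz_factor N \<noteq> (0 :: 'a fls)" using N by (rule carlitz_factor_unit)
  then have "emb (bracket N) \<noteq> (0 :: 'a fls)" by (simp add: emb_bracket)
  then show ?thesis by auto
qed

lemma degree_bracket: "degree (bracket N :: 'a::{field,finite} poly) \<le> CARD('a) ^ N"
proof -
  have "1 \<le> CARD('a) ^ N" by simp
  then show ?thesis unfolding bracket_def by (intro degree_diff_le) (auto simp: degree_monom_le)
qed

text \<open>The inverse of the series 1 - (theta + X) w has coefficient w^i / (1 - theta w)^(i + 1)
  at X^i. With 1 - theta w = [N] w and w = theta^(-q^N) this is theta^(q^N) / [N]^(i + 1).\<close>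

lemma tail_sequence_inverse:
  fixes x :: "nat \<Rightarrow> nat \<Rightarrow> 'a::{field,finite} fls"
  assumes x: "tail_sequence r M x" and N: "M \<le> N" and n: "n < r"
  shows "emb (bracket N) ^ Suc n * x N n
    = (\<Sum>i\<le>n. theta ^ (CARD('a) ^ N) * emb (bracket N) ^ (n - i) * x (Suc N) (n - i))"
  using n
proof (induction n)
  case 0
  then have "x (Suc N) 0 = carlitz_factor N * x N 0" using x N by (simp add: tail_sequence_def)
  then show ?case by (simp add: emb_bracket mult_ac)
next
  case (Suc n)
  define \<theta> where "\<theta> = (theta :: 'a fls) ^ (CARD('a) ^ N)"
  have "x (Suc N) (Suc n) = carlitz_factor N * x N (Suc n) - wval N * x N n"
    using x N Suc.prems by (simp add: tail_sequence_def)
  then have "\<theta> * x (Suc N) (Suc n) = \<theta> * (carlitz_factor N * x N (Suc n) - wval N * x N n)" by simp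
  also have "\<dots> = emb (bracket N) * x N (Suc n) - (\<theta> * wval N) * x N n"
    by (simp add: emb_bracket \<theta>_def right_diff_distrib mult.assoc)
  finally have "emb (bracket N) * x N (Suc n) = \<theta> * x (Suc N) (Suc n) + x N n"
    by (simp add: \<theta>_def theta_power_w)
  then have "emb (bracket N) ^ Suc (Suc n) * x N (Suc n)
      = \<theta> * emb (bracket N) ^ Suc n * x (Suc N) (Suc n) + emb (bracket N) ^ Suc n * x N n"
    by (metis (no_types, lifting) distrib_left mult.assoc mult.commute power_Suc2)
  also have "emb (bracket N) ^ Suc n * x N n = (\<Sum>i\<le>n. \<theta> * emb (bracket N) ^ (n - i) * x (Suc N) (n - i))"
    unfolding \<theta>_def using Suc by simp
  also have "\<theta> * emb (bracket N) ^ Suc n * x (Suc N) (Suc n) + \<dots>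
      = (\<Sum>i\<le>Suc n. \<theta> * emb (bracket N) ^ (Suc n - i) * x (Suc N) (Suc n - i))"
    unfolding sum.atMost_Suc_shift by simp
  finally show ?case by (simp only: \<theta>_def)
qed

lemma tail_sequence_inverse':
  fixes x :: "nat \<Rightarrow> nat \<Rightarrow> 'a::{field,finite} fls"
  assumes x: "tail_sequence r M x" and N: "M \<le> N" and n: "n < r"
  shows "emb (bracket N ^ r) * x N n = (\<Sum>j<r. emb (if j \<le> n then monom 1 (CARD('a) ^ N) * bracket N ^ (r - 1 - (n - j)) else 0) * x (Suc N) j)"
proof -
  have "r = (r - 1 - n) + Suc n" using n by simp
  then have "emb (bracket N ^ r) * x N n = emb (bracket N) ^ (r - 1 - n) * (emb (bracket N) ^ Suc n * x N n)"
    by (metis emb.power mult.assoc power_add)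
  also have "\<dots> = (\<Sum>i\<le>n. theta ^ (CARD('a) ^ N) * (emb (bracket N) ^ (r - 1 - n) * emb (bracket N) ^ (n - i)) * x (Suc N) (n - i))"
    unfolding tail_sequence_inverse[OF assms] by (simp add: sum_distrib_left mult_ac)
  also have "\<dots> = (\<Sum>i\<le>n. emb (monom 1 (CARD('a) ^ N) * bracket N ^ (r - 1 - i)) * x (Suc N) (n - i))"
  proof (intro sum.cong refl)
    fix i assume "i \<in> {..n}"
    then have "r - 1 - i = (r - 1 - n) + (n - i)" using n by simp
    then show "theta ^ (CARD('a) ^ N) * (emb (bracket N) ^ (r - 1 - n) * emb (bracket N) ^ (n - i)) * x (Suc N) (n - i)
      = emb (monom 1 (CARD('a) ^ N) * bracket N ^ (r - 1 - i)) * x (Suc N) (n - i)"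
      by (simp only: emb.mult emb.power emb_monom power_add)
  qed
  also have "\<dots> = (\<Sum>j\<le>n. emb (monom 1 (CARD('a) ^ N) * bracket N ^ (r - 1 - (n - j))) * x (Suc N) j)"
    by (rule sum.reindex_bij_witness[of _ "\<lambda>j. n - j" "\<lambda>i. n - i"]) auto
  also have "\<dots> = (\<Sum>j<r. emb (if j \<le> n then monom 1 (CARD('a) ^ N) * bracket N ^ (r - 1 - (n - j)) else 0) * x (Suc N) j)"
    using n by (intro sum.mono_neutral_cong_left) auto
  finally show ?thesis .
qed

text \<open>A step from \<open>N\<close> adds at most r q^N to the degrees; as q >= 2, the sum of
  all steps stays within r q^N at the new level. \<open>D\<close> and \<open>k\<close> do not depend
  on \<open>x\<close>: the identity holds for all solutions of the recursion together.\<close>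

lemma transfer_matrix:
  fixes Y :: "(nat \<Rightarrow> nat \<Rightarrow> 'a::{field,finite} fls) \<Rightarrow> nat \<Rightarrow> 'a fls"
  assumes M: "1 \<le> M" and D0: "D0 \<noteq> 0" "degree D0 \<le> K"
    and k0: "\<And>n j. degree (k0 n j) \<le> K"
    and base: "\<And>x n. n < r \<Longrightarrow> emb D0 * Y x n = (\<Sum>j<r. emb (k0 n j) * x M j)"
    and N: "M \<le> N"
  shows "\<exists>D k. D \<noteq> 0 \<and> degree D \<le> K + r * CARD('a) ^ N \<and> (\<forall>n j. degree (k n j) \<le> K + r * CARD('a) ^ N) \<and>
    (\<forall>x n. tail_sequence r M x \<longrightarrow> n < r \<longrightarrow> emb D * Y x n = (\<Sum>j<r. emb (k n j) * x N j))"
  using N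
proof (induction N rule: dec_induct)
  case base
  show ?case
    by (rule exI[of _ D0], rule exI[of _ k0]) (use D0 k0 assms(5) in \<open>auto intro: trans_le_add1\<close>)
next
  case (step N)
  define q where "q = CARD('a)"
  have q: "2 \<le> q" by (simp add: q_def card_field_ge_2)
  obtain D k where D: "D \<noteq> 0" "degree D \<le> K + r * q ^ N" and k: "\<And>n j. degree (k n j) \<le> K + r * q ^ N"
    and eq: "\<And>x n. tail_sequence r M x \<Longrightarrow> n < r \<Longrightarrow> emb D * Y x n = (\<Sum>j<r. emb (k n j) * x N j)"
    using step.IH unfolding q_def by blast
  define b :: "'a poly" where "b = bracket N"
  define e where "e j i = (if i \<le> j then monom 1 (q ^ N) * b ^ (r - 1 - (j - i)) else 0)" for j i
  have deg_pow: "degree (b ^ l) \<le> l * q ^ N" for l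
    using order_trans[OF degree_power_le mult_right_mono[OF degree_bracket[of N, where 'a = 'a]], of l]
    unfolding b_def q_def by (simp add: mult.commute)
  have bound: "K + r * q ^ N + r * q ^ N \<le> K + r * q ^ Suc N"
  proof -
    have "2 * (r * q ^ N) \<le> q * (r * q ^ N)" by (rule mult_right_mono[OF q]) simp
    then show ?thesis unfolding mult_2 by (simp only: power_Suc mult_ac add.assoc add_le_cancel_left)
  qed
  have deg_e: "degree (e j i) \<le> r * q ^ N" if "j < r" for j i
  proof (cases "i \<le> j")
    case True
    have "degree (e j i) \<le> q ^ N + (r - 1 - (j - i)) * q ^ N"
      using True order_trans[OF degree_mult_le add_mono[OF degree_monom_le deg_pow]] by (simp add: e_def)
    also have "\<dots> = Suc (r - 1 - (j - i)) * q ^ N" by simp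
    also have "\<dots> \<le> r * q ^ N" using that by (intro mult_right_mono) auto
    finally show ?thesis .
  qed (simp add: e_def)
  define k' where "k' n i = (\<Sum>j<r. k n j * e j i)" for n i
  have "D * b ^ r \<noteq> 0" using D bracket_nz[of N, where 'a = 'a] M step.hyps by (simp add: b_def)
  moreover have "degree (D * b ^ r) \<le> K + r * q ^ Suc N"
    using order_trans[OF order_trans[OF degree_mult_le add_mono[OF D(2) deg_pow[of r]]] bound] .
  moreover have "degree (k' n i) \<le> K + r * q ^ Suc N" for n i
    unfolding k'_def
  proof (intro degree_sum_le)
    fix j assume "j \<in> {..<r}"
    then show "degree (k n j * e j i) \<le> K + r * q ^ Suc N"
      using order_trans[OF order_trans[OF degree_mult_le add_mono[OF k deg_e]] bound] by simp
  qed simp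
  moreover have "emb (D * b ^ r) * Y x n = (\<Sum>i<r. emb (k' n i) * x (Suc N) i)" if x: "tail_sequence r M x" and n: "n < r" for x n
  proof -
    have "emb (D * b ^ r) * Y x n = emb (b ^ r) * (emb D * Y x n)" by (simp add: emb.mult mult_ac)
    also have "\<dots> = (\<Sum>j<r. emb (k n j) * (emb (b ^ r) * x N j))"
      unfolding eq[OF x n] by (simp add: sum_distrib_left mult_ac)
    also have "\<dots> = (\<Sum>j<r. emb (k n j) * (\<Sum>i<r. emb (e j i) * x (Suc N) i))"
      unfolding b_def e_def q_def using tail_sequence_inverse'[OF x] step.hyps by (intro sum.cong) auto
    also have "\<dots> = (\<Sum>j<r. \<Sum>i<r. emb (k n j * e j i) * x (Suc N) i)"
      by (simp add: sum_distrib_left emb.mult mult.assoc)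
    also have "\<dots> = (\<Sum>i<r. \<Sum>j<r. emb (k n j * e j i) * x (Suc N) i)"
      by (rule sum.swap)
    also have "\<dots> = (\<Sum>i<r. emb (k' n i) * x (Suc N) i)"
      by (simp add: k'_def emb.sum sum_distrib_right)
    finally show ?thesis .
  qed
  ultimately show ?case unfolding q_def by blast
qed

lemma infinite_fls: "infinite (UNIV :: 'a::field fls set)"
proof -
  have "inj (\<lambda>n :: nat. fls_X ^ n :: 'a fls)"
  proof (rule injI)
    fix m n assume "(fls_X ^ m :: 'a fls) = fls_X ^ n"
    then have "fls_subdegree (fls_X ^ m :: 'a fls) = fls_subdegree (fls_X ^ n :: 'a fls)" by simp
    then show "m = n" by simp
  qed
  then have "infinite (range (\<lambda>n :: nat. fls_X ^ n :: 'a fls))" by (rule range_inj_infinite)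
  then show ?thesis by (rule infinite_super[OF subset_UNIV])
qed

text \<open>With a free initial vector, an identity for all sequences becomes an identity at all
  points.\<close>

lemma tail_sequence_extension:
  fixes v :: "nat \<Rightarrow> 'a::{field,finite} fls"
  shows "\<exists>x. tail_sequence r M x \<and> x M = v"
proof -
  define s where "s = rec_nat v (\<lambda>k y n. carlitz_factor (M + k) * y n - (if n = 0 then 0 else wval (M + k) * y (n - 1)))"
  have "tail_sequence r M (\<lambda>N. s (N - M))"
    unfolding tail_sequence_def
  proof (intro allI impI)
    fix N n assume "M \<le> N"
    then have "Suc N - M = Suc (N - M)" "M + (N - M) = N" by auto
    then show "s (Suc N - M) n = carlitz_factor N * s (N - M) n - (if n = 0 then 0 else wval N * s (N - M) (n - 1))"
      by (simp add: s_def)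
  qed
  then show ?thesis by (intro exI[of _ "\<lambda>N. s (N - M)"]) (simp add: s_def)
qed

context leibniz
begin

text \<open>The relation is transported to each level \<open>N\<close>, where Mahler's method forces
  its coefficients \<open>\<rho> N\<close> to vanish for large \<open>N\<close>. For one such
  \<open>N\<close> the transport identity, read for an arbitrary sequence, says that the original
  polynomial vanishes at every vector, hence is 0.\<close>

theorem tail_deriv_independent:
  fixes c :: "(nat \<Rightarrow> nat) \<Rightarrow> 'a poly" and u :: "nat \<Rightarrow> 'a fls"
  assumes r: "0 < r" and M: "1 \<le> M" "r \<le> CARD('a) ^ M"
    and A: "finite A" "A \<subseteq> exponents r d"
    and D0: "D0 \<noteq> 0" and u: "\<And>n. n < r \<Longrightarrow> emb D0 * u n = emb (uu n)" and u0: "u 0 \<noteq> 0"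
    and rel: "(\<Sum>a\<in>A. emb (c a) * monomial_val r (\<lambda>n. \<Sum>i\<le>n. u (n - i) * tail_deriv M i) a) = 0"
    and a: "a \<in> A"
  shows "c a = 0"
proof -
  define q where "q = CARD('a)"
  have q: "2 \<le> q" by (simp add: q_def card_field_ge_2)
  define Y where "Y x n = (\<Sum>i\<le>n. u (n - i) * x M i)" for x :: "nat \<Rightarrow> nat \<Rightarrow> 'a fls" and n
  define K where "K = degree D0 + (\<Sum>n<r. degree (uu n))"
  have deg_D0: "degree D0 \<le> K" unfolding K_def by (rule le_add1)
  define k0 where "k0 n j = (if j \<le> n \<and> n < r then uu (n - j) else 0)" for n j
  have deg_k0: "degree (k0 n j) \<le> K" for n j
  proof (cases "j \<le> n \<and> n < r")
    case True
    then have "degree (uu (n - j)) \<le> (\<Sum>n<r. degree (uu n))"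
      by (intro member_le_sum[of "n - j" "{..<r}" "\<lambda>n. degree (uu n)"]) auto
    with True show ?thesis by (simp add: k0_def K_def)
  next
    case False
    then have "k0 n j = 0" unfolding k0_def by (rule if_not_P)
    then show ?thesis by simp
  qed
  have base: "emb D0 * Y x n = (\<Sum>j<r. emb (k0 n j) * x M j)" if "n < r" for x n
  proof -
    have "emb D0 * Y x n = (\<Sum>i\<le>n. (emb D0 * u (n - i)) * x M i)"
      by (simp add: Y_def sum_distrib_left mult.assoc)
    also have "\<dots> = (\<Sum>i\<le>n. emb (k0 n i) * x M i)"
      using that by (intro sum.cong) (auto simp: u k0_def)
    also have "\<dots> = (\<Sum>j<r. emb (k0 n j) * x M j)"
      using that by (intro sum.mono_neutral_left) (auto simp: k0_def)
    finally show ?thesis .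
  qed
  \<comment> \<open>The power \<open>emb D ^ d\<close> clears the denominators of all monomials of
    degree at most d. The quantifier over \<open>x\<close> comes after \<open>D\<close> and
    \<open>\<rho>\<close>, so one transported relation serves all sequences.\<close>
  define rel_at where "rel_at N \<rho> \<longleftrightarrow> (\<exists>D. D \<noteq> 0 \<and> (\<forall>x. tail_sequence r M x \<longrightarrow>
    emb D ^ d * (\<Sum>a\<in>A. emb (c a) * monomial_val r (Y x) a) = (\<Sum>b\<in>exponents r d. emb (\<rho> b) * monomial_val r (x N) b)))"
    for N and \<rho> :: "(nat \<Rightarrow> nat) \<Rightarrow> 'a poly"
  define dc where "dc = (\<Sum>a\<in>A. degree (c a))"
  define C0 where "C0 = dc + d * (K + r)"
  have "\<forall>N\<in>{M..}. \<exists>\<rho>. rel_at N \<rho> \<and> (\<forall>b. degree (\<rho> b) \<le> C0 * q ^ N)"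
  proof
    fix N assume "N \<in> {M..}"
    then have N: "M \<le> N" by simp
    define KN where "KN = K + r * q ^ N"
    have "\<exists>D k. D \<noteq> 0 \<and> degree D \<le> KN \<and> (\<forall>n j. degree (k n j) \<le> KN) \<and>
      (\<forall>x n. tail_sequence r M x \<longrightarrow> n < r \<longrightarrow> emb D * Y x n = (\<Sum>j<r. emb (k n j) * x N j))"
      unfolding KN_def q_def
      by (rule transfer_matrix[where ?k0.0 = k0 and Y = Y and M = M])
        (use M D0 deg_D0 deg_k0 base N in simp_all)
    then obtain D k where Dk: "D \<noteq> 0 \<and> degree D \<le> KN \<and> (\<forall>n j. degree (k n j) \<le> KN) \<and>
      (\<forall>x n. tail_sequence r M x \<longrightarrow> n < r \<longrightarrow> emb D * Y x n = (\<Sum>j<r. emb (k n j) * x N j))" by (elim exE)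
    have D: "D \<noteq> 0" "degree D \<le> KN" and k: "\<And>n j. degree (k n j) \<le> KN"
      and eq: "\<And>x n. tail_sequence r M x \<Longrightarrow> n < r \<Longrightarrow> emb D * Y x n = (\<Sum>j<r. emb (k n j) * x N j)"
      using Dk by simp_all
    \<comment> \<open>Each linear form in \<open>x N\<close> costs degree \<open>KN\<close> in its
      coefficients, so degree m in the forms costs m * KN.\<close>
    define C where "C m = emb ` {a :: 'a poly. degree a \<le> m * KN}" for m
    interpret filtration C
    proof
      show "0 \<in> C m" for m unfolding C_def by (rule image_eqI[of _ _ 0]) auto
      show "1 \<in> C 0" unfolding C_def by (rule image_eqI[of _ _ 1]) auto
      show "x + y \<in> C m" if "x \<in> C m" "y \<in> C m" for x y m
        using that unfolding C_def by (auto simp: degree_add_le simp flip: emb.add)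
      show "x * y \<in> C (m + n)" if xy: "x \<in> C m" "y \<in> C n" for x y m n
      proof -
        obtain a b where ab: "x = emb a" "degree a \<le> m * KN" "y = emb b" "degree b \<le> n * KN"
          using xy unfolding C_def by auto
        have "degree (a * b) \<le> (m + n) * KN"
          unfolding distrib_right by (rule order_trans[OF degree_mult_le add_mono[OF ab(2,4)]])
        then show ?thesis unfolding C_def
          by (intro image_eqI[of _ _ "a * b"]) (auto simp: emb.mult ab)
      qed
    qed
    define F where "F n x = (\<Sum>j<r. emb (k n j) * x N j)" for n and x :: "nat \<Rightarrow> nat \<Rightarrow> 'a fls"
    have F: "F n \<in> polyfun r (\<lambda>x. x N) C 1" for n
      unfolding F_def using k by (intro polyfun_linear) (auto simp: C_def)
    have "\<forall>a\<in>A. \<exists>g. (\<forall>b. degree (g b) \<le> d * KN) \<and>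
        (\<forall>x. emb D ^ (d - (\<Sum>i<r. a i)) * (\<Prod>n<r. F n x ^ a n) = (\<Sum>b\<in>exponents r d. emb (g b) * monomial_val r (x N) b))"
    proof
      fix a assume "a \<in> A"
      define s where "s = (\<Sum>i<r. a i)"
      have s: "s \<le> d" using \<open>a \<in> A\<close> A by (auto simp: s_def exponents_def)
      \<comment> \<open>A monomial of degree s < d needs d - s further factors \<open>D\<close>;
        each of them also costs at most \<open>KN\<close>.\<close>
      have "degree (D ^ (d - s)) \<le> (d - s) * KN"
        by (subst mult.commute) (rule order_trans[OF degree_power_le mult_right_mono[OF D(2)]], simp)
      then have "(\<lambda>x. emb D ^ (d - s) * monomial_val r (x N) (\<lambda>_. 0)) \<in> polyfun r (\<lambda>x. x N) C (d - s)"
        by (intro polyfun_mon) (auto simp: exponents_def C_def simp flip: emb.power)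
      then have "(\<lambda>x. emb D ^ (d - s) * monomial_val r (x N) (\<lambda>_. 0) * (\<Prod>n<r. F n x ^ a n))
          \<in> polyfun r (\<lambda>x. x N) C ((d - s) + s)"
        unfolding s_def by (intro polyfun_mult polyfun_prod_power F) auto
      then obtain g where g: "\<And>b. g b \<in> C d"
        "\<And>x. emb D ^ (d - s) * (\<Prod>n<r. F n x ^ a n) = (\<Sum>b\<in>exponents r d. g b * monomial_val r (x N) b)"
        using s by (auto simp: polyfun_def monomial_val_def)
      have "\<forall>b. \<exists>p. g b = emb p \<and> degree p \<le> d * KN" using g(1) unfolding C_def by blast
      then obtain p where "\<And>b. g b = emb (p b)" "\<And>b. degree (p b) \<le> d * KN" by metis
      with g(2) show "\<exists>g. (\<forall>b. degree (g b) \<le> d * KN) \<and>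
          (\<forall>x. emb D ^ (d - (\<Sum>i<r. a i)) * (\<Prod>n<r. F n x ^ a n) = (\<Sum>b\<in>exponents r d. emb (g b) * monomial_val r (x N) b))"
        unfolding s_def by (intro exI[of _ p]) simp
    qed
    from bchoice[OF this] obtain g where g: "\<forall>a\<in>A. (\<forall>b. degree (g a b) \<le> d * KN) \<and>
        (\<forall>x. emb D ^ (d - (\<Sum>i<r. a i)) * (\<Prod>n<r. F n x ^ a n) = (\<Sum>b\<in>exponents r d. emb (g a b) * monomial_val r (x N) b))"
      by (elim exE)
    have g_deg: "degree (g a b) \<le> d * KN" if "a \<in> A" for a b using g that by simp
    have g_eq: "emb D ^ (d - (\<Sum>i<r. a i)) * (\<Prod>n<r. F n x ^ a n) = (\<Sum>b\<in>exponents r d. emb (g a b) * monomial_val r (x N) b)"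
      if "a \<in> A" for a x using bspec[OF g that] by simp
    define \<rho> where "\<rho> b = (\<Sum>a\<in>A. c a * g a b)" for b
    have "emb D ^ d * (\<Sum>a\<in>A. emb (c a) * monomial_val r (Y x) a) = (\<Sum>b\<in>exponents r d. emb (\<rho> b) * monomial_val r (x N) b)"
      if x: "tail_sequence r M x" for x
    proof -
      have "emb D ^ d * monomial_val r (Y x) a = (\<Sum>b\<in>exponents r d. emb (g a b) * monomial_val r (x N) b)" if "a \<in> A" for a
      proof -
        have s: "(\<Sum>i<r. a i) \<le> d" using that A by (auto simp: exponents_def)
        have "(\<Prod>n<r. F n x ^ a n) = (\<Prod>n<r. (emb D * Y x n) ^ a n)"
          using eq[OF x] by (intro prod.cong) (auto simp: F_def)
        also have "\<dots> = emb D ^ (\<Sum>i<r. a i) * monomial_val r (Y x) a"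
          by (simp add: power_mult_distrib prod.distrib monomial_val_def power_sum)
        finally show ?thesis using g_eq[OF that, of x] s by (simp add: mult.assoc[symmetric] flip: power_add)
      qed
      then have "(\<Sum>a\<in>A. emb (c a) * (emb D ^ d * monomial_val r (Y x) a)) = (\<Sum>a\<in>A. \<Sum>b\<in>exponents r d. emb (c a * g a b) * monomial_val r (x N) b)"
        by (intro sum.cong) (auto simp: sum_distrib_left emb.mult mult.assoc)
      also have "\<dots> = (\<Sum>b\<in>exponents r d. \<Sum>a\<in>A. emb (c a * g a b) * monomial_val r (x N) b)" by (rule sum.swap)
      also have "\<dots> = (\<Sum>b\<in>exponents r d. emb (\<rho> b) * monomial_val r (x N) b)"
        by (simp add: \<rho>_def emb.sum sum_distrib_right)
      finally show ?thesis by (simp add: sum_distrib_left mult.left_commute)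
    qed
    with D(1) have "rel_at N \<rho>" unfolding rel_at_def by blast
    moreover have "degree (\<rho> b) \<le> C0 * q ^ N" for b
      unfolding \<rho>_def
    proof (intro degree_sum_le A)
      fix a assume a: "a \<in> A"
      have "degree (c a) \<le> dc" unfolding dc_def using A(1) a by (intro member_le_sum) auto
      then have "degree (c a * g a b) \<le> dc + d * KN"
        using order_trans[OF degree_mult_le add_mono[OF _ g_deg[OF a]]] by simp
      also have "\<dots> \<le> C0 * q ^ N"
      proof -
        have one: "1 \<le> q ^ N" using q by simp
        have "dc + d * K \<le> (dc + d * K) * q ^ N" using mult_left_mono[OF one, of "dc + d * K"] by simp
        then show ?thesis by (simp add: C0_def KN_def algebra_simps)
      qed
      finally show "degree (c a * g a b) \<le> C0 * q ^ N" .
    qed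
    ultimately show "\<exists>\<rho>. rel_at N \<rho> \<and> (\<forall>b. degree (\<rho> b) \<le> C0 * q ^ N)" by (intro exI[of _ \<rho>]) simp
  qed
  from bchoice[OF this] obtain \<rho> where "\<forall>N\<in>{M..}. rel_at N (\<rho> N) \<and> (\<forall>b. degree (\<rho> N b) \<le> C0 * q ^ N)"
    by (elim exE)
  then have \<rho>: "\<And>N. M \<le> N \<Longrightarrow> rel_at N (\<rho> N)" "\<And>N b. M \<le> N \<Longrightarrow> degree (\<rho> N b) \<le> C0 * q ^ N"
    by simp_all
  have valid_tail_deriv: "tail_sequence r M (tail_deriv :: nat \<Rightarrow> nat \<Rightarrow> 'a fls)"
    unfolding tail_sequence_def
  proof (intro allI impI)
    fix N n assume N: "M \<le> N" "n < r"
    have "CARD('a) ^ M \<le> CARD('a) ^ N" using N by (intro power_increasing) auto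
    with N M show "tail_deriv (Suc N) n = carlitz_factor N * tail_deriv N n - (if n = 0 then 0 else wval N * tail_deriv N (n - 1) :: 'a fls)"
      by (intro tail_deriv_Suc) auto
  qed
  have "\<exists>N0. \<forall>N\<ge>N0. \<forall>b\<in>exponents r d. \<rho> N b = 0"
  proof (rule mahler_relation_vanishes[of _ "\<lambda>b N. monomial_val r (tail_deriv N) b" "monomial_val r (phi_fps CARD('a) [:0, 1:])"])
    show "finite (exponents r d)" by (rule finite_exponents)
    show "expansion (\<lambda>N. monomial_val r (tail_deriv N) b :: 'a fls) (monomial_val r (phi_fps CARD('a) [:0, 1:]) b)" for b
      by (intro expansion_mon expansion_tail_deriv)
    show "\<forall>b\<in>exponents r d. R b = 0" if "(\<Sum>b\<in>exponents r d. fps_of_poly (R b) * monomial_val r (phi_fps CARD('a) [:0, 1:]) b) = 0"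
      for R :: "(nat \<Rightarrow> nat) \<Rightarrow> 'a poly poly"
      using functional_independence[OF r that] by blast
    show "degree (\<rho> N b) \<le> C0 * CARD('a) ^ N" if "M \<le> N" for N b
      using \<rho>(2)[OF that] by (simp add: q_def)
    show "(\<Sum>b\<in>exponents r d. emb (\<rho> N b) * monomial_val r (tail_deriv N) b :: 'a fls) = 0" if N: "M \<le> N" for N
    proof -
      have "(\<Sum>a\<in>A. emb (c a) * monomial_val r (Y tail_deriv) a) = 0" using rel unfolding Y_def .
      with \<rho>(1)[OF N] valid_tail_deriv show ?thesis unfolding rel_at_def by fastforce
    qed
  qed
  then obtain N0 where N0: "\<And>N b. N0 \<le> N \<Longrightarrow> b \<in> exponents r d \<Longrightarrow> \<rho> N b = 0" by blast
  define N where "N = max M N0"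
  obtain D where D: "D \<noteq> 0" "\<And>x. tail_sequence r M x \<Longrightarrow>
    emb D ^ d * (\<Sum>a\<in>A. emb (c a) * monomial_val r (Y x) a) = (\<Sum>b\<in>exponents r d. emb (\<rho> N b) * monomial_val r (x N) b)"
    using \<rho>(1)[of N] unfolding rel_at_def N_def by auto
  have "(\<Sum>a\<in>A. emb (c a) * monomial_val r y a) = 0" for y
  proof -
    \<comment> \<open>\<open>Y\<close> is multiplication by this series, which is invertible since
      \<open>u 0\<close> is nonzero. Hence every \<open>y\<close> is attained by a suitable initial
      vector.\<close>
    define U where "U = Abs_fps u"
    have U: "inverse U * U = 1" using u0 by (intro inverse_mult_eq_1) (simp add: U_def)
    obtain x where x: "tail_sequence r M x" "x M = fps_nth (Abs_fps y * inverse U)"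
      using tail_sequence_extension by blast
    have "Y x n = y n" for n
    proof -
      have "Y x n = fps_nth (Abs_fps y * inverse U * U) n"
        unfolding Y_def x(2) fps_mult_nth[of _ U] by (intro sum.cong) (auto simp: U_def atLeast0AtMost)
      then show ?thesis by (simp add: mult.assoc U)
    qed
    then have "monomial_val r y a = monomial_val r (Y x) a" for a by (simp add: monomial_val_def)
    then show ?thesis using D x(1) N0[of N] by (simp add: N_def)
  qed
  from coeffs_zero_if_vanishing[OF infinite_fls A this a] show ?thesis by simp
qed

end

section \<open>The Carlitz period\<close>

lemma rational_functions_altdef:
  "rational_functions = {emb a / emb b | a b. b \<noteq> (0 :: 'a::field poly)}"
  by (simp add: rational_functions_def emb_def)

lemma Rat_emb: "emb a \<in> rational_functions"
  unfolding rational_functions_altdef by (intro CollectI exI[of _ a] exI[of _ 1]) simp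

lemma Rat_0: "0 \<in> rational_functions" and Rat_1: "1 \<in> rational_functions"
  using Rat_emb[of 0] Rat_emb[of 1] by simp_all

lemma RatE:
  assumes "x \<in> rational_functions"
  obtains a b where "b \<noteq> 0" "x = emb a / emb b"
  using assms unfolding rational_functions_altdef by blast

lemma Rat_add: "x \<in> rational_functions \<Longrightarrow> y \<in> rational_functions \<Longrightarrow> x + y \<in> rational_functions"
proof (elim RatE)
  fix a b c d :: "'a poly" assume "b \<noteq> 0" "x = emb a / emb b" "d \<noteq> 0" "y = emb c / emb d"
  then show ?thesis unfolding rational_functions_altdef
    by (intro CollectI exI[of _ "a * d + c * b"] exI[of _ "b * d"]) (simp add: emb.add emb.mult add_frac_eq)
qed

lemma Rat_mult: "x \<in> rational_functions \<Longrightarrow> y \<in> rational_functions \<Longrightarrow> x * y \<in> rational_functions"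
proof (elim RatE)
  fix a b c d :: "'a poly" assume "b \<noteq> 0" "x = emb a / emb b" "d \<noteq> 0" "y = emb c / emb d"
  then show ?thesis unfolding rational_functions_altdef
    by (intro CollectI exI[of _ "a * c"] exI[of _ "b * d"]) (simp add: emb.mult)
qed

lemma Rat_uminus: "x \<in> rational_functions \<Longrightarrow> - x \<in> rational_functions"
  using Rat_mult[OF Rat_emb[of "- 1"], of x] by (simp add: emb.uminus)

lemma Rat_diff: "x \<in> rational_functions \<Longrightarrow> y \<in> rational_functions \<Longrightarrow> x - y \<in> rational_functions"
  using Rat_add[OF _ Rat_uminus, of x y] by simp

lemma Rat_inverse: "x \<in> rational_functions \<Longrightarrow> inverse x \<in> rational_functions"
proof (elim RatE)
  fix a b :: "'a poly" assume "b \<noteq> 0" "x = emb a / emb b"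
  then show ?thesis
  proof (cases "a = 0")
    case False
    with \<open>x = _\<close> show ?thesis unfolding rational_functions_altdef
      by (intro CollectI exI[of _ b] exI[of _ a]) simp
  qed (simp add: Rat_0)
qed

lemma Rat_sum: "(\<And>i. i \<in> I \<Longrightarrow> x i \<in> rational_functions) \<Longrightarrow> (\<Sum>i\<in>I. x i) \<in> rational_functions"
  by (induction I rule: infinite_finite_induct) (auto intro: Rat_0 Rat_add)

lemma Rat_power: "x \<in> rational_functions \<Longrightarrow> x ^ n \<in> rational_functions"
  by (induction n) (auto intro: Rat_1 Rat_mult)

lemma common_denominator:
  assumes "finite I" "\<And>i. i \<in> I \<Longrightarrow> x i \<in> rational_functions"
  shows "\<exists>D. D \<noteq> 0 \<and> (\<forall>i\<in>I. \<exists>a. emb D * x i = emb a)"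
  using assms
proof (induction I rule: finite_induct)
  case empty
  then show ?case by (intro exI[of _ 1]) auto
next
  case (insert j I)
  have "\<exists>D. D \<noteq> 0 \<and> (\<forall>i\<in>I. \<exists>a. emb D * x i = emb a)"
    by (rule insert.IH) (use insert.prems in simp)
  then obtain D where D: "D \<noteq> 0" "\<forall>i\<in>I. \<exists>a. emb D * x i = emb a" by (elim exE conjE)
  have "x j \<in> rational_functions" using insert.prems by simp
  then obtain a b where ab: "b \<noteq> 0" "x j = emb a / emb b" by (rule RatE)
  have "\<exists>a. emb (D * b) * x i = emb a" if i: "i \<in> I" for i
  proof -
    from bspec[OF D(2) i] obtain a where "emb D * x i = emb a" by (elim exE)
    then have "emb (D * b) * x i = emb (b * a)" by (simp add: emb.mult mult_ac)
    then show ?thesis by blast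
  qed
  moreover have "emb (D * b) * x j = emb (D * a)" using ab by (simp add: emb.mult)
  ultimately show ?case using D ab by (intro exI[of _ "D * b"]) auto
qed

text \<open>Collects the Taylor expansions of the part of the period split off from the tail;
  closure under products and inverses replaces explicit formulas for its hyperderivatives.\<close>

definition RatF :: "'a::field fls fps set" where
  "RatF = {F. \<forall>n. fps_nth F n \<in> rational_functions}"

lemma RatF_mult: "F \<in> RatF \<Longrightarrow> G \<in> RatF \<Longrightarrow> F * G \<in> RatF"
  by (auto simp: RatF_def fps_mult_nth intro: Rat_sum Rat_mult)

lemma RatF_1: "1 \<in> RatF"
  by (auto simp: RatF_def Rat_0 Rat_1)

lemma RatF_prod: "(\<And>i. i \<in> I \<Longrightarrow> F i \<in> RatF) \<Longrightarrow> (\<Prod>i\<in>I. F i) \<in> RatF"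
  by (induction I rule: infinite_finite_induct) (auto intro: RatF_1 RatF_mult)

lemma RatF_power: "F \<in> RatF \<Longrightarrow> F ^ n \<in> RatF"
  by (induction n) (auto intro: RatF_1 RatF_mult)

lemma RatF_diff: "F \<in> RatF \<Longrightarrow> G \<in> RatF \<Longrightarrow> F - G \<in> RatF"
  by (auto simp: RatF_def Rat_diff)

lemma RatF_cancel:
  assumes F: "F \<in> RatF" and FG: "F * G = 1"
  shows "G \<in> RatF"
proof -
  have F0: "fps_nth F 0 \<noteq> 0" using arg_cong[OF FG, of "\<lambda>H. fps_nth H 0"] by auto
  have "fps_nth G n \<in> rational_functions" for n
  proof (induction n rule: less_induct)
    case (less n)
    have "(\<Sum>i=0..n. fps_nth F i * fps_nth G (n - i)) = fps_nth 1 n"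
      using arg_cong[OF FG, of "\<lambda>H. fps_nth H n"] by (simp add: fps_mult_nth)
    moreover have "(\<Sum>i=0..n. fps_nth F i * fps_nth G (n - i))
        = fps_nth F 0 * fps_nth G n + (\<Sum>i=1..n. fps_nth F i * fps_nth G (n - i))"
      by (subst sum.atLeast_Suc_atMost) auto
    ultimately have "fps_nth G n = (fps_nth 1 n - (\<Sum>i=1..n. fps_nth F i * fps_nth G (n - i))) * inverse (fps_nth F 0)"
      using F0 by (simp add: field_simps)
    also have "\<dots> \<in> rational_functions"
      using less F Rat_0 Rat_1 unfolding RatF_def
      by (intro Rat_mult Rat_diff Rat_sum Rat_inverse) auto
    finally show ?case .
  qed
  then show ?thesis by (simp add: RatF_def)
qed

context leibniz
begin

lemma RatF_taylor_theta: "taylor (theta :: 'a fls) \<in> RatF"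
  using Rat_emb[of "[:0, 1:] :: 'a poly"] Rat_0 Rat_1
  by (auto simp: RatF_def taylor_def fls_hyperderiv_theta emb_X)

lemma RatF_taylor_w: "taylor (wval N :: 'a fls) \<in> RatF"
proof -
  have "taylor theta * taylor fls_X = (1 :: 'a fls fps)" by (simp flip: taylor_mult)
  with RatF_taylor_theta have "taylor (fls_X :: 'a fls) \<in> RatF" by (rule RatF_cancel)
  then show ?thesis by (simp add: wval_def taylor.power RatF_power)
qed

lemma RatF_taylor_inverse_partial: "taylor (inverse (carlitz_partial M) :: 'a fls) \<in> RatF"
proof (rule RatF_cancel)
  show "taylor (carlitz_partial M :: 'a fls) \<in> RatF"
    unfolding carlitz_partial_def taylor.prod carlitz_factor_def
    by (intro RatF_prod) (simp add: taylor.diff taylor_mult RatF_diff RatF_1 RatF_mult RatF_taylor_theta RatF_taylor_w)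
  show "taylor (carlitz_partial M) * taylor (inverse (carlitz_partial M)) = (1 :: 'a fls fps)"
    using carlitz_partial_unit(1)[of M, where 'a = 'a] by (simp flip: taylor_mult)
qed

end

text \<open>Kummer theory for \<open>x\<^sup>q\<^sup>-\<^sup>1 = -theta\<close>: taking \<open>q\<close>-th powers preserves the shape of a linear relation,
  so a relation of minimal length can be shortened.\<close>

lemma root_powers_independent:
  fixes lam :: "'a::{field,finite} fls alg_closure"
  assumes lam: "lam ^ (CARD('a) - 1) = - to_ac theta"
    and rel: "(\<Sum>s<CARD('a) - 1. lam ^ s * to_ac (g s)) = 0" and s: "s < CARD('a) - 1"
  shows "g s = 0"
  using rel s
proof (induction "card {s \<in> {..<CARD('a) - 1}. g s \<noteq> 0}" arbitrary: g s rule: less_induct)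
  case less
  define q where "q = CARD('a)"
  have q: "2 \<le> q" by (simp add: q_def card_field_ge_2)
  have frob: "frobenius_exponent CHAR('a fls alg_closure) q"
    using finite_field_frobenius_exponent[where 'a = 'a] by (simp add: q_def)
  have lam_q: "lam ^ (k * q) = lam ^ k * to_ac ((- theta) ^ k)" for k
  proof -
    have "k * q = k + (q - 1) * k" using q by (cases q) (auto simp: algebra_simps)
    then have "lam ^ (k * q) = lam ^ k * (lam ^ (q - 1)) ^ k" by (simp only: power_add power_mult)
    also have "lam ^ (q - 1) = to_ac (- theta)" using lam by (simp add: q_def)
    finally show ?thesis by simp
  qed
  have lam_nz: "lam \<noteq> 0"
  proof
    assume "lam = 0"
    then have "to_ac theta = (0 :: 'a fls alg_closure)" using lam q by (simp add: q_def power_0_left)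
    then show False by simp
  qed
  show ?case
  proof (rule ccontr)
    assume gs: "g s \<noteq> 0"
    \<comment> \<open>Taking q-th powers multiplies the coefficient at \<open>s\<close> by
      \<open>e\<close>. Subtracting \<open>e\<close> times the old relation from the new one deletes
      this term and creates no other.\<close>
    define e where "e = g s ^ (q - 1) * (- theta) ^ s"
    define g' where "g' k = g k ^ q * (- theta) ^ k - e * g k" for k
    have "(\<Sum>k<q - 1. lam ^ k * to_ac (g k ^ q * (- theta) ^ k)) = (\<Sum>k<q - 1. lam ^ k * to_ac (g k)) ^ (q ^ 1)"
      unfolding power_sum_frobenius[OF frob]
      by (intro sum.cong refl) (simp add: power_mult_distrib lam_q mult_ac flip: power_mult)
    also have "\<dots> = 0" using less.prems(1) q by (simp add: q_def power_0_left)
    finally have 1: "(\<Sum>k<q - 1. lam ^ k * to_ac (g k ^ q * (- theta) ^ k)) = 0" .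
    have "(\<Sum>k<q - 1. lam ^ k * to_ac (g' k)) = (\<Sum>k<q - 1. lam ^ k * to_ac (g k ^ q * (- theta) ^ k))
        - to_ac e * (\<Sum>k<q - 1. lam ^ k * to_ac (g k))"
      unfolding sum_distrib_left sum_subtractf[symmetric]
      by (intro sum.cong refl) (simp add: g'_def right_diff_distrib mult_ac)
    then have rel': "(\<Sum>k<q - 1. lam ^ k * to_ac (g' k)) = 0" using 1 less.prems(1) by (simp add: q_def)
    have "g s ^ q = g s ^ (q - 1) * g s" using q by (metis Suc_diff_1 power_Suc2 zero_less_numeral order_less_le_trans)
    then have g's: "g' s = 0" by (simp add: g'_def e_def mult_ac)
    have "{k \<in> {..<q - 1}. g' k \<noteq> 0} \<subset> {k \<in> {..<q - 1}. g k \<noteq> 0}"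
    proof
      show "{k \<in> {..<q - 1}. g' k \<noteq> 0} \<subseteq> {k \<in> {..<q - 1}. g k \<noteq> 0}"
        using q by (auto simp: g'_def power_0_left)
      show "{k \<in> {..<q - 1}. g' k \<noteq> 0} \<noteq> {k \<in> {..<q - 1}. g k \<noteq> 0}"
        using g's gs less.prems(2) by (auto simp: q_def)
    qed
    then have "card {k \<in> {..<q - 1}. g' k \<noteq> 0} < card {k \<in> {..<q - 1}. g k \<noteq> 0}"
      by (intro psubset_card_mono) auto
    then have g': "g' k = 0" if "k < q - 1" for k
      using less.hyps[of g' k] rel' that by (simp add: q_def)
    have "g k = 0" if k: "k < q - 1" "k \<noteq> s" for k
    proof (rule ccontr)
      assume gk: "g k \<noteq> 0"
      have "g k ^ q = g k ^ (q - 1) * g k" using q by (metis Suc_diff_1 power_Suc2 zero_less_numeral order_less_le_trans)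
      then have "g k ^ (q - 1) * (- theta) ^ k = e" using g'[OF k(1)] gk by (simp add: g'_def)
      \<comment> \<open>Since \<open>theta\<close> has order -1, comparing orders gives k = s modulo
        q - 1, impossible for distinct exponents below q - 1.\<close>
      then have "fls_subdegree (g k ^ (q - 1) * (- theta) ^ k) = fls_subdegree (g s ^ (q - 1) * (- theta) ^ s)"
        by (simp add: e_def)
      then have "int (q - 1) * fls_subdegree (g k) - int k = int (q - 1) * fls_subdegree (g s) - int s"
        using gk gs by (simp add: fls_subdegree_pow theta_def)
      then have "int k - int s = int (q - 1) * (fls_subdegree (g k) - fls_subdegree (g s))"
        by (simp add: algebra_simps)
      then have "int (q - 1) dvd int k - int s" by simp
      then have "int k mod int (q - 1) = int s mod int (q - 1)" by (simp add: mod_eq_dvd_iff)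
      then show False using k less.prems(2) by (simp add: q_def)
    qed
    then have "(\<Sum>k<q - 1. lam ^ k * to_ac (g k)) = (\<Sum>k<q - 1. if k = s then lam ^ k * to_ac (g k) else 0)"
      by (intro sum.cong) auto
    with less.prems lam_nz gs show False by (simp add: q_def)
  qed
qed

lemma is_subfield_field_adjoin: "is_subfield (field_adjoin F x)"
  unfolding field_adjoin_def by (rule hull_in) (auto simp: is_subfield_def)

lemma field_adjoin_superset: "insert x F \<subseteq> field_adjoin F x"
  unfolding field_adjoin_def by (rule hull_subset)

theorem theorem2p1:
  fixes lam :: "'a::{field,finite} fls alg_closure"
    and K K_inf L :: "'a fls alg_closure set"
    and D :: "nat \<Rightarrow> 'a fls alg_closure \<Rightarrow> 'a fls alg_closure"
  defines "K \<equiv> to_ac ` rational_functions"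
    and "K_inf \<equiv> range to_ac"
    and "L \<equiv> field_adjoin K_inf lam"
  assumes lam_sep: "lam \<in> separable_closure K"
    and lam_root: "lam ^ (CARD('a) - 1) = - to_ac theta"
    and D_higher: "higher_derivation_on (range (\<lambda>c. to_ac (fls_const c))) L D"
    and D_extends: "\<And>n f. D n (to_ac f) = to_ac (fls_hyperderiv n f)"
  shows "hypertranscendental K D (carlitz_period lam)"
proof -
  define q where "q = CARD('a)"
  have q: "2 \<le> q" by (simp add: q_def card_field_ge_2)
  have L_ac: "to_ac f \<in> L" for f using field_adjoin_superset[of lam K_inf] by (auto simp: L_def K_inf_def)
  have L_lam: "lam \<in> L" using field_adjoin_superset[of lam K_inf] by (auto simp: L_def)
  have L_mult: "x * y \<in> L" if "x \<in> L" "y \<in> L" for x y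
    using is_subfield_field_adjoin[of K_inf lam] that unfolding is_subfield_def L_def by blast
  have L_power: "x ^ n \<in> L" if "x \<in> L" for x n
    using L_ac[of 1] that by (induction n) (auto intro: L_mult)
  have D_mult: "D n (x * y) = (\<Sum>i\<le>n. D i x * D (n - i) y)" if "x \<in> L" "y \<in> L" for n x y
    using D_higher that unfolding higher_derivation_on_def by blast
  have D_0: "D 0 x = x" if "x \<in> L" for x
    using D_higher that unfolding higher_derivation_on_def by blast
  interpret leibniz "TYPE('a)"
  proof
    fix x y :: "'a fls"
    show "taylor (x * y) = taylor x * taylor y"
    proof (rule fps_ext)
      fix n
      have "to_ac (fls_hyperderiv n (x * y)) = to_ac (\<Sum>i\<le>n. fls_hyperderiv i x * fls_hyperderiv (n - i) y)"
        using D_mult[OF L_ac L_ac, of n x y] by (simp add: D_extends to_ac_sum flip: to_ac_mult)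
      then show "fps_nth (taylor (x * y)) n = fps_nth (taylor x * taylor y) n"
        by (simp add: taylor_def fps_mult_nth atLeast0AtMost)
    qed
  qed
  \<comment> \<open>The Taylor expansion on \<open>L\<close>; being multiplicative, it turns the
    equation for lam^q into one between power series.\<close>
  define T where "T x = Abs_fps (\<lambda>n. D n x)" for x
  have T_mult: "T (x * y) = T x * T y" if "x \<in> L" "y \<in> L" for x y
    using D_mult[OF that] by (simp add: T_def fps_eq_iff fps_mult_nth atLeast0AtMost)
  have T_power: "T (x ^ n) = T x ^ n" if "x \<in> L" for x n
  proof (induction n)
    case 0
    have "T (to_ac 1) = 1" by (simp only: T_def D_extends fls_hyperderiv_one) (auto simp: fps_eq_iff)
    then show ?case by simp
  next
    case (Suc n)
    then show ?case using T_mult[OF that L_power[OF that, of n]] by simp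
  qed
  have lam_q: "lam ^ q = to_ac (- theta) * lam"
  proof -
    have "lam ^ q = lam ^ (q - 1) * lam" using q by (metis Suc_diff_1 power_Suc2 zero_less_numeral order_less_le_trans)
    then show ?thesis using lam_root by (simp add: q_def)
  qed
  have lam_nz: "lam \<noteq> 0"
  proof
    assume "lam = 0"
    then have "to_ac theta = (0 :: 'a fls alg_closure)" using lam_root q by (simp add: q_def power_0_left)
    then show False by simp
  qed
  have frob: "frobenius_exponent CHAR('a fls alg_closure) q"
    using finite_field_frobenius_exponent[where 'a = 'a] by (simp add: q_def)
  text \<open>Differentiating \<open>lam\<^sup>q = - theta * lam\<close> gives a recursion for the quotients \<open>D n lam / lam\<close>.\<close>
  have "\<exists>v. v \<in> rational_functions \<and> D n lam = lam * to_ac v" for n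
  proof (induction n rule: less_induct)
    case (less n)
    show ?case
    proof (cases n)
      case 0
      then show ?thesis using D_0[OF L_lam] by (intro exI[of _ 1]) (simp add: Rat_1)
    next
      case (Suc m)
      obtain v where v: "v \<in> rational_functions" "D m lam = lam * to_ac v" using less Suc by blast
      have "T lam ^ (q ^ 1) = T (to_ac (- theta)) * T lam"
        using T_power[OF L_lam, of q] T_mult[OF L_ac L_lam, of "- theta"] by (simp add: lam_q)
      moreover have "T (to_ac (- theta)) = - fps_const (to_ac theta) - fps_X"
      proof -
        have neg: "fls_hyperderiv i (- theta :: 'a fls) = - fls_hyperderiv i theta" for i
          using hyperderiv_diff[of i 0 theta] hyperderiv_diff[of i 0 0] by simp
        have "D i (to_ac (- theta)) = - to_ac (if i = 0 then theta else if i = 1 then 1 else 0)" for i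
          unfolding D_extends neg by (simp only: fls_hyperderiv_theta to_ac_minus)
        then show ?thesis unfolding T_def by (simp only:) (auto simp: fps_eq_iff)
      qed
      ultimately have "fps_nth (T lam ^ (q ^ 1)) n = fps_nth (- (fps_const (to_ac theta) * T lam) - fps_X * T lam) n"
        by (simp add: left_diff_distrib)
      also have "\<dots> = - (to_ac theta * D n lam) - D m lam" by (simp add: T_def Suc)
      also have "fps_nth (T lam ^ (q ^ 1)) n = (if q dvd n then D (n div q) lam ^ q else 0)"
        unfolding fps_nth_power_frobenius[OF frob] by (simp add: T_def)
      finally have rec: "(if q dvd n then D (n div q) lam ^ q else 0) = - (to_ac theta * D n lam) - D m lam" .
      obtain v' where v': "v' \<in> rational_functions" "D (n div q) lam = lam * to_ac v'"
        using less[of "n div q"] Suc q by (auto simp: div_less_dividend)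
      define x where "x = - inverse theta * (v + (if q dvd n then - theta * v' ^ q else 0))"
      have theta_x: "theta * x = - (v + (if q dvd n then - theta * v' ^ q else 0))"
        unfolding x_def mult.assoc[symmetric] by simp
      have "to_ac theta * D n lam = - D m lam - (if q dvd n then D (n div q) lam ^ q else 0)"
        unfolding rec by simp
      also have "\<dots> = lam * to_ac (theta * x)"
        unfolding v v' power_mult_distrib lam_q theta_x by (simp add: distrib_left right_diff_distrib mult_ac)
      finally have "to_ac theta * D n lam = to_ac theta * (lam * to_ac x)" by (simp add: mult_ac)
      then have "D n lam = lam * to_ac x" by simp
      moreover have "x \<in> rational_functions"
        unfolding x_def using v v' Rat_emb[of "[:0, 1:] :: 'a poly"] Rat_0
        by (auto simp: emb_X intro!: Rat_mult Rat_uminus Rat_add Rat_diff Rat_inverse Rat_power)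
      ultimately show ?thesis by blast
    qed
  qed
  then obtain v where v: "\<And>n. v n \<in> rational_functions" "\<And>n. D n lam = lam * to_ac (v n)" by metis
  have v0: "v 0 = 1" using v(2)[of 0] D_0[OF L_lam] lam_nz by simp
  define per where "per = carlitz_period lam"
  have per: "per = lam * to_ac (theta * carlitz_prod)"
    unfolding per_def carlitz_period_def prodinf_carlitz_prod ..
  show ?thesis
    unfolding hypertranscendental_def algebraically_independent_def per_def[symmetric]
  proof (intro allI impI notI)
    fix P :: "(nat \<Rightarrow>\<^sub>0 nat) \<Rightarrow>\<^sub>0 'a fls alg_closure"
    assume "(\<forall>m. Poly_Mapping.lookup P m \<in> K) \<and> P \<noteq> 0" and eval: "mpoly_eval (\<lambda>n. D n per) P = 0"
    then have P: "\<And>m. Poly_Mapping.lookup P m \<in> K" "P \<noteq> 0" by auto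
    define E where "E = Poly_Mapping.keys P"
    have E: "finite E" "E \<noteq> {}" using P(2) by (auto simp: E_def)
    define V where "V = (\<Union>m\<in>E. Poly_Mapping.keys m)"
    have "finite V" using E by (auto simp: V_def)
    define r where "r = Suc (Max (insert 0 V))"
    have V: "i < r" if "m \<in> E" "i \<in> Poly_Mapping.keys m" for m i
      using that \<open>finite V\<close> by (auto simp: r_def V_def less_Suc_eq_le intro!: Max_ge)
    have r: "0 < r" by (simp add: r_def)
    define wd where "wd m = (\<Sum>i<r. Poly_Mapping.lookup m i)" for m :: "nat \<Rightarrow>\<^sub>0 nat"
    define d where "d = (\<Sum>m\<in>E. wd m)"
    have E_exponents: "Poly_Mapping.lookup m \<in> exponents r d" if "m \<in> E" for m
    proof -
      have "wd m \<le> d" unfolding d_def using E that by (intro member_le_sum) auto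
      moreover have "Poly_Mapping.lookup m i = 0" if "r \<le> i" for i
        using V[OF \<open>m \<in> E\<close>, of i] that by (meson in_keys_iff not_le)
      ultimately show ?thesis by (simp add: exponents_def wd_def)
    qed
    have "\<forall>m. \<exists>c. c \<in> rational_functions \<and> Poly_Mapping.lookup P m = to_ac c"
      using P(1) by (auto simp: K_def)
    then obtain c where c: "\<And>m. c m \<in> rational_functions" "\<And>m. Poly_Mapping.lookup P m = to_ac (c m)" by metis
    \<comment> \<open>The level \<open>r\<close> itself can serve as \<open>M\<close>: r <= q^r
      makes the points of the tail constant for all orders below r.\<close>
    have M: "1 \<le> r" "r \<le> CARD('a) ^ r" using r less_card_power[of r r, where 'a = 'a] by auto
    \<comment> \<open>The period is \<open>lam\<close>, times a rational function, times
      \<open>carlitz_tail r\<close>. \<open>U\<close> is the Taylor expansion of the first two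
      factors, divided by \<open>lam\<close>. Its coefficients are rational functions, and its
      nonzero constant term makes the change from tail derivatives to derivatives of the period
      invertible.\<close>
    define U where "U = Abs_fps v * taylor (theta * inverse (carlitz_partial r))"
    define u where "u = fps_nth U"
    have "U \<in> RatF" unfolding U_def taylor_mult
      using v by (intro RatF_mult RatF_taylor_theta RatF_taylor_inverse_partial) (simp add: RatF_def)
    then have u: "u n \<in> rational_functions" for n by (simp add: u_def RatF_def)
    have u0: "u 0 \<noteq> 0" using carlitz_partial_unit(1)[of r, where 'a = 'a]
      by (simp add: u_def U_def v0 taylor_def fls_hyperderiv_0)
    define y where "y n = (\<Sum>i\<le>n. u (n - i) * tail_deriv r i)" for n
    have Dper: "D n per = lam * to_ac (y n)" for n
    proof -
      have "theta * carlitz_prod = theta * inverse (carlitz_partial r) * (carlitz_tail r :: 'a fls)"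
        using carlitz_partial_unit(1)[of r, where 'a = 'a] by (simp add: carlitz_tail_def)
      then have "Abs_fps v * taylor (theta * carlitz_prod) = taylor (carlitz_tail r) * U"
        by (simp only: taylor_mult U_def mult_ac)
      then have "fps_nth (Abs_fps v * taylor (theta * carlitz_prod)) n = y n"
        by (simp add: fps_mult_nth y_def u_def atLeast0AtMost) (simp add: taylor_def tail_deriv_def mult.commute)
      moreover have "D n per = lam * to_ac (fps_nth (Abs_fps v * taylor (theta * carlitz_prod)) n)"
        unfolding per D_mult[OF L_lam L_ac]
        by (simp only: v(2) D_extends fps_mult_nth atLeast0AtMost)
          (simp add: taylor_def to_ac_sum sum_distrib_left mult.assoc)
      ultimately show ?thesis by simp
    qed
    define c' where "c' m = c m * (- theta) ^ (wd m div (q - 1))" for m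
    have term_eq: "Poly_Mapping.lookup P m * (\<Prod>i\<in>Poly_Mapping.keys m. D i per ^ Poly_Mapping.lookup m i)
        = lam ^ (wd m mod (q - 1)) * to_ac (c' m * monomial_val r y (Poly_Mapping.lookup m))" if m: "m \<in> E" for m
    proof -
      have "(\<Prod>i\<in>Poly_Mapping.keys m. D i per ^ Poly_Mapping.lookup m i) = (\<Prod>i<r. D i per ^ Poly_Mapping.lookup m i)"
        using V[OF m] by (intro prod.mono_neutral_left) (auto simp: in_keys_iff)
      also have "\<dots> = lam ^ wd m * to_ac (monomial_val r y (Poly_Mapping.lookup m))"
        by (simp add: Dper power_mult_distrib prod.distrib monomial_val_def to_ac_prod wd_def power_sum)
      also have "lam ^ wd m = lam ^ (wd m mod (q - 1) + (q - 1) * (wd m div (q - 1)))" by simp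
      also have "\<dots> = lam ^ (wd m mod (q - 1)) * (lam ^ (q - 1)) ^ (wd m div (q - 1))"
        by (simp only: power_add power_mult)
      also have "lam ^ (q - 1) = to_ac (- theta)" using lam_root by (simp add: q_def)
      finally show ?thesis by (simp add: c c'_def mult_ac)
    qed
    \<comment> \<open>A monomial of total degree \<open>wd m\<close> carries lam^(wd m), and lam^(q
      - 1) = -theta. Sorting by \<open>wd m\<close> modulo q - 1 yields a linear relation between
      powers of \<open>lam\<close>, so each class vanishes by itself.\<close>
    define G where "G s = (\<Sum>m\<in>{m \<in> E. wd m mod (q - 1) = s}. c' m * monomial_val r y (Poly_Mapping.lookup m))" for s
    have "0 = (\<Sum>m\<in>E. lam ^ (wd m mod (q - 1)) * to_ac (c' m * monomial_val r y (Poly_Mapping.lookup m)))"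
      using eval unfolding mpoly_eval_def E_def[symmetric] by (simp add: term_eq)
    also have "\<dots> = (\<Sum>s<q - 1. \<Sum>m\<in>{m \<in> E. wd m mod (q - 1) = s}. lam ^ (wd m mod (q - 1)) * to_ac (c' m * monomial_val r y (Poly_Mapping.lookup m)))"
      using E q by (intro sum.group[symmetric]) auto
    also have "\<dots> = (\<Sum>s<q - 1. lam ^ s * to_ac (G s))"
      by (intro sum.cong refl) (simp add: G_def to_ac_sum sum_distrib_left)
    finally have G0: "G s = 0" if "s < q - 1" for s
      using root_powers_independent[OF lam_root, of G s] that by (simp add: q_def)
    obtain m0 where m0: "m0 \<in> E" using E by blast
    define E0 where "E0 = {m \<in> E. wd m mod (q - 1) = wd m0 mod (q - 1)}"
    have E0: "finite E0" "m0 \<in> E0" "E0 \<subseteq> E" using E m0 by (auto simp: E0_def)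
    have rel: "(\<Sum>m\<in>E0. c' m * monomial_val r y (Poly_Mapping.lookup m)) = 0"
      using G0[of "wd m0 mod (q - 1)"] q by (simp add: G_def E0_def)
    have "c' m \<in> rational_functions" for m
      unfolding c'_def using Rat_emb[of "[:0, 1:] :: 'a poly"] c
      by (intro Rat_mult Rat_power Rat_uminus) (auto simp: emb_X)
    then have "\<exists>D. D \<noteq> 0 \<and> (\<forall>m\<in>E0. \<exists>a. emb D * c' m = emb a)"
      by (intro common_denominator E0)
    then obtain D1 where D1: "D1 \<noteq> 0" "\<forall>m\<in>E0. \<exists>a. emb D1 * c' m = emb a" by (elim exE conjE)
    from bchoice[OF D1(2)] obtain a where a: "\<And>m. m \<in> E0 \<Longrightarrow> emb D1 * c' m = emb (a m)" by auto
    have "\<exists>D. D \<noteq> 0 \<and> (\<forall>n\<in>{..<r}. \<exists>a. emb D * u n = emb a)"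
      by (intro common_denominator u) simp
    then obtain D0 where D0: "D0 \<noteq> 0" "\<forall>n\<in>{..<r}. \<exists>a. emb D0 * u n = emb a" by (elim exE conjE)
    from bchoice[OF D0(2)] obtain uu where uu: "\<And>n. n < r \<Longrightarrow> emb D0 * u n = emb (uu n)" by auto
    have inj: "inj_on Poly_Mapping.lookup E0" by (intro inj_onI) (simp add: poly_mapping_eqI)
    \<comment> \<open>\<open>tail_deriv_independent\<close> indexes monomials by functions;
      \<open>Abs_poly_mapping\<close> undoes \<open>lookup\<close> on them.\<close>
    define ca where "ca b = a (Poly_Mapping.Abs_poly_mapping b)" for b
    have "ca (Poly_Mapping.lookup m0) = 0"
    proof (rule tail_deriv_independent[where u = u and uu = uu and M = r and r = r and d = d and ?D0.0 = D0
          and A = "Poly_Mapping.lookup ` E0" and c = ca and a = "Poly_Mapping.lookup m0"])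
      show "0 < r" "1 \<le> r" "r \<le> CARD('a) ^ r" "D0 \<noteq> 0" "u 0 \<noteq> 0" by (fact r M D0(1) u0)+
      show "emb D0 * u n = emb (uu n)" if "n < r" for n using that by (rule uu)
      show "finite (Poly_Mapping.lookup ` E0)" using E0 by simp
      show "Poly_Mapping.lookup ` E0 \<subseteq> exponents r d" using E_exponents E0 by auto
      show "Poly_Mapping.lookup m0 \<in> Poly_Mapping.lookup ` E0" using E0 by simp
      have "(\<Sum>b\<in>Poly_Mapping.lookup ` E0. emb (ca b) * monomial_val r y b)
          = (\<Sum>m\<in>E0. emb D1 * (c' m * monomial_val r y (Poly_Mapping.lookup m)))"
        unfolding sum.reindex[OF inj] by (intro sum.cong refl) (simp add: ca_def lookup_inverse mult.assoc flip: a)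
      also have "\<dots> = 0" unfolding sum_distrib_left[symmetric] rel by simp
      finally show "(\<Sum>b\<in>Poly_Mapping.lookup ` E0. emb (ca b)
          * monomial_val r (\<lambda>n. \<Sum>i\<le>n. u (n - i) * tail_deriv r i) b) = 0"
        by (simp add: y_def[abs_def])
    qed
    then have "emb D1 * c' m0 = 0" using a[OF E0(2)] by (simp add: ca_def lookup_inverse)
    then have "c m0 = 0" using D1(1) by (simp add: c'_def)
    then have "Poly_Mapping.lookup P m0 = 0" by (simp add: c)
    with m0 show False by (simp add: E_def in_keys_iff)
  qed
qed

end
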